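(* In the setting described in the context, assume $b(0)>0$ is sufficiently small, $\frac14\le c(0)\le1$, and $A(\tau),B(\tau),M_1(\tau)\le\beta^{-\kappa/2}(\tau)$ for $0\le\tau\le T$. Let $w=v_{abc}+\xi$ be a solution of $$w_\tau=\Big(\partial_y^2-\tfrac14(a^2+a_\tau)y^2-\big(\tfrac2{p-1}-\tfrac12\big)a\Big)w+e^{\frac a4(p-1)y^2}|w|^{p-1}w$$ with $\xi\perp\phi_{0a},\phi_{2a}$ in $L^2(\mathbb R)$ and $a=2c-\frac12$. Then for $0\le\tau\le T$ the parameters $b$ and $c$ satisfy $$b_\tau=-\frac{2(3p-1)}{(p-1)^2}b^2+2b(c-a)+\mathcal R_b(\xi,b,c),$$ $$\frac{c_\tau}{c}=2(c-a)-\frac2{p-1}b+\mathcal R_c(\xi,b,c),$$ where the remainders $\mathcal R_b$ and $\mathcal R_c$ are of the order $$O\big(\beta^3+\beta^3M_1(1+A)+\beta^4M_1^2+\beta^{2p}M_1^p\big)$$ and satisfy $\mathcal R_b(0,b,c),\ \mathcal R_c(0,b,c)=O(b^3)$.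
   Context: Fix $p>1$. $a(\tau),b(\tau),c(\tau)$ are positive $C^1$ functions with $a=2c-\frac12$; $\xi(y,\tau)$ is even in $y$. $v_{abc}(y):=\big(\frac{2c}{p-1+by^2}\big)^{\frac1{p-1}}e^{-\frac a4y^2}$, $\phi_{0a}:=e^{-\frac a4y^2}$, $\phi_{2a}:=(1-ay^2)e^{-\frac a4y^2}$, $\langle y\rangle:=(1+y^2)^{1/2}$. (The equation for $w$ arises from $u_t=\partial_x^2u+|u|^{p-1}u$ via $w(y,\tau)=e^{-\frac a4y^2}\lambda^{-\frac2{p-1}}(t)u(x,t)$, $y=\lambda(t)x$, $\tau=\int_0^t\lambda^2(s)ds$, $a=\lambda^{-3}\partial_t\lambda$.) Define $$\beta(\tau):=\frac1{\frac1{b(0)}+\frac{4p}{(p-1)^2}\tau},\qquad \kappa:=\min\{\tfrac12,\tfrac{p-1}2\},$$ $$M_1(T'):=\max_{\tau\le T'}\beta^{-2}(\tau)\|\langle y\rangle^{-3}e^{\frac a4y^2}\xi(\tau)\|_\infty,$$ $$A(T'):=\max_{\tau\le T'}\beta^{-2}(\tau)\Big|a(\tau)-\tfrac12+\tfrac{2b(\tau)}{p-1}\Big|,\qquad B(T'):=\max_{\tau\le T'}\beta^{-(1+\kappa)}(\tau)|b(\tau)-\beta(\tau)|.$$ All implied constants depend only on $p$. *)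

theory Defs
  imports "HOL-Analysis.Analysis"
begin

definition C1_on_interval :: "real \<Rightarrow> (real \<Rightarrow> real) \<Rightarrow> (real \<Rightarrow> real) \<Rightarrow> bool" where
  "C1_on_interval T f f' \<longleftrightarrow>
     (\<forall>\<tau>\<in>{0..T}. (f has_real_derivative f' \<tau>) (at \<tau> within {0..T})) \<and> continuous_on {0..T} f'"

definition bracket :: "real \<Rightarrow> real" where
  "bracket y = sqrt (1 + y\<^sup>2)"

definition profile :: "real \<Rightarrow> real \<Rightarrow> real \<Rightarrow> real \<Rightarrow> real \<Rightarrow> real" where
  "profile p a b c y = (2 * c / (p - 1 + b * y\<^sup>2)) powr (1 / (p - 1)) * exp (- (a / 4) * y\<^sup>2)"

definition phi0 :: "real \<Rightarrow> real \<Rightarrow> real" where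
  "phi0 a y = exp (- (a / 4) * y\<^sup>2)"

definition phi2 :: "real \<Rightarrow> real \<Rightarrow> real" where
  "phi2 a y = (1 - a * y\<^sup>2) * exp (- (a / 4) * y\<^sup>2)"

definition beta :: "real \<Rightarrow> real \<Rightarrow> real \<Rightarrow> real" where
  "beta p b0 \<tau> = 1 / (1 / b0 + 4 * p / (p - 1)\<^sup>2 * \<tau>)"

definition kappa :: "real \<Rightarrow> real" where
  "kappa p = min (1/2) ((p - 1) / 2)"

definition weighted :: "(real \<Rightarrow> real) \<Rightarrow> (real \<Rightarrow> real \<Rightarrow> real) \<Rightarrow> real \<Rightarrow> real \<Rightarrow> real" where
  "weighted a \<xi> y \<tau> = bracket y powr (-3) * exp (a \<tau> / 4 * y\<^sup>2) * \<xi> y \<tau>"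

text \<open>Real suprema carry no information on unbounded sets, so \<open>M1\<close> must be used together with
  boundedness of \<open>weighted a \<xi>\<close> on \<open>UNIV \<times> {0..T}\<close>. For \<open>A\<close> and \<open>B\<close> the suprema are over a compact
  interval and are attained whenever the parameters are continuous.\<close>

definition M1 :: "real \<Rightarrow> real \<Rightarrow> (real \<Rightarrow> real) \<Rightarrow> (real \<Rightarrow> real \<Rightarrow> real) \<Rightarrow> real \<Rightarrow> real" where
  "M1 p b0 a \<xi> T' =
     (SUP \<tau>\<in>{0..T'}. beta p b0 \<tau> powr (-2) * (SUP y. \<bar>weighted a \<xi> y \<tau>\<bar>))"

definition A :: "real \<Rightarrow> (real \<Rightarrow> real) \<Rightarrow> (real \<Rightarrow> real) \<Rightarrow> real \<Rightarrow> real" where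
  "A p a b T' =
     (SUP \<tau>\<in>{0..T'}. beta p (b 0) \<tau> powr (-2) * \<bar>a \<tau> - 1/2 + 2 * b \<tau> / (p - 1)\<bar>)"

definition B :: "real \<Rightarrow> (real \<Rightarrow> real) \<Rightarrow> real \<Rightarrow> real" where
  "B p b T' =
     (SUP \<tau>\<in>{0..T'}. beta p (b 0) \<tau> powr (- (1 + kappa p)) * \<bar>b \<tau> - beta p (b 0) \<tau>\<bar>)"

definition potential :: "real \<Rightarrow> real \<Rightarrow> real \<Rightarrow> real \<Rightarrow> real" where
  "potential p a a1 y = 1/4 * (a\<^sup>2 + a1) * y\<^sup>2 + (2 / (p - 1) - 1/2) * a"

definition nonlinearity :: "real \<Rightarrow> real \<Rightarrow> real \<Rightarrow> real \<Rightarrow> real" where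
  "nonlinearity p a y w = exp (a / 4 * (p - 1) * y\<^sup>2) * \<bar>w\<bar> powr (p - 1) * w"

text \<open>Classical solutions, continuous up to both ends of the time interval; \<open>a'\<close> is the time
  derivative of \<open>a\<close>.\<close>

definition solves_w_equation ::
    "real \<Rightarrow> real \<Rightarrow> (real \<Rightarrow> real) \<Rightarrow> (real \<Rightarrow> real) \<Rightarrow> (real \<Rightarrow> real \<Rightarrow> real) \<Rightarrow> bool" where
  "solves_w_equation p T a a' w \<longleftrightarrow>
     continuous_on (UNIV \<times> {0..T}) (\<lambda>(y, \<tau>). w y \<tau>) \<and>
     (\<exists>wt wy wyy.
        continuous_on (UNIV \<times> {0<..<T}) (\<lambda>(y, \<tau>). wt y \<tau>) \<and>
        continuous_on (UNIV \<times> {0<..<T}) (\<lambda>(y, \<tau>). wyy y \<tau>) \<and>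
        (\<forall>y. \<forall>\<tau>\<in>{0<..<T}.
           ((\<lambda>s. w y s) has_real_derivative wt y \<tau>) (at \<tau>) \<and>
           ((\<lambda>z. w z \<tau>) has_real_derivative wy y \<tau>) (at y) \<and>
           ((\<lambda>z. wy z \<tau>) has_real_derivative wyy y \<tau>) (at y) \<and>
           wt y \<tau> = wyy y \<tau> - potential p (a \<tau>) (a' \<tau>) y * w y \<tau>
                      + nonlinearity p (a \<tau>) y (w y \<tau>)))"

text \<open>The remainders are functionals of a single state \<open>(\<xi>, b, c)\<close>, where \<open>\<xi>\<close> is a function of \<open>y\<close>
  only and \<open>a = 2 c - 1/2\<close>. They come from the two equations for \<open>(b_\<tau>, c_\<tau>)\<close> obtained by
  differentiating the orthogonality conditions in \<open>\<tau>\<close>. If the parameters have velocities \<open>b1\<close>, \<open>c1\<close>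
  (hence \<open>a1 = 2 c1\<close>) and \<open>w = v + \<xi>\<close> evolves by the equation above, then
  \<open>\<langle>w_\<tau> - v_\<tau>, \<phi>\<^sub>a\<rangle> + \<langle>\<xi>, (\<phi>\<^sub>a)_\<tau>\<rangle>\<close>, which is the time derivative of \<open>\<langle>\<xi>, \<phi>\<^sub>a\<rangle>\<close>, is the integral
  below. The two space derivatives are moved from \<open>w\<close> to \<open>\<phi>\<^sub>a\<close>, so that the integral makes sense for
  every measurable \<open>\<xi>\<close> of finite weighted norm. The derivatives in \<open>s\<close> at \<open>0\<close> are the chain rule
  along \<open>(a, b, c) + s (a1, b1, c1)\<close>.\<close>

definition orthogonality_rate ::
    "real \<Rightarrow> (real \<Rightarrow> real \<Rightarrow> real) \<Rightarrow> (real \<Rightarrow> real) \<Rightarrow> real \<Rightarrow> real \<Rightarrow> real \<Rightarrow> real \<Rightarrow> real" where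
  "orthogonality_rate p \<phi> \<xi> b c b1 c1 =
     (let a = 2 * c - 1/2; a1 = 2 * c1; w = (\<lambda>y. profile p a b c y + \<xi> y)
      in LINT y|lborel.
           w y * (deriv (deriv (\<phi> a)) y - potential p a a1 y * \<phi> a y)
         + nonlinearity p a y (w y) * \<phi> a y
         - deriv (\<lambda>s. profile p (a + s * a1) (b + s * b1) (c + s * c1) y) 0 * \<phi> a y
         + \<xi> y * deriv (\<lambda>s. \<phi> (a + s * a1) y) 0)"

definition velocity :: "real \<Rightarrow> (real \<Rightarrow> real) \<Rightarrow> real \<Rightarrow> real \<Rightarrow> real \<times> real" where
  "velocity p \<xi> b c = (THE (b1, c1).
     orthogonality_rate p phi0 \<xi> b c b1 c1 = 0 \<and> orthogonality_rate p phi2 \<xi> b c b1 c1 = 0)"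

definition R_b :: "real \<Rightarrow> (real \<Rightarrow> real) \<Rightarrow> real \<Rightarrow> real \<Rightarrow> real" where
  "R_b p \<xi> b c = fst (velocity p \<xi> b c)
     - (- (2 * (3 * p - 1) / (p - 1)\<^sup>2) * b\<^sup>2 + 2 * b * (c - (2 * c - 1/2)))"

definition R_c :: "real \<Rightarrow> (real \<Rightarrow> real) \<Rightarrow> real \<Rightarrow> real \<Rightarrow> real" where
  "R_c p \<xi> b c = snd (velocity p \<xi> b c) / c
     - (2 * (c - (2 * c - 1/2)) - 2 / (p - 1) * b)"

definition remainder_order :: "real \<Rightarrow> real \<Rightarrow> real \<Rightarrow> real \<Rightarrow> real" where
  "remainder_order p \<beta> m A0 =
     \<beta>^3 + \<beta>^3 * m * (1 + A0) + \<beta>^4 * m\<^sup>2 + \<beta> powr (2 * p) * m powr p"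

end

theory Submission
  imports Defs "HOL-Probability.Distributions"
begin

text \<open>Write \<open>w = exp (- a y\<^sup>2 / 4) (V + h)\<close> with \<open>V\<close> the algebraic factor of the profile and
  \<open>q = p - 1\<close>. Testing the equation against the two modes turns both orthogonality conditions into
  Gaussian integrals that are affine in the velocities \<open>(b\<^sub>\<tau>, c\<^sub>\<tau>)\<close>.

  The true velocities annihilate these integrals: the time derivative of the vanishing pairing of
  \<open>\<xi>\<close> with a mode is computed with a cutoff in \<open>y\<close>, because the derivatives of \<open>w\<close> are not controlled at
  infinity, and the cutoff error is \<open>O(R\<^sup>-\<^sup>2)\<close> uniformly in time.

  At a fixed time the \<open>2 \<times> 2\<close> linear system for the velocities has determinant close to
  \<open>- 2 Z\<^sup>2 V\<^sub>0\<^sup>2 / (q\<^sup>3 a c)\<close>, with \<open>Z\<close> the Gaussian mass and \<open>V\<^sub>0 = V(0)\<close>. Inserting the predicted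
  velocities and expanding \<open>V\<close> in \<open>b y\<^sup>2 / q\<close>, the exact Gaussian moments cancel through second order.
  What is left is \<open>O(b\<^sup>3)\<close> from the profile, \<open>O(b N)\<close> from the linear terms in \<open>h\<close> (the constant-coefficient
  part drops out by orthogonality) and \<open>O(N\<^sup>2 + N\<^sup>p)\<close> from the nonlinearity, where \<open>N\<close> is the weighted
  norm of \<open>\<xi>\<close>. Cramer's rule bounds the remainders, and \<open>b \<le> 2 \<beta>\<close>, \<open>N \<le> \<beta>\<^sup>2 M\<^sub>1\<close> give the claim.\<close>

section \<open>The two modes and the density of the orthogonality rate\<close>

text \<open>\<open>R_b\<close> and \<open>R_c\<close> are functionals of one frozen state, defined
  through a \<open>THE\<close>, and carry no information until the linear system is uniquely
  solvable at that state. So two independent facts are needed: the flow's own velocities solve the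
  system, and the system has a single solution, which is close to the prediction. Only the first
  fact uses the equation, with constants that depend on the whole flow. The second concerns one
  time, with constants depending only on p, and its instance \<xi> = 0 gives the b^3 bounds. Three
  obstacles shape the estimates. The expansion variable b y^2 / q is unbounded in y, so Taylor
  remainders must hold for all nonnegative arguments and are paid for by polynomial growth under the
  Gaussian. The amplitude decays to 0 in y, so the nonlinearity may not be estimated by dividing by
  it. A linear term of size N would be too large: V^q is the rational function 2 c / (q + b y^2),
  which differs from a constant by O(b y^2), and the predicted c-velocity, which multiplies h
  because the Gaussian moves with c, is O(b) as well.\<close>

definition mode :: "real \<Rightarrow> real \<Rightarrow> real \<Rightarrow> real" where
  "mode k a y = (1 - k * a * y\<^sup>2) * exp (- (a / 4) * y\<^sup>2)"

definition amplitude :: "real \<Rightarrow> real \<Rightarrow> real \<Rightarrow> real \<Rightarrow> real" where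
  "amplitude p b c y = (2 * c / (p - 1 + b * y\<^sup>2)) powr (1 / (p - 1))"

text \<open>The integrand of the orthogonality rate against \<open>mode k\<close> after the substitution
  \<open>w = exp (- a y\<^sup>2 / 4) (V + h)\<close>; of the terms with \<open>a\<^sub>\<tau> = 2 c\<^sub>\<tau>\<close> only the last summand survives,
  since the rate of the Gaussian in the profile cancels the \<open>V\<close>-part of the potential.\<close>

definition rate_density ::
    "real \<Rightarrow> real \<Rightarrow> real \<Rightarrow> real \<Rightarrow> real \<Rightarrow> real \<Rightarrow> real \<Rightarrow> real \<Rightarrow> real \<Rightarrow> real" where
  "rate_density p k a b c b1 c1 h y =
     exp (- (a / 2) * y\<^sup>2) *
       ((1 - k * a * y\<^sup>2) *
          (- (2 * a / (p - 1)) * (amplitude p b c y + h)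
           + \<bar>amplitude p b c y + h\<bar> powr (p - 1) * (amplitude p b c y + h)
           + b1 * amplitude p b c y * y\<^sup>2 / ((p - 1) * (p - 1 + b * y\<^sup>2))
           - c1 * amplitude p b c y / ((p - 1) * c))
        - 2 * a * k * (1 - a * y\<^sup>2) * (amplitude p b c y + h)
        + c1 * h * (k * a * y^4 - (1 + 2 * k) * y\<^sup>2))"

lemma phi0_eq_mode: "phi0 = mode 0"
  by (intro ext) (simp add: phi0_def mode_def)

lemma phi2_eq_mode: "phi2 = mode 1"
  by (intro ext) (simp add: phi2_def mode_def)

lemma profile_eq_amplitude: "profile p a b c y = amplitude p b c y * exp (- (a / 4) * y\<^sup>2)"
  by (simp add: profile_def amplitude_def)

lemma amplitude_pos:
  assumes "1 < p" "0 \<le> b" "0 < c"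
  shows "0 < amplitude p b c y"
proof -
  have "0 < p - 1 + b * y\<^sup>2" using assms by (simp add: add_pos_nonneg)
  then show ?thesis using assms by (simp add: amplitude_def)
qed

section \<open>Derivatives of the modes and of the profile\<close>

definition mode1 :: "real \<Rightarrow> real \<Rightarrow> real \<Rightarrow> real" where
  "mode1 k a y = (- 2 * k * a * y - a * y / 2 * (1 - k * a * y\<^sup>2)) * exp (- (a / 4) * y\<^sup>2)"

text \<open>The form suited to the potential: for k = 0 and k = 1 the bracket
  \<open>1 + 4 * k - 5 * k * a * y\<^sup>2\<close> is 1 or 5 times the polynomial of the mode, and
  the formula is the eigenvalue relation of -d^2/dy^2 + a^2 y^2 / 4 with eigenvalues a/2 and
  5a/2.\<close>

definition mode2 :: "real \<Rightarrow> real \<Rightarrow> real \<Rightarrow> real" where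
  "mode2 k a y = a\<^sup>2 * y\<^sup>2 / 4 * mode k a y
     - a / 2 * (1 + 4 * k - 5 * k * a * y\<^sup>2) * exp (- (a / 4) * y\<^sup>2)"

lemma mode_has_derivative: "(mode k a has_real_derivative mode1 k a y) (at y)"
  unfolding mode_def[abs_def] mode1_def
  by (auto intro!: derivative_eq_intros simp: field_simps power2_eq_square)

lemma mode1_has_derivative: "(mode1 k a has_real_derivative mode2 k a y) (at y)"
  unfolding mode1_def[abs_def] mode2_def mode_def
  by (auto intro!: derivative_eq_intros simp: field_simps power2_eq_square)

lemma deriv_deriv_mode: "deriv (deriv (mode k a)) y = mode2 k a y"
proof -
  have "deriv (mode k a) = mode1 k a"
    using mode_has_derivative by (intro ext DERIV_imp_deriv)
  then show ?thesis
    using mode1_has_derivative by (simp add: DERIV_imp_deriv)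
qed

lemma mode_parameter_derivative:
  assumes "(a has_real_derivative a1) (at t within S)"
  shows "((\<lambda>s. mode k (a s) y) has_real_derivative
           - a1 * (k * y\<^sup>2 * exp (- (a t / 4) * y\<^sup>2) + y\<^sup>2 / 4 * mode k (a t) y)) (at t within S)"
  unfolding mode_def
  by (rule derivative_eq_intros assms refl | simp add: field_simps)+

definition profile_rate :: "real \<Rightarrow> real \<Rightarrow> real \<Rightarrow> real \<Rightarrow> real \<Rightarrow> real \<Rightarrow> real \<Rightarrow> real \<Rightarrow> real" where
  "profile_rate p a b c a1 b1 c1 y =
     (c1 * amplitude p b c y / ((p - 1) * c)
      - b1 * amplitude p b c y * y\<^sup>2 / ((p - 1) * (p - 1 + b * y\<^sup>2))
      - a1 * y\<^sup>2 / 4 * amplitude p b c y) * exp (- (a / 4) * y\<^sup>2)"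

text \<open>Stated within an arbitrary set because it serves twice: for the affine perturbation at
  \<open>s = 0\<close> in the definition of the rate, and along the flow on \<open>{0..T}\<close>
  including the end points.\<close>

lemma profile_parameter_derivative:
  assumes "(a has_real_derivative a1) (at t within S)"
    and "(b has_real_derivative b1) (at t within S)"
    and "(c has_real_derivative c1) (at t within S)"
    and "1 < p" "0 \<le> b t" "0 < c t"
  shows "((\<lambda>s. profile p (a s) (b s) (c s) y) has_real_derivative
           profile_rate p (a t) (b t) (c t) a1 b1 c1 y) (at t within S)"
proof -
  have D: "0 < p - 1 + b t * y\<^sup>2" using assms by (simp add: add_pos_nonneg)
  define X where "X = 2 * c t / (p - 1 + b t * y\<^sup>2)"
  have X: "0 < X" using D assms by (simp add: X_def)
  have quot: "((\<lambda>s. 2 * c s / (p - 1 + b s * y\<^sup>2)) has_real_derivative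
      (2 * c1 * (p - 1 + b t * y\<^sup>2) - 2 * c t * (b1 * y\<^sup>2)) / ((p - 1 + b t * y\<^sup>2) * (p - 1 + b t * y\<^sup>2)))
      (at t within S)"
    using D by (auto intro!: derivative_eq_intros assms)
  have alg: "1 / q * (Y / (2 * C / d)) * ((2 * c1 * d - 2 * C * (b1 * x)) / (d * d))
      = c1 * Y / (q * C) - b1 * Y * x / (q * d)" if "d \<noteq> 0" "q \<noteq> 0" "C \<noteq> 0" for d q C Y x :: real
    using that by (simp add: field_simps)
  have amp: "((\<lambda>s. (2 * c s / (p - 1 + b s * y\<^sup>2)) powr (1 / (p - 1))) has_real_derivative
      (c1 * X powr (1 / (p - 1)) / ((p - 1) * c t)
      - b1 * X powr (1 / (p - 1)) * y\<^sup>2 / ((p - 1) * (p - 1 + b t * y\<^sup>2)))) (at t within S)"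
  proof (rule DERIV_cong[OF DERIV_chain'[OF quot, where g="\<lambda>x. x powr (1 / (p - 1))"]])
    show "((\<lambda>x. x powr (1 / (p - 1))) has_real_derivative 1 / (p - 1) * (X powr (1 / (p - 1)) / X))
      (at (2 * c t / (p - 1 + b t * y\<^sup>2)))"
      using X unfolding X_def[symmetric]
      by (auto intro!: derivative_eq_intros simp: powr_diff)
    show "1 / (p - 1) * (X powr (1 / (p - 1)) / X) *
        ((2 * c1 * (p - 1 + b t * y\<^sup>2) - 2 * c t * (b1 * y\<^sup>2)) /
          ((p - 1 + b t * y\<^sup>2) * (p - 1 + b t * y\<^sup>2)))
      = c1 * X powr (1 / (p - 1)) / ((p - 1) * c t)
      - b1 * X powr (1 / (p - 1)) * y\<^sup>2 / ((p - 1) * (p - 1 + b t * y\<^sup>2))"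
      using alg[of "p - 1 + b t * y\<^sup>2" "p - 1" "c t" "X powr (1 / (p - 1))" "y\<^sup>2"] D assms
      unfolding X_def by simp
  qed
  have "((\<lambda>s. exp (- (a s / 4) * y\<^sup>2)) has_real_derivative
      - (a1 * y\<^sup>2 / 4) * exp (- (a t / 4) * y\<^sup>2)) (at t within S)"
    by (auto intro!: derivative_eq_intros assms(1))
  from DERIV_mult[OF amp this] show ?thesis
    unfolding profile_def profile_rate_def amplitude_def X_def[symmetric]
    by (rule DERIV_cong) (simp add: algebra_simps)
qed

lemma profile_perturbation_rate:
  assumes "1 < p" "0 < b" "0 < c"
  shows "deriv (\<lambda>s. profile p (a + s * a1) (b + s * b1) (c + s * c1) y) 0 = profile_rate p a b c a1 b1 c1 y"
proof -
  have "((\<lambda>s. profile p (a + s * a1) (b + s * b1) (c + s * c1) y) has_real_derivative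
      profile_rate p (a + 0 * a1) (b + 0 * b1) (c + 0 * c1) a1 b1 c1 y) (at 0)"
    by (rule profile_parameter_derivative) (use assms in \<open>auto intro!: derivative_eq_intros\<close>)
  then show ?thesis by (simp add: DERIV_imp_deriv)
qed

lemma mode_perturbation_rate:
  "deriv (\<lambda>s. mode k (a + s * a1) y) 0
     = - a1 * (k * y\<^sup>2 * exp (- (a / 4) * y\<^sup>2) + y\<^sup>2 / 4 * mode k a y)"
proof -
  have "((\<lambda>s. mode k (a + s * a1) y) has_real_derivative
     - a1 * (k * y\<^sup>2 * exp (- ((a + 0 * a1) / 4) * y\<^sup>2) + y\<^sup>2 / 4 * mode k (a + 0 * a1) y)) (at 0)"
    by (rule mode_parameter_derivative) (auto intro!: derivative_eq_intros)
  then show ?thesis by (simp add: DERIV_imp_deriv)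
qed

text \<open>The weight exp (a (p - 1) y^2 / 4) compensates the degree p of homogeneity, so a
  Gaussian factor passes through with its first power only.\<close>

lemma nonlinearity_gauged:
  "nonlinearity p a y (H * exp (- (a / 4) * y\<^sup>2)) = \<bar>H\<bar> powr (p - 1) * H * exp (- (a / 4) * y\<^sup>2)"
proof -
  have "(exp (- (a / 4) * y\<^sup>2)) powr (p - 1) = exp (- (a / 4 * (p - 1) * y\<^sup>2))"
    by (simp add: powr_def)
  then have "exp (a / 4 * (p - 1) * y\<^sup>2) * exp (- (a / 4) * y\<^sup>2) powr (p - 1) = 1"
    by (simp add: exp_minus)
  then show ?thesis
    unfolding nonlinearity_def abs_mult abs_exp_cancel
    by (simp add: powr_mult mult.assoc mult.left_commute)
qed

text \<open>The part of \<open>mode2\<close> with factor a^2 y^2 / 4 cancels the same part of the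
  potential. On h, unlike on V, the potential and the moving mode contribute to the
  \<open>c1\<close>-terms with the same sign; together they leave the last summand of the
  density.\<close>

lemma rate_density_eq:
  assumes "h = exp (a / 4 * y\<^sup>2) * x"
  shows "(profile p a b c y + x) * (mode2 k a y - potential p a (2 * c1) y * mode k a y)
     + nonlinearity p a y (profile p a b c y + x) * mode k a y
     - profile_rate p a b c (2 * c1) b1 c1 y * mode k a y
     + x * (- (2 * c1) * (k * y\<^sup>2 * exp (- (a / 4) * y\<^sup>2) + y\<^sup>2 / 4 * mode k a y))
     = rate_density p k a b c b1 c1 h y"
proof -
  define e where "e = exp (- (a / 4) * y\<^sup>2)"
  define V where "V = amplitude p b c y"
  define N where "N = \<bar>V + h\<bar> powr (p - 1) * (V + h)"
  define r where "r = 1 / (p - 1)"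
  define B where "B = V * y\<^sup>2 / ((p - 1) * (p - 1 + b * y\<^sup>2))"
  define Q where "Q = V / ((p - 1) * c)"
  have x: "x = h * e" unfolding assms e_def by (simp add: exp_minus)
  have v: "profile p a b c y = V * e" by (simp add: profile_eq_amplitude V_def e_def)
  have n: "nonlinearity p a y (profile p a b c y + x) = N * e"
    using nonlinearity_gauged[of p a y "V + h"] unfolding v x N_def e_def by (simp add: algebra_simps)
  have ee: "exp (- (a / 2) * y\<^sup>2) = e * e" unfolding e_def by (simp add: exp_add[symmetric])
  have pr: "profile_rate p a b c (2 * c1) b1 c1 y = (c1 * Q - b1 * B - 2 * c1 * y\<^sup>2 / 4 * V) * e"
    unfolding profile_rate_def V_def[symmetric] e_def[symmetric] B_def Q_def by simp
  have y4: "y^4 = y\<^sup>2 * y\<^sup>2" by (simp add: power2_eq_square power4_eq_xxxx)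
  have r2: "2 / (p - 1) = 2 * r" by (simp add: r_def)
  have rd: "rate_density p k a b c b1 c1 h y = e * e * ((1 - k * a * y\<^sup>2) *
      (- (2 * a * r) * (V + h) + N + b1 * B - c1 * Q) - 2 * a * k * (1 - a * y\<^sup>2) * (V + h)
       + c1 * h * (k * a * y^4 - (1 + 2 * k) * y\<^sup>2))"
    unfolding rate_density_def V_def[symmetric] ee B_def Q_def r_def N_def by simp
  show ?thesis
    unfolding n
    unfolding rd pr v
    unfolding mode2_def mode_def potential_def e_def[symmetric] x y4 r2
    by (simp add: field_simps power2_eq_square)
qed

lemma orthogonality_rate_mode:
  assumes "1 < p" "0 < b" "0 < c"
  shows "orthogonality_rate p (mode k) \<xi> b c b1 c1 =
    (LINT y|lborel. rate_density p k (2 * c - 1/2) b c b1 c1 (exp ((2 * c - 1/2) / 4 * y\<^sup>2) * \<xi> y) y)"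
  unfolding orthogonality_rate_def Let_def deriv_deriv_mode profile_perturbation_rate[OF assms]
    mode_perturbation_rate
  by (intro Bochner_Integration.integral_cong refl rate_density_eq)

section \<open>Gaussian integrals\<close>

lemma gaussian_moment:
  assumes "0 < a"
  shows "has_bochner_integral lborel (\<lambda>y::real. exp (- (a / 2) * y\<^sup>2) * y ^ (2 * k))
           (sqrt (2 * pi / a) * (fact (2 * k) / ((2 * a) ^ k * fact k)))"
proof -
  \<comment> \<open>With variance 1/a the normal density is the Gaussian divided by its mass sqrt (2
    pi / a).\<close>
  define \<sigma> where "\<sigma> = 1 / sqrt a"
  have \<sigma>: "0 < \<sigma>" "\<sigma>\<^sup>2 = 1 / a" using assms by (auto simp: \<sigma>_def power_divide)
  have "has_bochner_integral lborel (\<lambda>y. sqrt (2 * pi / a) * (normal_density 0 \<sigma> y * (y - 0) ^ (2 * k)))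
     (sqrt (2 * pi / a) * (fact (2 * k) / ((2 / \<sigma>\<^sup>2) ^ k * fact k)))"
    by (intro has_bochner_integral_mult_right normal_moment_even \<sigma>)
  moreover have "(\<lambda>y. sqrt (2 * pi / a) * (normal_density 0 \<sigma> y * (y - 0) ^ (2 * k)))
      = (\<lambda>y. exp (- (a / 2) * y\<^sup>2) * y ^ (2 * k))"
    using assms by (intro ext) (simp add: normal_density_def \<sigma> field_simps)
  ultimately have "has_bochner_integral lborel (\<lambda>y. exp (- (a / 2) * y\<^sup>2) * y ^ (2 * k))
     (sqrt (2 * pi / a) * (fact (2 * k) / ((2 / \<sigma>\<^sup>2) ^ k * fact k)))"
    by (simp only:)
  then show ?thesis by (simp add: \<sigma>)
qed

definition gauss_mass :: "real \<Rightarrow> nat \<Rightarrow> real" where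
  "gauss_mass d n = (LINT y|lborel. exp (- d * y\<^sup>2) * (1 + y\<^sup>2) ^ n)"

lemma integrable_gauss_poly:
  assumes "0 < d"
  shows "integrable lborel (\<lambda>y::real. exp (- d * y\<^sup>2) * (1 + y\<^sup>2) ^ n)"
proof -
  have m: "integrable lborel (\<lambda>y::real. exp (- d * y\<^sup>2) * y ^ (2 * k))" for k
    using gaussian_moment[of "2 * d" k] assms by (simp add: has_bochner_integral_iff)
  have "(\<lambda>y::real. exp (- d * y\<^sup>2) * (1 + y\<^sup>2) ^ n)
      = (\<lambda>y. \<Sum>k\<le>n. of_nat (n choose k) * (exp (- d * y\<^sup>2) * y ^ (2 * k)))"
    by (simp add: add.commute[of 1] binomial_ring sum_distrib_left mult_ac flip: power_mult)
  then show ?thesis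
    by (simp only:) (intro Bochner_Integration.integrable_sum integrable_mult_right m)
qed

lemma gauss_mass_nonneg: "0 \<le> gauss_mass d n"
  unfolding gauss_mass_def by (intro Bochner_Integration.integral_nonneg) auto

lemma integrable_gauss_bounded:
  assumes "0 < d" "f \<in> borel_measurable lborel"
    and "\<And>y. \<bar>f y\<bar> \<le> D * (exp (- d * y\<^sup>2) * (1 + y\<^sup>2) ^ n)"
  shows "integrable lborel f" and "\<bar>LINT y|lborel. f y\<bar> \<le> D * gauss_mass d n"
proof -
  have i: "integrable lborel (\<lambda>y. D * (exp (- d * y\<^sup>2) * (1 + y\<^sup>2) ^ n))"
    using integrable_gauss_poly[OF assms(1)] by (rule integrable_mult_right)
  show f: "integrable lborel f"
    using i assms(2) by (rule Bochner_Integration.integrable_bound)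
      (use assms(3) in \<open>auto intro: order_trans[OF _ abs_ge_self]\<close>)
  have "\<bar>LINT y|lborel. f y\<bar> \<le> (LINT y|lborel. \<bar>f y\<bar>)"
    using integral_norm_bound[of lborel f] by simp
  also have "\<dots> \<le> (LINT y|lborel. D * (exp (- d * y\<^sup>2) * (1 + y\<^sup>2) ^ n))"
    using f i assms(3) by (intro integral_mono) auto
  finally show "\<bar>LINT y|lborel. f y\<bar> \<le> D * gauss_mass d n" by (simp add: gauss_mass_def)
qed

text \<open>With s = y^2 / R^2 the cutoff misses 1 by s (2 - s) \<le> 2 s inside the interval and by
  1 \<le> 2 s outside it. The factor y^2 costs one more power of 1 + y^2, whence
  \<open>Suc n\<close>.\<close>

lemma cutoff_integral_error:
  fixes f :: "real \<Rightarrow> real"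
  assumes "0 < d" "continuous_on UNIV f" "0 < R"
    and b: "\<And>y. \<bar>f y\<bar> \<le> D * (exp (- d * y\<^sup>2) * (1 + y\<^sup>2) ^ n)"
  shows "\<bar>integral {-R..R} (\<lambda>y. f y * (1 - y\<^sup>2 / R\<^sup>2)\<^sup>2) - (LINT y|lborel. f y)\<bar>
           \<le> 2 * D * gauss_mass d (Suc n) / R\<^sup>2"
proof -
  define g where "g y = indicator {-R..R} y * (f y * (1 - y\<^sup>2 / R\<^sup>2)\<^sup>2)" for y
  have fm: "f \<in> borel_measurable lborel"
    using borel_measurable_continuous_onI[OF assms(2)] by simp
  have gm: "g \<in> borel_measurable lborel" unfolding g_def using fm by measurable
  have err: "\<bar>g y - f y\<bar> \<le> \<bar>f y\<bar> * (2 * y\<^sup>2 / R\<^sup>2)" for y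
  proof (cases "\<bar>y\<bar> \<le> R")
    case True
    define s where "s = y\<^sup>2 / R\<^sup>2"
    have s: "0 \<le> s" "s \<le> 1" using True \<open>0 < R\<close> by (auto simp: s_def abs_le_square_iff[symmetric])
    have "g y - f y = - f y * (s * (2 - s))"
    proof -
      have "g y = f y * (1 - s)\<^sup>2" using True by (auto simp: g_def s_def indicator_def abs_le_iff)
      then show ?thesis by (simp add: power2_eq_square algebra_simps)
    qed
    moreover have "\<bar>s * (2 - s)\<bar> \<le> 2 * s" using s by (simp add: abs_mult mult_left_mono mult.commute)
    ultimately have "\<bar>g y - f y\<bar> \<le> \<bar>f y\<bar> * (2 * s)"
      by (simp add: abs_mult mult_left_mono)
    then show ?thesis by (simp add: s_def)
  next
    case False
    then have "R\<^sup>2 \<le> y\<^sup>2" using \<open>0 < R\<close> by (auto simp: abs_le_square_iff[symmetric])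
    then have "R\<^sup>2 \<le> 2 * y\<^sup>2" by (smt (verit) zero_le_power2)
    then have "1 \<le> 2 * y\<^sup>2 / R\<^sup>2" using \<open>0 < R\<close> by (simp add: field_simps)
    moreover have "g y = 0" using False by (auto simp: g_def indicator_def abs_le_iff)
    ultimately show ?thesis
      using mult_left_mono[of 1 "2 * y\<^sup>2 / R\<^sup>2" "\<bar>f y\<bar>"] by simp
  qed
  have D: "0 \<le> D" using b[of 0] by (simp add: order_trans[OF abs_ge_zero])
  have err': "\<bar>g y - f y\<bar> \<le> (2 * D / R\<^sup>2) * (exp (- d * y\<^sup>2) * (1 + y\<^sup>2) ^ Suc n)" for y
  proof -
    have "\<bar>f y\<bar> * (2 * y\<^sup>2 / R\<^sup>2) \<le> (D * (exp (- d * y\<^sup>2) * (1 + y\<^sup>2) ^ n)) * (2 * (1 + y\<^sup>2) / R\<^sup>2)"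
      by (intro mult_mono b divide_right_mono) (use D in auto)
    also have "\<dots> = (2 * D / R\<^sup>2) * (exp (- d * y\<^sup>2) * (1 + y\<^sup>2) ^ Suc n)"
      by (simp add: algebra_simps add_divide_distrib)
    finally show ?thesis using err[of y] by linarith
  qed
  have i: "integrable lborel f" by (rule integrable_gauss_bounded[OF assms(1) fm b])
  have ie: "integrable lborel (\<lambda>y. g y - f y)"
    by (rule integrable_gauss_bounded[OF assms(1) _ err']) (use gm fm in simp)
  from Bochner_Integration.integrable_add[OF ie i] have ig: "integrable lborel g" by simp
  have "integral {-R..R} (\<lambda>y. f y * (1 - y\<^sup>2 / R\<^sup>2)\<^sup>2) = (LINT y|lborel. g y)"
  proof -
    have "set_integrable lborel {-R..R} (\<lambda>y. f y * (1 - y\<^sup>2 / R\<^sup>2)\<^sup>2)"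
      using ig by (simp add: set_integrable_def g_def[abs_def])
    from set_borel_integral_eq_integral(2)[OF this] show ?thesis
      by (simp add: set_lebesgue_integral_def g_def)
  qed
  then have "integral {-R..R} (\<lambda>y. f y * (1 - y\<^sup>2 / R\<^sup>2)\<^sup>2) - (LINT y|lborel. f y)
     = (LINT y|lborel. g y - f y)" using ig i by simp
  also have "\<bar>\<dots>\<bar> \<le> (2 * D / R\<^sup>2) * gauss_mass d (Suc n)"
    by (rule integrable_gauss_bounded[OF assms(1) _ err']) (use gm fm in simp)
  finally show ?thesis by simp
qed

lemma interval_integral_gauss_bound:
  fixes f :: "real \<Rightarrow> real"
  assumes "0 < d" "continuous_on {-R..R} f" "0 \<le> D"
    and b: "\<And>y. \<bar>y\<bar> \<le> R \<Longrightarrow> \<bar>f y\<bar> \<le> D * (exp (- d * y\<^sup>2) * (1 + y\<^sup>2) ^ n)"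
  shows "\<bar>integral {-R..R} f\<bar> \<le> D * gauss_mass d n"
proof -
  define g where "g y = indicator {-R..R} y * f y" for y
  have si: "set_integrable lborel {-R..R} f"
    using borel_integrable_atLeastAtMost'[OF assms(2)] .
  then have ig: "integrable lborel g" by (simp add: set_integrable_def g_def[abs_def])
  have "integral {-R..R} f = (LINT y|lborel. g y)"
    using set_borel_integral_eq_integral(2)[OF si] by (simp add: set_lebesgue_integral_def g_def)
  also have "\<bar>\<dots>\<bar> \<le> D * gauss_mass d n"
  proof (rule integrable_gauss_bounded[OF assms(1)])
    show "g \<in> borel_measurable lborel" using ig by (rule borel_measurable_integrable)
    show "\<bar>g y\<bar> \<le> D * (exp (- d * y\<^sup>2) * (1 + y\<^sup>2) ^ n)" for y
      using b[of y] \<open>0 \<le> D\<close> by (cases "\<bar>y\<bar> \<le> R") (auto simp: g_def indicator_def abs_le_iff)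
  qed
  finally show ?thesis .
qed

section \<open>A Gaussian majorant of the rate density\<close>

lemma amplitude_le:
  assumes "1 < p" "0 \<le> b" "0 < c"
  shows "amplitude p b c y \<le> (2 * c / (p - 1)) powr (1 / (p - 1))"
proof -
  have "2 * c / (p - 1 + b * y\<^sup>2) \<le> 2 * c / (p - 1)"
    using assms by (intro divide_left_mono) (auto intro!: mult_pos_pos add_pos_nonneg)
  moreover have "0 < p - 1 + b * y\<^sup>2" using assms by (simp add: add_pos_nonneg)
  ultimately show ?thesis unfolding amplitude_def using assms
    by (intro powr_mono2) auto
qed

text \<open>The majorant sees the parameters only through \<open>L\<close> and the exponent of the
  Gaussian. One choice of \<open>D\<close> and \<open>n\<close> therefore serves all times of a
  flow, both for dominated convergence and for the cutoff error.\<close>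

lemma rate_density_bound:
  assumes "1 < p" and True: "1 \<le> L"
  shows "\<exists>D\<ge>0. \<exists>n. \<forall>k a b c b1 c1 h y.
     0 \<le> k \<and> k \<le> 1 \<and> 0 < a \<and> a \<le> L \<and> 0 \<le> b \<and> 0 < c \<and> 1 / c \<le> L \<and>
     amplitude p b c y \<le> L \<and> \<bar>b1\<bar> \<le> L \<and> \<bar>c1\<bar> \<le> L \<and> \<bar>h\<bar> \<le> L * (1 + y\<^sup>2)\<^sup>2 \<longrightarrow>
     \<bar>rate_density p k a b c b1 c1 h y\<bar> \<le> D * (exp (- (a / 2) * y\<^sup>2) * (1 + y\<^sup>2) ^ n)"
proof -
  define q where "q = p - 1"
  have q: "0 < q" using assms by (simp add: q_def)
  \<comment> \<open>h grows like (1 + y^2)^2, so the nonlinearity grows like (1 + y^2)^(2 p);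
    \<open>m\<close> rounds this exponent up.\<close>
  define m where "m = nat \<lceil>2 * p\<rceil>"
  \<comment> \<open>The summands of \<open>D1\<close>, and likewise those of \<open>D\<close>, bound
    the summands of the density in the order in which they occur there.\<close>
  define D1 where "D1 = (2 * L / q) * (2 * L) + (2 * L) powr p + L * L / (q * q) + L * L * L / q"
  define D where "D = (L + 1) * D1 + 2 * L * (L + 1) * (2 * L) + L * L * (L + 3)"
  have D1: "0 \<le> D1" using True q by (simp add: D1_def)
  have D0: "0 \<le> D" using True D1 by (simp add: D_def)
  show ?thesis
  proof (intro exI[of _ D] conjI exI[of _ "m + 4"] allI impI D0, elim conjE)
    fix k a b c b1 c1 h y :: real
    assume H: "0 \<le> k" "k \<le> 1" "0 < a" "a \<le> L" "0 \<le> b" "0 < c" "1 / c \<le> L" 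
      "amplitude p b c y \<le> L" "\<bar>b1\<bar> \<le> L" "\<bar>c1\<bar> \<le> L" "\<bar>h\<bar> \<le> L * (1 + y\<^sup>2)\<^sup>2"
    define s where "s = 1 + y\<^sup>2"
    define V where "V = amplitude p b c y"
    have s: "1 \<le> s" "y\<^sup>2 \<le> s" by (auto simp: s_def)
    have V: "0 < V" "V \<le> L" using amplitude_pos[OF assms(1), of b c y] H by (auto simp: V_def)
    have pw: "s ^ i \<le> s ^ (m + 3)" if "i \<le> m + 3" for i
      using s that by (intro power_increasing) auto
    have d: "q \<le> q + b * y\<^sup>2" "0 < q + b * y\<^sup>2" using H q by (auto simp: add_pos_nonneg)
    have W: "\<bar>V + h\<bar> \<le> 2 * L * s\<^sup>2"
    proof -
      have "L * 1 \<le> L * s\<^sup>2" using s True by (intro mult_left_mono one_le_power) auto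
      moreover have "\<bar>h\<bar> \<le> L * s\<^sup>2" using H(11) by (simp add: s_def)
      ultimately show ?thesis using V by linarith
    qed
    have P: "\<bar>1 - k * a * y\<^sup>2\<bar> \<le> (L + 1) * s" if k: "0 \<le> k" "k \<le> 1" for k
    proof -
      have "k * a \<le> 1 * L" using k H by (intro mult_mono) auto
      then have "k * a * y\<^sup>2 \<le> 1 * L * s" "0 \<le> k * a * y\<^sup>2"
        using k H s True by (auto intro!: mult_mono)
      then show ?thesis using s True by (simp add: algebra_simps)
    qed
    have N: "\<bar>\<bar>V + h\<bar> powr (p - 1) * (V + h)\<bar> \<le> (2 * L) powr p * s ^ m"
    proof -
      have "\<bar>\<bar>V + h\<bar> powr (p - 1) * (V + h)\<bar> = \<bar>V + h\<bar> powr p"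
        by (cases "V + h = 0") (simp_all add: abs_mult powr_mult_base[symmetric] powr_diff)
      also have "\<dots> \<le> (2 * L * s\<^sup>2) powr p" using W assms by (intro powr_mono2) auto
      also have "\<dots> = (2 * L) powr p * s powr (2 * p)"
        using True s by (simp add: powr_mult powr_powr flip: powr_numeral)
      also have "s powr (2 * p) \<le> s powr (real m)"
        using s assms unfolding m_def by (intro powr_mono) auto
      also have "s powr (real m) = s ^ m" using s by (simp add: powr_realpow)
      finally show ?thesis using True by (simp add: mult_left_mono)
    qed
    have c1b: "\<bar>c1 * V / (q * c)\<bar> \<le> L * L * L / q"
    proof -
      have "\<bar>c1 * V / (q * c)\<bar> = \<bar>c1\<bar> * V * (1 / c) / q" using V q H by (simp add: abs_mult)
      also have "\<dots> \<le> L * L * L / q"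
        using H V q True by (intro divide_right_mono mult_mono) auto
      finally show ?thesis .
    qed
    have b1b: "\<bar>b1 * V * y\<^sup>2 / (q * (q + b * y\<^sup>2))\<bar> \<le> L * L / (q * q) * s"
    proof -
      have "\<bar>b1 * V * y\<^sup>2 / (q * (q + b * y\<^sup>2))\<bar> = \<bar>b1\<bar> * V * y\<^sup>2 / (q * (q + b * y\<^sup>2))"
        using V q d by (simp add: abs_mult)
      also have "\<dots> \<le> (L * L * s) / (q * q)"
        using H V q True s d by (intro frac_le mult_mono) auto
      finally show ?thesis by simp
    qed
    define I where "I = - (2 * a / q) * (V + h) + \<bar>V + h\<bar> powr (p - 1) * (V + h)
           + b1 * V * y\<^sup>2 / (q * (q + b * y\<^sup>2)) - c1 * V / (q * c)"
    have I: "\<bar>I\<bar> \<le> D1 * s ^ (m + 3)"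
    proof -
      have "\<bar>(2 * a / q) * (V + h)\<bar> \<le> (2 * L / q) * (2 * L * s\<^sup>2)"
        unfolding abs_mult using H q W True by (intro mult_mono) (auto intro: divide_right_mono)
      also have "\<dots> \<le> (2 * L / q) * (2 * L * s ^ (m + 3))"
        using q True by (intro mult_left_mono pw) auto
      finally have 1: "\<bar>(2 * a / q) * (V + h)\<bar> \<le> (2 * L / q) * (2 * L) * s ^ (m + 3)" by simp
      have 2: "\<bar>\<bar>V + h\<bar> powr (p - 1) * (V + h)\<bar> \<le> (2 * L) powr p * s ^ (m + 3)"
        by (rule order_trans[OF N]) (auto intro!: mult_left_mono pw)
      have 3: "\<bar>b1 * V * y\<^sup>2 / (q * (q + b * y\<^sup>2))\<bar> \<le> L * L / (q * q) * s ^ (m + 3)"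
        by (rule order_trans[OF b1b]) (use q True pw[of 1] in \<open>auto intro!: mult_left_mono divide_right_mono\<close>)
      have 4: "\<bar>c1 * V / (q * c)\<bar> \<le> L * L * L / q * s ^ (m + 3)"
        by (rule order_trans[OF c1b]) (use q True pw[of 0] mult_left_mono[of 1 "s ^ (m + 3)" "L * L * L / q"] in simp)
      have "\<bar>I\<bar> \<le> \<bar>(2 * a / q) * (V + h)\<bar> + \<bar>\<bar>V + h\<bar> powr (p - 1) * (V + h)\<bar>
        + \<bar>b1 * V * y\<^sup>2 / (q * (q + b * y\<^sup>2))\<bar> + \<bar>c1 * V / (q * c)\<bar>"
      proof -
        have "\<bar>- u + v + w - z\<bar> \<le> \<bar>u\<bar> + \<bar>v\<bar> + \<bar>w\<bar> + \<bar>z\<bar>" for u v w z :: real by linarith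
        then show ?thesis unfolding I_def mult_minus_left .
      qed
      with 1 2 3 4 show ?thesis unfolding D1_def by (simp only: distrib_right)
    qed
    have t1: "\<bar>(1 - k * a * y\<^sup>2) * I\<bar> \<le> (L + 1) * D1 * s ^ (m + 4)"
    proof -
      have "\<bar>(1 - k * a * y\<^sup>2) * I\<bar> \<le> ((L + 1) * s) * (D1 * s ^ (m + 3))"
        unfolding abs_mult using P[OF H(1,2)] I s True by (intro mult_mono) auto
      then show ?thesis by (simp add: power_add mult_ac eval_nat_numeral)
    qed
    have t2: "\<bar>2 * a * k * (1 - a * y\<^sup>2) * (V + h)\<bar> \<le> 2 * L * (L + 1) * (2 * L) * s ^ (m + 4)"
    proof -
      have "\<bar>2 * a * k\<bar> \<le> 2 * L * 1" using H unfolding abs_mult by (intro mult_mono) auto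
      then have "\<bar>2 * a * k * (1 - a * y\<^sup>2) * (V + h)\<bar> \<le> (2 * L) * ((L + 1) * s) * (2 * L * s\<^sup>2)"
        unfolding abs_mult[of "2 * a * k * (1 - a * y\<^sup>2)"] abs_mult[of "2 * a * k"]
        using P[of 1] W True s by (intro mult_mono) auto
      also have "\<dots> = 2 * L * (L + 1) * (2 * L) * s ^ 3" by (simp add: power3_eq_cube power2_eq_square)
      also have "\<dots> \<le> 2 * L * (L + 1) * (2 * L) * s ^ (m + 4)"
        using True s by (intro mult_left_mono power_increasing) auto
      finally show ?thesis .
    qed
    have t3: "\<bar>c1 * h * (k * a * y^4 - (1 + 2 * k) * y\<^sup>2)\<bar> \<le> L * L * (L + 3) * s ^ (m + 4)"
    proof -
      have y4: "y^4 = y\<^sup>2 * y\<^sup>2" by (simp add: power2_eq_square power4_eq_xxxx)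
      have "\<bar>k * a * y^4 - (1 + 2 * k) * y\<^sup>2\<bar> \<le> k * a * y^4 + (1 + 2 * k) * y\<^sup>2"
        using H by (intro order_trans[OF abs_triangle_ineq4]) (simp add: abs_mult)
      also have "\<dots> \<le> 1 * L * (s * s) + 3 * (s * s)"
      proof (intro add_mono mult_mono)
        show "y ^ 4 \<le> s * s" unfolding y4 using s by (intro mult_mono) auto
        show "y\<^sup>2 \<le> s * s" using s mult_mono[of 1 s "y\<^sup>2" s] by simp
      qed (use H s in auto)
      finally have "\<bar>k * a * y^4 - (1 + 2 * k) * y\<^sup>2\<bar> \<le> (L + 3) * (s * s)" by (simp add: algebra_simps)
      then have "\<bar>c1 * h * (k * a * y^4 - (1 + 2 * k) * y\<^sup>2)\<bar> \<le> L * (L * s\<^sup>2) * ((L + 3) * (s * s))"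
        unfolding abs_mult[of "c1 * h"] abs_mult[of c1]
        using H True s by (intro mult_mono) (auto simp: s_def)
      also have "\<dots> = L * L * (L + 3) * s ^ 4" by (simp add: power4_eq_xxxx power2_eq_square)
      also have "\<dots> \<le> L * L * (L + 3) * s ^ (m + 4)"
        using True s by (intro mult_left_mono power_increasing) auto
      finally show ?thesis .
    qed
    have "\<bar>(1 - k * a * y\<^sup>2) * I - 2 * a * k * (1 - a * y\<^sup>2) * (V + h)
        + c1 * h * (k * a * y^4 - (1 + 2 * k) * y\<^sup>2)\<bar> \<le> D * s ^ (m + 4)"
      using t1 t2 t3 unfolding D_def distrib_right by linarith
    then have "exp (- (a / 2) * y\<^sup>2) * \<bar>(1 - k * a * y\<^sup>2) * I - 2 * a * k * (1 - a * y\<^sup>2) * (V + h)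
        + c1 * h * (k * a * y^4 - (1 + 2 * k) * y\<^sup>2)\<bar> \<le> exp (- (a / 2) * y\<^sup>2) * (D * s ^ (m + 4))"
      by (intro mult_left_mono) auto
    then show "\<bar>rate_density p k a b c b1 c1 h y\<bar> \<le> D * (exp (- (a / 2) * y\<^sup>2) * (1 + y\<^sup>2) ^ (m + 4))"
      unfolding rate_density_def I_def V_def q_def s_def abs_mult abs_exp_cancel
      by (simp add: mult_ac)
  qed
qed

section \<open>The orthogonality rate vanishes along the flow\<close>

text \<open>The cutoff vanishes to second order at \<open>\<plusminus>R\<close>, so that integration by parts on \<open>{-R..R}\<close> leaves no
  boundary terms, and differs from \<open>1\<close> by at most \<open>2 y\<^sup>2 / R\<^sup>2\<close>.\<close>

definition cutoff :: "real \<Rightarrow> real \<Rightarrow> real" where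
  "cutoff R y = (1 - y\<^sup>2 / R\<^sup>2)\<^sup>2"

definition cutoff1 :: "real \<Rightarrow> real \<Rightarrow> real" where
  "cutoff1 R y = - 4 * y / R\<^sup>2 * (1 - y\<^sup>2 / R\<^sup>2)"

definition cutoff2 :: "real \<Rightarrow> real \<Rightarrow> real" where
  "cutoff2 R y = - 4 / R\<^sup>2 * (1 - 3 * (y\<^sup>2 / R\<^sup>2))"

lemma cutoff_has_derivative: "(cutoff R has_real_derivative cutoff1 R y) (at y within S)"
proof -
  have "((\<lambda>y. (1 - r * y\<^sup>2)\<^sup>2) has_real_derivative - 4 * r * y * (1 - r * y\<^sup>2)) (at y within S)" for r
    by (rule derivative_eq_intros refl | simp add: algebra_simps)+
  from this[of "1 / R\<^sup>2"] show ?thesis by (simp add: cutoff_def[abs_def] cutoff1_def)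
qed

lemma cutoff1_has_derivative: "(cutoff1 R has_real_derivative cutoff2 R y) (at y within S)"
proof -
  have "((\<lambda>y. - 4 * r * y * (1 - r * y\<^sup>2)) has_real_derivative - 4 * r * (1 - 3 * (r * y\<^sup>2))) (at y within S)" for r
    by (rule derivative_eq_intros refl | simp add: algebra_simps power2_eq_square)+
  from this[of "1 / R\<^sup>2"] show ?thesis by (simp add: cutoff1_def[abs_def] cutoff2_def)
qed

lemma cutoff_boundary:
  assumes "0 < R"
  shows "cutoff R R = 0" "cutoff R (- R) = 0" "cutoff1 R R = 0" "cutoff1 R (- R) = 0"
  using assms by (simp_all add: cutoff_def cutoff1_def)

text \<open>Both derivatives are O(R^(-2)) with at most polynomial growth in y, so every term
  containing one of them disappears under a Gaussian as R grows.\<close>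

lemma cutoff_derivative_bounds:
  assumes "\<bar>y\<bar> \<le> R" "0 < R"
  shows "\<bar>cutoff1 R y\<bar> \<le> 4 * (1 + y\<^sup>2) / R\<^sup>2" "\<bar>cutoff2 R y\<bar> \<le> 12 / R\<^sup>2"
proof -
  have s: "0 \<le> y\<^sup>2 / R\<^sup>2" "y\<^sup>2 / R\<^sup>2 \<le> 1"
    using assms by (auto simp: abs_le_square_iff[symmetric])
  have "\<bar>y\<bar> \<le> 1 + y\<^sup>2" using sum_squares_bound[of 1 "\<bar>y\<bar>"] by simp
  then have "\<bar>y\<bar> * \<bar>1 - y\<^sup>2 / R\<^sup>2\<bar> \<le> (1 + y\<^sup>2) * 1"
    using s by (intro mult_mono) auto
  then have "4 / R\<^sup>2 * (\<bar>y\<bar> * \<bar>1 - y\<^sup>2 / R\<^sup>2\<bar>) \<le> 4 / R\<^sup>2 * ((1 + y\<^sup>2) * 1)"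
    by (intro mult_left_mono) auto
  then show "\<bar>cutoff1 R y\<bar> \<le> 4 * (1 + y\<^sup>2) / R\<^sup>2"
    by (simp add: cutoff1_def abs_mult)
  have "4 / R\<^sup>2 * \<bar>1 - 3 * (y\<^sup>2 / R\<^sup>2)\<bar> \<le> 4 / R\<^sup>2 * 3"
    by (rule mult_left_mono) (use s in linarith, simp)
  moreover have "\<bar>- 4 / R\<^sup>2 * z\<bar> = 4 / R\<^sup>2 * \<bar>z\<bar>" for z :: real by (simp add: abs_mult)
  ultimately show "\<bar>cutoff2 R y\<bar> \<le> 12 / R\<^sup>2" by (simp only: cutoff2_def)
qed

lemma interval_derivative_unique:
  fixes f :: "real \<Rightarrow> real"
  assumes "s < t" "x \<in> {s..t}"
    "(f has_real_derivative D) (at x within {s..t})" "(f has_real_derivative E) (at x within {s..t})"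
  shows "D = E"
  using vector_derivative_unique_within_closed_interval[of s t x f D E] assms
  by (simp add: has_real_derivative_iff_has_vector_derivative)

text \<open>Uniform convergence of the derivatives identifies \<open>g\<close> with the derivative
  of the limit function, which is 0. The interval must be nondegenerate for that derivative to be
  unique.\<close>

lemma uniform_limit_derivative_zero:
  fixes f f' :: "nat \<Rightarrow> real \<Rightarrow> real"
  assumes "s < t"
    and f: "\<And>n x. x \<in> {s..t} \<Longrightarrow> (f n has_real_derivative f' n x) (at x within {s..t})"
    and lim: "\<And>x. x \<in> {s..t} \<Longrightarrow> (\<lambda>n. f n x) \<longlonglongrightarrow> 0"
    and unif: "\<And>n x. x \<in> {s..t} \<Longrightarrow> \<bar>f' n x - g x\<bar> \<le> e n" and e: "e \<longlonglongrightarrow> 0"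
    and "x \<in> {s..t}"
  shows "g x = 0"
proof -
  have "\<exists>F. \<forall>x\<in>{s..t}. (\<lambda>n. f n x) \<longlonglongrightarrow> F x \<and> (F has_derivative (\<lambda>h. g x * h)) (at x within {s..t})"
  proof (rule has_derivative_sequence)
    show "(f n has_derivative (\<lambda>h. f' n x * h)) (at x within {s..t})" if "x \<in> {s..t}" for n x
      using f[OF that] by (simp add: has_field_derivative_def)
    show "\<forall>\<^sub>F n in sequentially. \<forall>x\<in>{s..t}. \<forall>h. norm (f' n x * h - g x * h) \<le> r * norm h" if "0 < r" for r
      using order_tendstoD(2)[OF e that]
    proof eventually_elim
      case (elim n)
      show ?case
      proof (intro ballI allI)
        fix x h assume "x \<in> {s..t}"
        from unif[OF this, of n] elim have "\<bar>f' n x - g x\<bar> \<le> r" by linarith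
        then have "\<bar>f' n x - g x\<bar> * \<bar>h\<bar> \<le> r * \<bar>h\<bar>" by (rule mult_right_mono) simp
        then show "norm (f' n x * h - g x * h) \<le> r * norm h"
          by (simp add: left_diff_distrib[symmetric] abs_mult)
      qed
    qed
    show "x \<in> {s..t}" "(\<lambda>n. f n x) \<longlonglongrightarrow> 0" using assms lim by auto
  qed auto
  then obtain F where F: "\<And>x. x \<in> {s..t} \<Longrightarrow> (\<lambda>n. f n x) \<longlonglongrightarrow> F x"
    "\<And>x. x \<in> {s..t} \<Longrightarrow> (F has_real_derivative g x) (at x within {s..t})"
    unfolding has_field_derivative_def by blast
  have F0: "F x = 0" if "x \<in> {s..t}" for x using LIMSEQ_unique[OF F(1) lim] that by simp
  have "(F has_real_derivative 0) (at x within {s..t})"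
    by (rule has_field_derivative_transform_within[OF DERIV_const[of 0] zero_less_one \<open>x \<in> {s..t}\<close>])
      (use F0 in simp)
  from interval_derivative_unique[OF \<open>s < t\<close> \<open>x \<in> {s..t}\<close> F(2)[OF \<open>x \<in> {s..t}\<close>] this]
  show ?thesis .
qed

text \<open>Trading the weight for an integer power keeps all later estimates polynomial in 1 + y^2;
  the loss is harmless under a Gaussian.\<close>

lemma bracket_cubed_le: "bracket y powr 3 \<le> (1 + y\<^sup>2)\<^sup>2"
proof -
  have "bracket y powr 3 = (1 + y\<^sup>2) powr (3 / 2)"
    by (simp add: bracket_def powr_half_sqrt[symmetric] powr_powr add_pos_nonneg)
  also have "\<dots> \<le> (1 + y\<^sup>2) powr 2" by (intro powr_mono) auto
  also have "\<dots> = (1 + y\<^sup>2)\<^sup>2" by (simp add: powr_numeral add_pos_nonneg)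
  finally show ?thesis .
qed

lemma weighted_bound:
  assumes "\<bar>weighted a \<xi> y \<tau>\<bar> \<le> N"
  shows "\<bar>exp (a \<tau> / 4 * y\<^sup>2) * \<xi> y \<tau>\<bar> \<le> N * (1 + y\<^sup>2)\<^sup>2"
proof -
  have pos: "0 < bracket y" by (simp add: bracket_def add_pos_nonneg)
  have "exp (a \<tau> / 4 * y\<^sup>2) * \<xi> y \<tau> = weighted a \<xi> y \<tau> * bracket y powr 3"
    using pos by (simp add: weighted_def powr_minus)
  then have "\<bar>exp (a \<tau> / 4 * y\<^sup>2) * \<xi> y \<tau>\<bar> \<le> N * bracket y powr 3"
    using assms by (simp add: abs_mult mult_right_mono)
  also have "\<dots> \<le> N * (1 + y\<^sup>2)\<^sup>2"
    using assms by (intro mult_left_mono bracket_cubed_le) auto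
  finally show ?thesis .
qed

section \<open>Joint continuity in time and space\<close>

lemma continuous_on_amplitude [continuous_intros]:
  fixes b c y :: "'a::topological_space \<Rightarrow> real"
  assumes "continuous_on S b" "continuous_on S c" "continuous_on S y"
    and "1 < p" "\<And>x. x \<in> S \<Longrightarrow> 0 \<le> b x" "\<And>x. x \<in> S \<Longrightarrow> 0 < c x"
  shows "continuous_on S (\<lambda>x. amplitude p (b x) (c x) (y x))"
proof -
  have "0 < p - 1 + b x * (y x)\<^sup>2" if "x \<in> S" for x
    using assms(4,5) that by (simp add: add_pos_nonneg)
  then have "p - 1 + b x * (y x)\<^sup>2 \<noteq> 0" "2 * c x / (p - 1 + b x * (y x)\<^sup>2) \<noteq> 0" if "x \<in> S" for x
    using assms(6) that by (fastforce, fastforce)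
  then show ?thesis unfolding amplitude_def
    by (intro continuous_intros assms) auto
qed

lemma continuous_on_rate_density [continuous_intros]:
  fixes a b c b1 c1 h y :: "'a::topological_space \<Rightarrow> real"
  assumes "continuous_on S a" "continuous_on S b" "continuous_on S c"
    "continuous_on S b1" "continuous_on S c1" "continuous_on S h" "continuous_on S y"
    and "1 < p" "\<And>x. x \<in> S \<Longrightarrow> 0 \<le> b x" "\<And>x. x \<in> S \<Longrightarrow> 0 < c x"
  shows "continuous_on S (\<lambda>x. rate_density p k (a x) (b x) (c x) (b1 x) (c1 x) (h x) (y x))"
proof -
  have "0 < p - 1 + b x * (y x)\<^sup>2" if "x \<in> S" for x
    using assms(8,9) that by (simp add: add_pos_nonneg)
  then have nz: "p - 1 + b x * (y x)\<^sup>2 \<noteq> 0" "c x \<noteq> 0" if "x \<in> S" for x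
    using assms(10) that by (fastforce, fastforce)
  show ?thesis unfolding rate_density_def
    by (intro continuous_intros continuous_on_powr' assms) (use nz assms(8) in auto)
qed

section \<open>The flow on a compact time interval\<close>

locale blowup_flow =
  fixes p T :: real and a a' b b' c c' :: "real \<Rightarrow> real" and \<xi> :: "real \<Rightarrow> real \<Rightarrow> real"
  assumes p: "1 < p" and T: "0 < T"
    and C1: "C1_on_interval T a a'" "C1_on_interval T b b'" "C1_on_interval T c c'"
    and pos: "\<And>\<tau>. \<tau> \<in> {0..T} \<Longrightarrow> 0 < a \<tau>" "\<And>\<tau>. \<tau> \<in> {0..T} \<Longrightarrow> 0 < b \<tau>" "\<And>\<tau>. \<tau> \<in> {0..T} \<Longrightarrow> 0 < c \<tau>"
    and ac: "\<And>\<tau>. \<tau> \<in> {0..T} \<Longrightarrow> a \<tau> = 2 * c \<tau> - 1/2"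
    and bounded: "bounded ((\<lambda>(y, \<tau>). weighted a \<xi> y \<tau>) ` (UNIV \<times> {0..T}))"
    and solves: "solves_w_equation p T a a' (\<lambda>y \<tau>. profile p (a \<tau>) (b \<tau>) (c \<tau>) y + \<xi> y \<tau>)"
begin

lemma derivs:
  assumes "\<tau> \<in> {0..T}"
  shows "(a has_real_derivative a' \<tau>) (at \<tau> within {0..T})"
    "(b has_real_derivative b' \<tau>) (at \<tau> within {0..T})"
    "(c has_real_derivative c' \<tau>) (at \<tau> within {0..T})"
  using C1 assms by (auto simp: C1_on_interval_def)

lemma cont:
  "continuous_on {0..T} a" "continuous_on {0..T} b" "continuous_on {0..T} c"
  "continuous_on {0..T} a'" "continuous_on {0..T} b'" "continuous_on {0..T} c'"
    using C1 DERIV_continuous_on[OF derivs(1)] DERIV_continuous_on[OF derivs(2)] DERIV_continuous_on[OF derivs(3)]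
  by (auto simp: C1_on_interval_def)

text \<open>The relation between a and c may be differentiated up to the end points, because
  derivatives within a nondegenerate closed interval are unique.\<close>

lemma a'_eq:
  assumes "\<tau> \<in> {0..T}"
  shows "a' \<tau> = 2 * c' \<tau>"
proof -
  have "((\<lambda>s. 2 * c s - 1/2) has_real_derivative 2 * c' \<tau>) (at \<tau> within {0..T})"
    by (auto intro!: derivative_eq_intros derivs assms)
  then have "(a has_real_derivative 2 * c' \<tau>) (at \<tau> within {0..T})"
    by (rule has_field_derivative_transform_within[OF _ zero_less_one assms]) (use ac in auto)
  with interval_derivative_unique[OF T assms derivs(1)[OF assms]] show ?thesis .
qed

lemma cont2:
  assumes "continuous_on {0..T} f"
  shows "continuous_on (UNIV \<times> {0..T}) (\<lambda>z. f (snd z))"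
  by (rule continuous_on_compose2[OF assms]) (auto intro: continuous_intros)

lemma cont_profile: "continuous_on (UNIV \<times> {0..T}) (\<lambda>z. profile p (a (snd z)) (b (snd z)) (c (snd z)) (fst z))"
  unfolding profile_eq_amplitude
  by (intro continuous_intros cont2 cont p) (use pos in \<open>auto intro: less_imp_le\<close>)

lemma cont_\<xi>: "continuous_on (UNIV \<times> {0..T}) (\<lambda>z. \<xi> (fst z) (snd z))"
proof -
  have "continuous_on (UNIV \<times> {0..T}) (\<lambda>z. profile p (a (snd z)) (b (snd z)) (c (snd z)) (fst z) + \<xi> (fst z) (snd z))"
    using solves unfolding solves_w_equation_def case_prod_unfold by blast
  from continuous_on_diff[OF this cont_profile] show ?thesis by simp
qed

definition gauged :: "real \<Rightarrow> real \<Rightarrow> real" where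
  "gauged y \<tau> = exp (a \<tau> / 4 * y\<^sup>2) * \<xi> y \<tau>"

definition J :: "real \<Rightarrow> real \<Rightarrow> real \<Rightarrow> real" where
  "J k y \<tau> = rate_density p k (a \<tau>) (b \<tau>) (c \<tau>) (b' \<tau>) (c' \<tau>) (gauged y \<tau>) y"

lemma cont_J: "continuous_on (UNIV \<times> {0..T}) (\<lambda>z. J k (fst z) (snd z))"
  unfolding J_def gauged_def
  by (intro continuous_intros cont2 cont cont_\<xi> p) (use pos in \<open>auto intro: less_imp_le\<close>)

lemma cont_sections:
  assumes "continuous_on (UNIV \<times> {0..T}) (\<lambda>z. f (fst z) (snd z))"
  shows "\<tau> \<in> {0..T} \<Longrightarrow> continuous_on S (\<lambda>y. f y \<tau>)" "continuous_on {0..T} (\<lambda>\<tau>. f y \<tau>)"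
proof -
  show "continuous_on S (\<lambda>y. f y \<tau>)" if "\<tau> \<in> {0..T}"
    using continuous_on_compose2[OF assms, of S "\<lambda>y. (y, \<tau>)"] that
    by (simp add: image_subset_iff continuous_on_Pair)
  show "continuous_on {0..T} (\<lambda>\<tau>. f y \<tau>)"
    using continuous_on_compose2[OF assms, of "{0..T}" "\<lambda>\<tau>. (y, \<tau>)"]
    by (simp add: image_subset_iff continuous_on_Pair)
qed

text \<open>Compactness of \<open>{0..T}\<close> and boundedness of the weighted \<xi>. These
  constants depend on the individual flow; they serve only the limit in the cutoff radius and the
  continuity in time, and never reach the final estimate.\<close>

lemma uniform_bounds:
  obtains L d where "1 \<le> L" "0 < d"
    "\<And>\<tau>. \<tau> \<in> {0..T} \<Longrightarrow> 2 * d \<le> a \<tau> \<and> a \<tau> \<le> L \<and> 1 / c \<tau> \<le> L \<and> \<bar>b' \<tau>\<bar> \<le> L \<and> \<bar>c' \<tau>\<bar> \<le> L"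
    "\<And>\<tau> y. \<tau> \<in> {0..T} \<Longrightarrow> amplitude p (b \<tau>) (c \<tau>) y \<le> L"
    "\<And>\<tau> y. \<tau> \<in> {0..T} \<Longrightarrow> \<bar>gauged y \<tau>\<bar> \<le> L * (1 + y\<^sup>2)\<^sup>2"
proof -
  have c0: "c \<tau> \<noteq> 0" "2 * c \<tau> / (p - 1) \<noteq> 0" if "\<tau> \<in> {0..T}" for \<tau> using pos(3)[OF that] p by auto
  \<comment> \<open>All summands are nonnegative, so the maximum of the sum bounds each of
    them.\<close>
  define F where "F \<tau> = a \<tau> + 1 / c \<tau> + \<bar>b' \<tau>\<bar> + \<bar>c' \<tau>\<bar> + (2 * c \<tau> / (p - 1)) powr (1 / (p - 1))" for \<tau>
  have "continuous_on {0..T} F" unfolding F_def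
    by (intro continuous_intros cont) (use c0 p in auto)
  then have "\<exists>t\<in>{0..T}. \<forall>\<tau>\<in>{0..T}. F \<tau> \<le> F t" using T by (intro continuous_attains_sup) auto
  then obtain t1 where t1: "\<And>\<tau>. \<tau> \<in> {0..T} \<Longrightarrow> F \<tau> \<le> F t1" by blast
  have "\<exists>t\<in>{0..T}. \<forall>\<tau>\<in>{0..T}. a t \<le> a \<tau>" using T by (intro continuous_attains_inf cont) auto
  then obtain t2 where t2: "t2 \<in> {0..T}" "\<And>\<tau>. \<tau> \<in> {0..T} \<Longrightarrow> a t2 \<le> a \<tau>" by blast
  from bounded obtain N where N: "\<And>y \<tau>. \<tau> \<in> {0..T} \<Longrightarrow> \<bar>weighted a \<xi> y \<tau>\<bar> \<le> N"
    unfolding bounded_iff by fastforce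
  define L where "L = max 1 (max (F t1) N)"
  have FL: "F \<tau> \<le> L" if "\<tau> \<in> {0..T}" for \<tau> using t1[OF that] by (simp add: L_def)
  have parts: "0 < a \<tau>" "0 < 1 / c \<tau>" "0 \<le> (2 * c \<tau> / (p - 1)) powr (1 / (p - 1))" if "\<tau> \<in> {0..T}" for \<tau>
    using pos that by auto
  show thesis
  proof (rule that[of L "a t2 / 2"])
    show "1 \<le> L" by (simp add: L_def)
    show "0 < a t2 / 2" using pos(1)[OF t2(1)] by simp
    show "2 * (a t2 / 2) \<le> a \<tau> \<and> a \<tau> \<le> L \<and> 1 / c \<tau> \<le> L \<and> \<bar>b' \<tau>\<bar> \<le> L \<and> \<bar>c' \<tau>\<bar> \<le> L" if "\<tau> \<in> {0..T}" for \<tau>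
    proof -
      have "a t2 \<le> a \<tau>" using t2 that by simp
      then show ?thesis using FL[OF that] parts[OF that] unfolding F_def by (intro conjI) linarith+
    qed
    show "amplitude p (b \<tau>) (c \<tau>) y \<le> L" if "\<tau> \<in> {0..T}" for \<tau> y
    proof -
      have "amplitude p (b \<tau>) (c \<tau>) y \<le> (2 * c \<tau> / (p - 1)) powr (1 / (p - 1))"
        using pos that by (intro amplitude_le p) (auto intro: less_imp_le)
      then show ?thesis using FL[OF that] parts[OF that] unfolding F_def by linarith
    qed
    show "\<bar>gauged y \<tau>\<bar> \<le> L * (1 + y\<^sup>2)\<^sup>2" if "\<tau> \<in> {0..T}" for y \<tau>
      unfolding gauged_def
      by (rule weighted_bound) (use N[OF that, of y] in \<open>simp add: L_def\<close>)
  qed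
qed

lemma J_bound:
  obtains D d n where "0 \<le> D" "0 < d" 
    "\<And>k y \<tau>. 0 \<le> k \<Longrightarrow> k \<le> 1 \<Longrightarrow> \<tau> \<in> {0..T} \<Longrightarrow> \<bar>J k y \<tau>\<bar> \<le> D * (exp (- d * y\<^sup>2) * (1 + y\<^sup>2) ^ n)"
proof -
  obtain L d where L: "1 \<le> L" "0 < d"
    "\<And>\<tau>. \<tau> \<in> {0..T} \<Longrightarrow> 2 * d \<le> a \<tau> \<and> a \<tau> \<le> L \<and> 1 / c \<tau> \<le> L \<and> \<bar>b' \<tau>\<bar> \<le> L \<and> \<bar>c' \<tau>\<bar> \<le> L"
    "\<And>\<tau> y. \<tau> \<in> {0..T} \<Longrightarrow> amplitude p (b \<tau>) (c \<tau>) y \<le> L"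
    "\<And>\<tau> y. \<tau> \<in> {0..T} \<Longrightarrow> \<bar>gauged y \<tau>\<bar> \<le> L * (1 + y\<^sup>2)\<^sup>2"
    by (rule uniform_bounds) blast
  from rate_density_bound[OF p L(1)] obtain D n where D: "0 \<le> D"
    "\<And>k a b c b1 c1 h y.
     0 \<le> k \<and> k \<le> 1 \<and> 0 < a \<and> a \<le> L \<and> 0 \<le> b \<and> 0 < c \<and> 1 / c \<le> L \<and>
     amplitude p b c y \<le> L \<and> \<bar>b1\<bar> \<le> L \<and> \<bar>c1\<bar> \<le> L \<and> \<bar>h\<bar> \<le> L * (1 + y\<^sup>2)\<^sup>2 \<Longrightarrow>
     \<bar>rate_density p k a b c b1 c1 h y\<bar> \<le> D * (exp (- (a / 2) * y\<^sup>2) * (1 + y\<^sup>2) ^ n)"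
    by blast
  show thesis
  proof (rule that[OF D(1) L(2), of n])
    fix k y \<tau> :: real assume k: "0 \<le> k" "k \<le> 1" and t: "\<tau> \<in> {0..T}"
    have "\<bar>J k y \<tau>\<bar> \<le> D * (exp (- (a \<tau> / 2) * y\<^sup>2) * (1 + y\<^sup>2) ^ n)"
      unfolding J_def using k L(3-5)[OF t] pos[OF t] by (intro D(2)) auto
    also have "2 * d * y\<^sup>2 \<le> a \<tau> * y\<^sup>2" using L(3)[OF t] by (intro mult_right_mono) auto
    then have "D * (exp (- (a \<tau> / 2) * y\<^sup>2) * (1 + y\<^sup>2) ^ n) \<le> D * (exp (- d * y\<^sup>2) * (1 + y\<^sup>2) ^ n)"
      using D(1) by (intro mult_left_mono mult_right_mono) auto
    finally show "\<bar>J k y \<tau>\<bar> \<le> D * (exp (- d * y\<^sup>2) * (1 + y\<^sup>2) ^ n)" .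
  qed
qed

text \<open>Dominated convergence: the integrand is continuous in time at every fixed y, and
  \<open>J_bound\<close> gives a majorant that does not depend on the time.\<close>

lemma continuous_on_rate:
  assumes "0 \<le> k" "k \<le> 1"
  shows "continuous_on {0..T} (\<lambda>\<tau>. LINT y|lborel. J k y \<tau>)"
proof -
  obtain D d n where D: "0 \<le> D" "0 < d" 
    "\<And>k y \<tau>. 0 \<le> k \<Longrightarrow> k \<le> 1 \<Longrightarrow> \<tau> \<in> {0..T} \<Longrightarrow> \<bar>J k y \<tau>\<bar> \<le> D * (exp (- d * y\<^sup>2) * (1 + y\<^sup>2) ^ n)"
    by (rule J_bound) blast
  have m: "(\<lambda>y. J k y \<tau>) \<in> borel_measurable lborel" if "\<tau> \<in> {0..T}" for \<tau>
    using borel_measurable_continuous_onI[OF cont_sections(1)[OF cont_J that]] by simp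
  show ?thesis unfolding continuous_on_sequentially
  proof (intro allI ballI impI)
    fix x \<tau> assume t: "\<tau> \<in> {0..T}" and x: "(\<forall>n. x n \<in> {0..T}) \<and> x \<longlonglongrightarrow> \<tau>"
    show "((\<lambda>\<tau>. LINT y|lborel. J k y \<tau>) \<circ> x) \<longlonglongrightarrow> (LINT y|lborel. J k y \<tau>)"
      unfolding comp_def
    proof (rule integral_dominated_convergence[where w="\<lambda>y. D * (exp (- d * y\<^sup>2) * (1 + y\<^sup>2) ^ n)"])
      show "integrable lborel (\<lambda>y. D * (exp (- d * y\<^sup>2) * (1 + y\<^sup>2) ^ n))"
        using integrable_gauss_poly[OF D(2)] by (rule integrable_mult_right)
      show "AE y in lborel. (\<lambda>i. J k y (x i)) \<longlonglongrightarrow> J k y \<tau>"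
      proof (rule AE_I2)
        fix y
        show "(\<lambda>i. J k y (x i)) \<longlonglongrightarrow> J k y \<tau>"
          using cont_sections(2)[OF cont_J, of k y] x t unfolding continuous_on_sequentially comp_def by blast
      qed
      show "AE y in lborel. norm (J k y (x i)) \<le> D * (exp (- d * y\<^sup>2) * (1 + y\<^sup>2) ^ n)" for i
        using D(3)[OF assms] x by simp
    qed (use m t x in auto)
  qed
qed

end

section \<open>Differentiating the cut-off pairing\<close>

lemma mode_bounds:
  assumes "0 \<le> k" "k \<le> 1" "0 < a" "a \<le> L"
  shows "\<bar>mode k a y\<bar> \<le> (L + 1) * (1 + y\<^sup>2) * exp (- (a / 4) * y\<^sup>2)"
    and "\<bar>mode1 k a y\<bar> \<le> 2 * (L + 1)\<^sup>2 * (1 + y\<^sup>2)\<^sup>2 * exp (- (a / 4) * y\<^sup>2)"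
proof -
  define S where "S = 1 + y\<^sup>2"
  have S: "1 \<le> S" "y\<^sup>2 \<le> S" by (auto simp: S_def)
  have yS: "\<bar>y\<bar> \<le> S" using sum_squares_bound[of 1 "\<bar>y\<bar>"] by (simp add: S_def)
  have ka: "k * a \<le> 1 * L" using assms by (intro mult_mono) auto
  have ka0: "0 \<le> k * a" using assms by simp
  have "k * a * y\<^sup>2 \<le> (1 * L) * S" "0 \<le> k * a * y\<^sup>2" 
    using mult_mono[OF ka S(2)] ka0 S assms by simp_all
  then have P: "\<bar>1 - k * a * y\<^sup>2\<bar> \<le> (L + 1) * S" using S unfolding distrib_right mult_1 by linarith
  then show "\<bar>mode k a y\<bar> \<le> (L + 1) * (1 + y\<^sup>2) * exp (- (a / 4) * y\<^sup>2)"
    unfolding mode_def abs_mult abs_exp_cancel S_def[symmetric] by (intro mult_right_mono) auto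
  have "\<bar>- 2 * k * a * y - a * y / 2 * (1 - k * a * y\<^sup>2)\<bar>
      \<le> 2 * (k * a) * \<bar>y\<bar> + a * \<bar>y\<bar> / 2 * \<bar>1 - k * a * y\<^sup>2\<bar>"
    using assms by (intro order_trans[OF abs_triangle_ineq4]) (simp add: abs_mult)
  also have "\<dots> \<le> 2 * L * S + L * S / 2 * ((L + 1) * S)"
  proof -
    have "a * \<bar>y\<bar> \<le> L * S" using assms yS by (intro mult_mono) auto
    moreover have "2 * (k * a) \<le> 2 * L" using ka by simp
    ultimately show ?thesis using P yS ka0 assms by (intro add_mono mult_mono) simp_all
  qed
  also have "\<dots> \<le> 2 * L * S\<^sup>2 + L / 2 * (L + 1) * S\<^sup>2"
  proof -
    have "S \<le> S\<^sup>2" using S mult_left_mono[of 1 S S] by (simp add: power2_eq_square)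
    then have "L * S \<le> L * S\<^sup>2" using assms by (intro mult_left_mono) auto
    then show ?thesis by (simp add: power2_eq_square algebra_simps)
  qed
  also have "\<dots> \<le> 2 * (L + 1)\<^sup>2 * S\<^sup>2"
  proof -
    have "2 * L + L / 2 * (L + 1) \<le> 2 * (L + 1)\<^sup>2"
      using assms by (simp add: power2_eq_square algebra_simps)
    from mult_right_mono[OF this, of "S\<^sup>2"] show ?thesis by (simp add: algebra_simps)
  qed
  finally show "\<bar>mode1 k a y\<bar> \<le> 2 * (L + 1)\<^sup>2 * (1 + y\<^sup>2)\<^sup>2 * exp (- (a / 4) * y\<^sup>2)"
    unfolding mode1_def abs_mult abs_exp_cancel S_def[symmetric] by (intro mult_right_mono) auto
qed

text \<open>\<open>F\<close> is the boundary expression w_y (\<phi> \<chi>) - w (\<phi> \<chi>)';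
  both terms vanish at R and -R because \<chi> has double zeros there. In the form
  \<open>has_integral 0\<close> the identity can be added to another integral without a separate
  integrability argument for \<open>wyy\<close>.\<close>

lemma cutoff_integration_by_parts:
  fixes w wy wyy :: "real \<Rightarrow> real"
  assumes "0 < R"
    and "\<And>y. (w has_real_derivative wy y) (at y)"
    and "\<And>y. (wy has_real_derivative wyy y) (at y)"
  shows "((\<lambda>y. wyy y * mode k a y * cutoff R y
      - w y * (mode2 k a y * cutoff R y + 2 * mode1 k a y * cutoff1 R y + mode k a y * cutoff2 R y)) has_integral 0) {-R..R}"
proof -
  define F where "F y = wy y * (mode k a y * cutoff R y) - w y * (mode1 k a y * cutoff R y + mode k a y * cutoff1 R y)" for y
  have "(F has_real_derivative (wyy y * mode k a y * cutoff R y
      - w y * (mode2 k a y * cutoff R y + 2 * mode1 k a y * cutoff1 R y + mode k a y * cutoff2 R y))) (at y)" for y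
    unfolding F_def
    by (rule DERIV_cong, (rule derivative_intros assms mode_has_derivative mode1_has_derivative
          cutoff_has_derivative cutoff1_has_derivative)+) (simp add: algebra_simps)
  then have "((\<lambda>y. wyy y * mode k a y * cutoff R y
      - w y * (mode2 k a y * cutoff R y + 2 * mode1 k a y * cutoff1 R y + mode k a y * cutoff2 R y))
      has_integral (F R - F (- R))) {-R..R}"
    using assms(1)
    by (intro fundamental_theorem_of_calculus)
      (auto simp flip: has_real_derivative_iff_has_vector_derivative intro: DERIV_subset)
  moreover have "F R = 0" "F (- R) = 0" using cutoff_boundary[OF assms(1)] by (auto simp: F_def)
  ultimately show ?thesis by simp
qed

context blowup_flow
begin

lemma profile_time_derivative:
  assumes "\<tau> \<in> {0..T}"
  shows "((\<lambda>s. profile p (a s) (b s) (c s) y) has_real_derivative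
    profile_rate p (a \<tau>) (b \<tau>) (c \<tau>) (a' \<tau>) (b' \<tau>) (c' \<tau>) y) (at \<tau> within {0..T})"
  using assms pos by (intro profile_parameter_derivative derivs p) (auto intro: less_imp_le)

lemma continuous_on_cutoff:
  "continuous_on S (\<lambda>z::'b::topological_space. f z) \<Longrightarrow> continuous_on S (\<lambda>z. cutoff R (f z))"
  "continuous_on S (\<lambda>z::'b::topological_space. f z) \<Longrightarrow> continuous_on S (\<lambda>z. cutoff1 R (f z))"
  "continuous_on S (\<lambda>z::'b::topological_space. f z) \<Longrightarrow> continuous_on S (\<lambda>z. cutoff2 R (f z))"
  by (auto simp: cutoff_def cutoff1_def cutoff2_def divide_inverse intro!: continuous_intros)

text \<open>On a compact rectangle the cut-off pairing may be differentiated under the integral.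
  Integration by parts then gives the cut-off rate plus commutator terms. Pairing, commutators and
  cutoff error all vanish as R grows, so the rate is the derivative of the zero function.\<close>

lemma rate_zero_interior:
  assumes k: "0 \<le> k" "k \<le> 1"
    and orth: "\<And>\<tau>. \<tau> \<in> {0..T} \<Longrightarrow> (LINT y|lborel. \<xi> y \<tau> * mode k (a \<tau>) y) = 0"
    and \<tau>: "\<tau> \<in> {0<..<T}"
  shows "(LINT y|lborel. J k y \<tau>) = 0"
proof -
  define w where "w y s = profile p (a s) (b s) (c s) y + \<xi> y s" for y s
  from solves obtain wt wy wyy where
    wt_cont: "continuous_on (UNIV \<times> {0<..<T}) (\<lambda>(y, \<tau>). wt y \<tau>)"
    and wt: "\<And>y s. s \<in> {0<..<T} \<Longrightarrow> ((\<lambda>s. w y s) has_real_derivative wt y s) (at s)"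
    and wy: "\<And>y s. s \<in> {0<..<T} \<Longrightarrow> ((\<lambda>z. w z s) has_real_derivative wy y s) (at y)"
    and wyy: "\<And>y s. s \<in> {0<..<T} \<Longrightarrow> ((\<lambda>z. wy z s) has_real_derivative wyy y s) (at y)"
    and eqn: "\<And>y s. s \<in> {0<..<T} \<Longrightarrow> wt y s = wyy y s - potential p (a s) (a' s) y * w y s
                      + nonlinearity p (a s) y (w y s)"
    unfolding solves_w_equation_def w_def by blast
  obtain L d where L: "1 \<le> L" "0 < d"
    "\<And>\<tau>. \<tau> \<in> {0..T} \<Longrightarrow> 2 * d \<le> a \<tau> \<and> a \<tau> \<le> L \<and> 1 / c \<tau> \<le> L \<and> \<bar>b' \<tau>\<bar> \<le> L \<and> \<bar>c' \<tau>\<bar> \<le> L"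
    "\<And>\<tau> y. \<tau> \<in> {0..T} \<Longrightarrow> amplitude p (b \<tau>) (c \<tau>) y \<le> L"
    "\<And>\<tau> y. \<tau> \<in> {0..T} \<Longrightarrow> \<bar>gauged y \<tau>\<bar> \<le> L * (1 + y\<^sup>2)\<^sup>2"
    by (rule uniform_bounds) blast
  obtain DJ dJ n where J: "0 \<le> DJ" "0 < dJ" 
    "\<And>k y \<tau>. 0 \<le> k \<Longrightarrow> k \<le> 1 \<Longrightarrow> \<tau> \<in> {0..T} \<Longrightarrow> \<bar>J k y \<tau>\<bar> \<le> DJ * (exp (- dJ * y\<^sup>2) * (1 + y\<^sup>2) ^ n)"
    by (rule J_bound) blast
  define pr where "pr y s = profile_rate p (a s) (b s) (c s) (a' s) (b' s) (c' s) y" for y s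
  define md where "md y s = - a' s * (k * y\<^sup>2 * exp (- (a s / 4) * y\<^sup>2) + y\<^sup>2 / 4 * mode k (a s) y)" for y s
  define H where "H R s = integral {-R..R} (\<lambda>y. \<xi> y s * mode k (a s) y * cutoff R y)" for R s
  define fx where "fx R s y = ((wt y s - pr y s) * mode k (a s) y + \<xi> y s * md y s) * cutoff R y" for R s y
  \<comment> \<open>\<open>E\<close> collects the terms in which at least one space derivative has
    fallen on the cutoff.\<close>
  define E where "E R s y = w y s * (2 * mode1 k (a s) y * cutoff1 R y + mode k (a s) y * cutoff2 R y)" for R s y
  define G where "G R s = integral {-R..R} (\<lambda>y. J k y s * cutoff R y + E R s y)" for R s
  \<comment> \<open>\<open>wt\<close> is continuous on the open time interval only, so the argument
    runs on a closed interval around \<tau> inside it.\<close>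
  define t1 where "t1 = \<tau> / 2"
  define t2 where "t2 = (\<tau> + T) / 2"
  have t: "0 < t1" "t1 < \<tau>" "\<tau> < t2" "t2 < T" using \<tau> by (auto simp: t1_def t2_def)
  have S: "{t1..t2} \<subseteq> {0<..<T}" "{t1..t2} \<subseteq> {0..T}" using t by auto
  have \<xi>_deriv: "((\<lambda>s. \<xi> y s) has_real_derivative wt y s - pr y s) (at s within {t1..t2})" if "s \<in> {t1..t2}" for y s
  proof -
    have "((\<lambda>s. w y s - profile p (a s) (b s) (c s) y) has_real_derivative wt y s - pr y s) (at s within {t1..t2})"
      using that S unfolding pr_def
      by (intro DERIV_diff has_field_derivative_at_within[OF wt] DERIV_subset[OF profile_time_derivative]) auto
    then show ?thesis by (simp add: w_def)
  qed
  have param: "continuous_on ({t1..t2} \<times> X) (\<lambda>z. f (fst z))" if "continuous_on {0..T} f" for f :: "real \<Rightarrow> real" and X :: "real set"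
    by (rule continuous_on_compose2[OF that]) (use S in \<open>auto intro!: continuous_intros\<close>)
  have H_deriv: "(H R has_real_derivative G R s) (at s within {t1..t2})" if R: "0 < R" and s: "s \<in> {t1..t2}" for R s
  proof -
    have sT: "s \<in> {0<..<T}" "s \<in> {0..T}" using s S by auto
    have "(H R has_real_derivative integral (cbox (-R) R) (fx R s)) (at s within {t1..t2})"
      unfolding H_def cbox_interval[symmetric, of "- R" R]
    proof (rule leibniz_rule_field_derivative[OF _ _ _ s])
      fix s y assume "s \<in> {t1..t2}"
      then have "((\<lambda>s. \<xi> y s * mode k (a s) y) has_real_derivative (wt y s - pr y s) * mode k (a s) y + md y s * \<xi> y s) (at s within {t1..t2})"
        unfolding md_def using S
        by (intro DERIV_mult \<xi>_deriv mode_parameter_derivative DERIV_subset[OF derivs(1)]) auto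
      from DERIV_cmult_right[OF this, of "cutoff R y"]
      show "((\<lambda>s. \<xi> y s * mode k (a s) y * cutoff R y) has_real_derivative fx R s y) (at s within {t1..t2})"
        by (simp add: fx_def mult_ac)
    next
      fix s assume "s \<in> {t1..t2}"
      then have "s \<in> {0..T}" using S by auto
      then show "(\<lambda>y. \<xi> y s * mode k (a s) y * cutoff R y) integrable_on cbox (- R) R"
        unfolding mode_def
        by (intro integrable_continuous continuous_intros continuous_on_cutoff cont_sections(1)[OF cont_\<xi>])
    next
      have wtc: "continuous_on ({t1..t2} \<times> cbox (- R) R) (\<lambda>z. wt (snd z) (fst z))"
        using S by (intro continuous_on_compose2[OF wt_cont, where f="\<lambda>z. (snd z, fst z)", simplified])
          (auto intro!: continuous_intros)
      have xc: "continuous_on ({t1..t2} \<times> cbox (- R) R) (\<lambda>z. \<xi> (snd z) (fst z))"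
        using S by (intro continuous_on_compose2[OF cont_\<xi>, where f="\<lambda>z. (snd z, fst z)", simplified])
          (auto intro!: continuous_intros)
      have nz: "(p - 1 + b s * y\<^sup>2) \<noteq> 0" "c s \<noteq> 0" "0 \<le> b s" "0 < c s" if "s \<in> {t1..t2}" for s y
      proof -
        have "s \<in> {0..T}" using that S by auto
        then have "0 < p - 1 + b s * y\<^sup>2" using pos(2) p by (simp add: add_pos_nonneg less_imp_le)
        then show "(p - 1 + b s * y\<^sup>2) \<noteq> 0" "c s \<noteq> 0" "0 \<le> b s" "0 < c s"
          using pos[OF \<open>s \<in> {0..T}\<close>] by auto
      qed
      show "continuous_on ({t1..t2} \<times> cbox (- R) R) (\<lambda>(s, y). fx R s y)"
        unfolding fx_def case_prod_unfold pr_def profile_rate_def md_def mode_def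
        by (intro continuous_intros wtc xc continuous_on_cutoff param cont p)
          (use nz p in auto)
    qed auto
    moreover have "integral (cbox (-R) R) (fx R s) = G R s"
    proof -
      have wc: "continuous_on {-R..R} (\<lambda>y. w y s)"
        using wy[OF sT(1)] by (intro DERIV_continuous_on) (auto intro: has_field_derivative_at_within)
      have ic: "(\<lambda>y. J k y s * cutoff R y + E R s y) integrable_on {-R..R}"
        unfolding E_def mode_def mode1_def
        by (intro integrable_continuous_interval continuous_intros continuous_on_cutoff cont_sections(1)[OF cont_J] sT wc)
          auto
      \<comment> \<open>Adding an integral of value 0 replaces the derivatives of the test function
        by \<open>wyy\<close>; the equation for \<open>wt\<close> then turns the integrand into
        \<open>fx\<close>.\<close>
      have "((\<lambda>y. (J k y s * cutoff R y + E R s y) + (wyy y s * mode k (a s) y * cutoff R y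
      - w y s * (mode2 k (a s) y * cutoff R y + 2 * mode1 k (a s) y * cutoff1 R y + mode k (a s) y * cutoff2 R y)))
        has_integral (G R s + 0)) {-R..R}"
        unfolding G_def
        by (intro has_integral_add integrable_integral ic
              cutoff_integration_by_parts[where wy="\<lambda>y. wy y s"] R wy wyy sT)
      moreover have "(J k y s * cutoff R y + E R s y) + (wyy y s * mode k (a s) y * cutoff R y
      - w y s * (mode2 k (a s) y * cutoff R y + 2 * mode1 k (a s) y * cutoff1 R y + mode k (a s) y * cutoff2 R y)) = fx R s y" for y
      proof -
        have Jeq: "J k y s = w y s * (mode2 k (a s) y - potential p (a s) (a' s) y * mode k (a s) y)
           + nonlinearity p (a s) y (w y s) * mode k (a s) y - pr y s * mode k (a s) y + \<xi> y s * md y s"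
          unfolding J_def w_def pr_def md_def a'_eq[OF sT(2)]
          by (rule rate_density_eq[symmetric]) (simp add: gauged_def)
        have "(v * (m2 - q * m) + f * m - r * m + x * m') * u + v * (2 * m1 * u1 + m * u2)
            + (vv * m * u - v * (m2 * u + 2 * m1 * u1 + m * u2))
          = ((vv - q * v + f - r) * m + x * m') * u" for v vv m m1 m2 m' q f r x u u1 u2 :: real
          by algebra
        then show ?thesis unfolding fx_def E_def eqn[OF sT(1)] Jeq .
      qed
      ultimately have "(fx R s has_integral G R s) {-R..R}" by simp
      then show ?thesis by (simp add: integral_unique)
    qed
    ultimately show ?thesis by simp
  qed
  have e_le: "exp (- (a s / 4) * y\<^sup>2) * exp (- (a s / 4) * y\<^sup>2) \<le> exp (- d * y\<^sup>2)" if "s \<in> {0..T}" for s y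
  proof -
    have "2 * d * y\<^sup>2 \<le> a s * y\<^sup>2" using L(3)[OF that] by (intro mult_right_mono) auto
    then show ?thesis by (simp add: exp_add[symmetric])
  qed
  have \<xi>_eq: "\<xi> y s = gauged y s * exp (- (a s / 4) * y\<^sup>2)" for y s
    by (simp add: gauged_def exp_minus)
  \<comment> \<open>2 L bounds w up to weights. In the bracket, 16 = 2 * 2 * 4 stems from the
    product of the first derivatives of mode and cutoff, and 12 from the second derivative of the
    cutoff.\<close>
  define DE where "DE = 2 * L * (16 * (L + 1)\<^sup>2 + 12 * (L + 1))"
  have E_bound: "\<bar>E R s y\<bar> \<le> DE / R\<^sup>2 * (exp (- d * y\<^sup>2) * (1 + y\<^sup>2) ^ 5)"
    if "0 < R" "\<bar>y\<bar> \<le> R" "s \<in> {0..T}" for R s y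
  proof -
    define e where "e = exp (- (a s / 4) * y\<^sup>2)"
    define X where "X = 1 + y\<^sup>2"
    have X: "1 \<le> X" by (simp add: X_def)
    have e: "0 < e" by (simp add: e_def)
    define g where "g = gauged y s"
    have x: "\<xi> y s = g * e" unfolding g_def e_def by (rule \<xi>_eq)
    have w_eq: "w y s = (amplitude p (b s) (c s) y + g) * e"
      unfolding w_def profile_eq_amplitude x e_def[symmetric] by (simp add: algebra_simps)
    have W: "\<bar>w y s\<bar> \<le> 2 * L * X\<^sup>2 * e"
    proof -
      have "L * 1 \<le> L * X\<^sup>2" using X L(1) by (intro mult_left_mono one_le_power) auto
      moreover have "0 < amplitude p (b s) (c s) y"
        using pos[OF that(3)] by (intro amplitude_pos p) auto
      ultimately have "\<bar>amplitude p (b s) (c s) y + g\<bar> \<le> 2 * L * X\<^sup>2"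
        using L(4)[OF that(3), of y] L(5)[OF that(3), of y] unfolding X_def[symmetric] g_def[symmetric]
        by linarith
      then show ?thesis unfolding w_eq abs_mult using e by simp
    qed
    note mb = mode_bounds[OF k pos(1)[OF that(3)], of L y, folded X_def e_def]
    have aL: "a s \<le> L" using L(3)[OF that(3)] by simp
    note cb = cutoff_derivative_bounds[OF that(2,1), folded X_def]
    have "\<bar>2 * mode1 k (a s) y * cutoff1 R y + mode k (a s) y * cutoff2 R y\<bar>
       \<le> 2 * \<bar>mode1 k (a s) y\<bar> * \<bar>cutoff1 R y\<bar> + \<bar>mode k (a s) y\<bar> * \<bar>cutoff2 R y\<bar>"
      by (rule order_trans[OF abs_triangle_ineq]) (simp add: abs_mult)
    also have "\<dots> \<le> 2 * (2 * (L + 1)\<^sup>2 * X\<^sup>2 * e) * (4 * X / R\<^sup>2) + ((L + 1) * X * e) * (12 / R\<^sup>2)"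
      using mb[OF aL] cb X L(1) e by (intro add_mono mult_mono) auto
    also have "\<dots> = e / R\<^sup>2 * (16 * (L + 1)\<^sup>2 * X ^ 3 + 12 * (L + 1) * X)"
    proof -
      have "2 * (2 * l * X\<^sup>2 * e) * (4 * X / R\<^sup>2) + (m * X * e) * (12 / R\<^sup>2)
          = e / R\<^sup>2 * (16 * l * X ^ 3 + 12 * m * X)" for l m
        by (simp add: power2_eq_square power3_eq_cube algebra_simps add_divide_distrib)
      then show ?thesis by blast
    qed
    also have "\<dots> \<le> e / R\<^sup>2 * (16 * (L + 1)\<^sup>2 * X ^ 3 + 12 * (L + 1) * X ^ 3)"
      using e X L(1) power_increasing[of 1 3 X] by (intro mult_left_mono add_mono) auto
    finally have "\<bar>E R s y\<bar> \<le> (2 * L * X\<^sup>2 * e) * (e / R\<^sup>2 * (16 * (L + 1)\<^sup>2 * X ^ 3 + 12 * (L + 1) * X ^ 3))"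
      unfolding E_def abs_mult[of "w y s"] using W X L(1) e by (intro mult_mono) auto
    also have "\<dots> = DE / R\<^sup>2 * ((e * e) * X ^ 5)"
    proof -
      have "X ^ 5 = X\<^sup>2 * X ^ 3" by (simp flip: power_add)
      then show ?thesis unfolding DE_def distrib_right[symmetric] by simp
    qed
    also have "\<dots> \<le> DE / R\<^sup>2 * (exp (- d * y\<^sup>2) * X ^ 5)"
      using e_le[OF that(3), of y] X L(1) unfolding DE_def e_def
      by (intro mult_left_mono mult_right_mono) auto
    finally show ?thesis by (simp add: X_def)
  qed
  define C where "C = 2 * DJ * gauss_mass dJ (Suc n) + DE * gauss_mass d 5"
  have G_lim: "\<bar>G R s - (LINT y|lborel. J k y s)\<bar> \<le> C / R\<^sup>2" if R: "0 < R" and s: "s \<in> {t1..t2}" for R s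
  proof -
    have sT: "s \<in> {0<..<T}" "s \<in> {0..T}" using s S by auto
    have wc: "continuous_on {-R..R} (\<lambda>y. w y s)"
      using wy[OF sT(1)] by (intro DERIV_continuous_on) (auto intro: has_field_derivative_at_within)
    have ec: "continuous_on {-R..R} (E R s)"
      unfolding E_def mode_def mode1_def
      by (intro continuous_intros continuous_on_cutoff wc) auto
    have jc: "continuous_on {-R..R} (\<lambda>y. J k y s * cutoff R y)"
      by (intro continuous_intros continuous_on_cutoff cont_sections(1)[OF cont_J] sT)
    have "G R s = integral {-R..R} (\<lambda>y. J k y s * cutoff R y) + integral {-R..R} (E R s)"
      unfolding G_def by (intro integral_add integrable_continuous_interval ec jc)
    moreover have "\<bar>integral {-R..R} (\<lambda>y. J k y s * cutoff R y) - (LINT y|lborel. J k y s)\<bar>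
        \<le> 2 * DJ * gauss_mass dJ (Suc n) / R\<^sup>2"
      unfolding cutoff_def
      by (rule cutoff_integral_error[OF J(2) cont_sections(1)[OF cont_J sT(2)] R J(3)[OF k sT(2)]])
    moreover have "\<bar>integral {-R..R} (E R s)\<bar> \<le> DE / R\<^sup>2 * gauss_mass d 5"
      by (rule interval_integral_gauss_bound[OF L(2) ec]) (use E_bound[OF R _ sT(2)] L(1) in \<open>auto simp: DE_def\<close>)
    ultimately show ?thesis by (simp add: C_def add_divide_distrib)
  qed
  \<comment> \<open>The full pairing vanishes by orthogonality, so the cut-off pairing equals its
    own cutoff error.\<close>
  define C' where "C' = 2 * (L * (L + 1)) * gauss_mass d (Suc 3)"
  have H_lim: "\<bar>H R s\<bar> \<le> C' / R\<^sup>2" if R: "0 < R" and s: "s \<in> {0..T}" for R s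
  proof -
    have b: "\<bar>\<xi> y s * mode k (a s) y\<bar> \<le> (L * (L + 1)) * (exp (- d * y\<^sup>2) * (1 + y\<^sup>2) ^ 3)" for y
    proof -
      define e where "e = exp (- (a s / 4) * y\<^sup>2)"
      define X where "X = 1 + y\<^sup>2"
      have X: "1 \<le> X" by (simp add: X_def)
      have e: "0 < e" by (simp add: e_def)
      have aL: "a s \<le> L" using L(3)[OF s] by simp
      define g where "g = gauged y s"
      have x: "\<xi> y s = g * e" unfolding g_def e_def by (rule \<xi>_eq)
      have "\<bar>\<xi> y s * mode k (a s) y\<bar> \<le> (L * X\<^sup>2 * e) * ((L + 1) * X * e)"
        unfolding x abs_mult
        using mode_bounds(1)[OF k pos(1)[OF s] aL, of y] L(5)[OF s, of y] e L(1) X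
        by (intro mult_mono) (auto simp: X_def e_def g_def)
      also have "\<dots> = (L * (L + 1)) * ((e * e) * X ^ 3)" by (simp add: eval_nat_numeral)
      also have "\<dots> \<le> (L * (L + 1)) * (exp (- d * y\<^sup>2) * X ^ 3)"
        using e_le[OF s, of y] X L(1) unfolding e_def by (intro mult_left_mono mult_right_mono) auto
      finally show ?thesis by (simp add: X_def)
    qed
    have "continuous_on UNIV (\<lambda>y. \<xi> y s * mode k (a s) y)"
      unfolding mode_def by (intro continuous_intros cont_sections(1)[OF cont_\<xi>] s)
    from cutoff_integral_error[OF L(2) this R b] orth[OF s] show ?thesis
      by (simp add: H_def C'_def cutoff_def)
  qed
  have lim0: "(\<lambda>n. K / (real (Suc n))\<^sup>2) \<longlonglongrightarrow> 0" for K
  proof -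
    have "(\<lambda>n. K * (1 / real (Suc n) * (1 / real (Suc n)))) \<longlonglongrightarrow> K * (0 * 0)"
      by (intro tendsto_intros LIMSEQ_Suc[OF lim_1_over_n])
    then show ?thesis by (simp add: power2_eq_square)
  qed
  show ?thesis
  proof (rule uniform_limit_derivative_zero[where f="\<lambda>n. H (real (Suc n))" and f'="\<lambda>n. G (real (Suc n))"
        and e="\<lambda>n. C / (real (Suc n))\<^sup>2" and s=t1 and t=t2
        and g="\<lambda>s. LINT y|lborel. J k y s" and x=\<tau>])
    show "(\<lambda>n. H (real (Suc n)) s) \<longlonglongrightarrow> 0" if "s \<in> {t1..t2}" for s
      by (rule tendsto_rabs_zero_cancel, rule tendsto_sandwich[OF _ _ tendsto_const lim0[of C']])
        (use that S H_lim in auto)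
  qed (use t H_deriv G_lim lim0 in auto)
qed

lemma rate_zero:
  assumes k: "0 \<le> k" "k \<le> 1"
    and orth: "\<And>\<tau>. \<tau> \<in> {0..T} \<Longrightarrow> (LINT y|lborel. \<xi> y \<tau> * mode k (a \<tau>) y) = 0"
    and \<tau>: "\<tau> \<in> {0..T}"
  shows "orthogonality_rate p (mode k) (\<lambda>y. \<xi> y \<tau>) (b \<tau>) (c \<tau>) (b' \<tau>) (c' \<tau>) = 0"
proof -
  have cl: "closure {0<..<T} = {0..T}" using T by simp
  have "(LINT y|lborel. J k y \<tau>) = 0"
    by (rule continuous_constant_on_closure[where S="{0<..<T}"])
      (use continuous_on_rate[OF k] rate_zero_interior[OF k orth] \<tau> cl in auto)
  then show ?thesis
    using orthogonality_rate_mode[OF p pos(2)[OF \<tau>] pos(3)[OF \<tau>]] ac[OF \<tau>]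
    by (simp add: J_def gauged_def)
qed

end

section \<open>Expansion of the rates at a fixed time\<close>

lemma one_plus_powr_has_derivative:
  assumes "0 < 1 + x"
  shows "((\<lambda>x. K * (1 + x) powr e) has_real_derivative K * e * (1 + x) powr (e - 1)) (at (x::real))"
  using DERIV_cmult[OF DERIV_fun_powr[of "\<lambda>x. 1 + x" 1 x e], of K] assms
  by (auto intro!: derivative_eq_intros simp: mult.assoc)

text \<open>The Lagrange remainder contains (1 + x)^(-s - 3) \<le> 1 with x > 0, so the bound holds
  for every t \<ge> 0. Smallness of t cannot be assumed: it will be b y^2 / q with y ranging over
  the whole line.\<close>

lemma powr_minus_taylor3:
  fixes s t :: real
  assumes "0 < s" "0 \<le> t"
  shows "\<bar>(1 + t) powr (- s) - (1 - s * t + s * (s + 1) / 2 * t\<^sup>2)\<bar> \<le> s * (s + 1) * (s + 2) / 6 * t ^ 3"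
proof (cases "t = 0")
  case False
  then have t: "0 < t" using assms by simp
  define diff where "diff m x = (- 1) ^ m * pochhammer s m * (1 + x) powr (- s - real m)" for m x
  have "\<exists>x. 0 < x \<and> x < t \<and> (1 + t) powr (- s) = (\<Sum>m<3. diff m 0 / fact m * t ^ m) + diff 3 x / fact 3 * t ^ 3"
  proof (rule Maclaurin[OF t])
    show "\<forall>m x. m < 3 \<and> 0 \<le> x \<and> x \<le> t \<longrightarrow> DERIV (diff m) x :> diff (Suc m) x"
    proof (intro allI impI)
      fix m :: nat and x :: real assume "m < 3 \<and> 0 \<le> x \<and> x \<le> t"
      then have "0 < 1 + x" by simp
      from one_plus_powr_has_derivative[OF this, of "(- 1) ^ m * pochhammer s m" "- s - real m"]
      show "DERIV (diff m) x :> diff (Suc m) x" unfolding diff_def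
        by (rule DERIV_cong) (simp add: pochhammer_Suc algebra_simps)
    qed
  qed (auto simp: diff_def)
  then obtain x where x: "0 < x" "x < t"
    "(1 + t) powr (- s) = (\<Sum>m<3. diff m 0 / fact m * t ^ m) + diff 3 x / fact 3 * t ^ 3" by blast
  have sum: "(\<Sum>m<3. diff m 0 / fact m * t ^ m) = 1 - s * t + s * (s + 1) / 2 * t\<^sup>2"
    by (simp add: diff_def eval_nat_numeral pochhammer_rec algebra_simps)
  have "(1 + t) powr (- s) - (1 - s * t + s * (s + 1) / 2 * t\<^sup>2)
      = - (s * (s + 1) * (s + 2) / 6 * t ^ 3) * (1 + x) powr (- s - 3)"
    unfolding x(3) sum by (simp add: diff_def eval_nat_numeral pochhammer_rec algebra_simps)
  moreover have "(1 + x) powr (- s - 3) \<le> 1" using powr_mono[of "- s - 3" 0 "1 + x"] x(1) assms by simp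
  ultimately show ?thesis using assms
    by (simp add: abs_mult mult_left_le)
qed simp

text \<open>The power is at most 1; the lower half combines ln (1 + t) \<le> t with exp (-z) \<ge> 1
  - z.\<close>

lemma powr_minus_taylor1:
  fixes s t :: real
  assumes "0 < s" "0 \<le> t"
  shows "\<bar>(1 + t) powr (- s) - 1\<bar> \<le> s * t"
proof -
  have "(1 + t) powr (- s) \<le> 1" using powr_mono[of "- s" 0 "1 + t"] assms by simp
  moreover have "1 - s * t \<le> (1 + t) powr (- s)"
  proof -
    have "s * ln (1 + t) \<le> s * t" using assms ln_add_one_self_le_self[of t] by (intro mult_left_mono) auto
    moreover have "1 + - (s * ln (1 + t)) \<le> exp (- (s * ln (1 + t)))" by (rule exp_ge_add_one_self)
    moreover have "(1 + t) powr (- s) = exp (- (s * ln (1 + t)))" using assms by (simp add: powr_def)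
    ultimately show ?thesis by linarith
  qed
  ultimately show ?thesis by simp
qed

text \<open>The second-order remainder at \<open>v\<close> is \<open>v powr p\<close> times the remainder at \<open>1\<close> with
  \<open>\<theta> = h / v\<close>. It is quadratic for \<open>\<theta>\<close> near \<open>0\<close> and of order \<open>\<bar>\<theta>\<bar> powr p\<close> away from \<open>0\<close>;
  for \<open>p < 2\<close> the second bound dominates the first, which removes the singular factor \<open>v powr (p - 2)\<close>.\<close>

lemma signed_power_taylor_unit:
  assumes "1 < p"
  obtains C where "0 \<le> C"
    "\<And>\<theta>::real. \<bar>\<theta>\<bar> \<le> 1/2 \<Longrightarrow> \<bar>\<bar>1 + \<theta>\<bar> powr (p - 1) * (1 + \<theta>) - 1 - p * \<theta>\<bar> \<le> C * \<theta>\<^sup>2"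
    "\<And>\<theta>::real. 1/2 < \<bar>\<theta>\<bar> \<Longrightarrow> \<bar>\<bar>1 + \<theta>\<bar> powr (p - 1) * (1 + \<theta>) - 1 - p * \<theta>\<bar> \<le> C * \<bar>\<theta>\<bar> powr p"
proof -
  define C1 where "C1 = p * (p - 1) * 2 powr \<bar>p - 2\<bar>"
  define C2 where "C2 = 3 powr p + 2 powr p + p * 2 powr (p - 1)"
  have C: "0 \<le> C1" "0 \<le> C2" using assms by (auto simp: C1_def C2_def)
  have near: "\<bar>\<bar>1 + \<theta>\<bar> powr (p - 1) * (1 + \<theta>) - 1 - p * \<theta>\<bar> \<le> C1 * \<theta>\<^sup>2" if th: "\<bar>\<theta>\<bar> \<le> 1/2" for \<theta> :: real
  proof -
    define diff where "diff m x = (if m = 0 then (1 + x) powr p else if m = Suc 0 then p * (1 + x) powr (p - 1)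
      else p * (p - 1) * (1 + x) powr (p - 2))" for m :: nat and x :: real
    have "\<exists>x. \<bar>x\<bar> \<le> \<bar>\<theta>\<bar> \<and> (1 + \<theta>) powr p = (\<Sum>m<2. diff m 0 / fact m * \<theta> ^ m) + diff 2 x / fact 2 * \<theta> ^ 2"
    proof (rule Maclaurin_bi_le)
      show "\<forall>m x. m < 2 \<and> \<bar>x\<bar> \<le> \<bar>\<theta>\<bar> \<longrightarrow> DERIV (diff m) x :> diff (Suc m) x"
      proof (intro allI impI)
        fix m :: nat and x :: real assume H: "m < 2 \<and> \<bar>x\<bar> \<le> \<bar>\<theta>\<bar>"
        then have "0 < 1 + x" using th by auto
        moreover from H have "m = 0 \<or> m = 1" by auto
        ultimately show "DERIV (diff m) x :> diff (Suc m) x" unfolding diff_def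
          using one_plus_powr_has_derivative[of x 1 p] one_plus_powr_has_derivative[of x p "p - 1"] by auto
      qed
    qed (auto simp: diff_def)
    then obtain x where x: "\<bar>x\<bar> \<le> \<bar>\<theta>\<bar>"
      "(1 + \<theta>) powr p = (\<Sum>m<2. diff m 0 / fact m * \<theta> ^ m) + diff 2 x / fact 2 * \<theta> ^ 2" by blast
    have x': "1/2 \<le> 1 + x" "1 + x \<le> 2" using x(1) th by auto
    \<comment> \<open>1 + x lies between 1/2 and 2, so the exponent |p - 2| covers both signs of p -
      2.\<close>
    have "(1 + x) powr (p - 2) \<le> 2 powr \<bar>p - 2\<bar>"
    proof (cases "2 \<le> p")
      case True
      then show ?thesis using x' by (auto intro!: powr_mono2)
    next
      case False
      then have "(1 + x) powr (p - 2) \<le> (1/2) powr (p - 2)" using x' by (intro powr_mono2') auto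
      also have "\<dots> = 2 powr (2 - p)" by (simp add: powr_divide powr_minus[symmetric] powr_minus_divide[symmetric])
      finally show ?thesis using False by simp
    qed
    then have "p * (p - 1) * (1 + x) powr (p - 2) \<le> C1"
      unfolding C1_def using assms by (intro mult_left_mono) auto
    moreover have "0 \<le> p * (p - 1) * (1 + x) powr (p - 2)" using assms by simp
    ultimately have "\<bar>diff 2 x / fact 2 * \<theta>\<^sup>2\<bar> \<le> C1 * \<theta>\<^sup>2"
      unfolding abs_mult by (intro mult_mono) (auto simp: diff_def)
    moreover have "(1 + \<theta>) powr p = \<bar>1 + \<theta>\<bar> powr (p - 1) * (1 + \<theta>)"
      using th by (simp add: powr_diff)
    ultimately show ?thesis using x(2) by (simp add: diff_def eval_nat_numeral)
  qed
  have far: "\<bar>\<bar>1 + \<theta>\<bar> powr (p - 1) * (1 + \<theta>) - 1 - p * \<theta>\<bar> \<le> C2 * \<bar>\<theta>\<bar> powr p" if th: "1/2 < \<bar>\<theta>\<bar>" for \<theta> :: real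
  proof -
    have "\<bar>\<bar>1 + \<theta>\<bar> powr (p - 1) * (1 + \<theta>)\<bar> = \<bar>1 + \<theta>\<bar> powr p"
      by (cases "1 + \<theta> = 0") (simp_all add: abs_mult powr_diff)
    also have "\<dots> \<le> (3 * \<bar>\<theta>\<bar>) powr p" using th assms by (intro powr_mono2) auto
    also have "\<dots> = 3 powr p * \<bar>\<theta>\<bar> powr p" by (simp add: powr_mult)
    finally have 1: "\<bar>\<bar>1 + \<theta>\<bar> powr (p - 1) * (1 + \<theta>)\<bar> \<le> 3 powr p * \<bar>\<theta>\<bar> powr p" .
    have "1 \<le> (2 * \<bar>\<theta>\<bar>) powr p" using th assms by (intro ge_one_powr_ge_zero) auto
    then have 2: "1 \<le> 2 powr p * \<bar>\<theta>\<bar> powr p" by (simp add: powr_mult)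
    have "1 \<le> (2 * \<bar>\<theta>\<bar>) powr (p - 1)" using th assms by (intro ge_one_powr_ge_zero) auto
    then have "\<bar>\<theta>\<bar> * 1 \<le> \<bar>\<theta>\<bar> * (2 * \<bar>\<theta>\<bar>) powr (p - 1)" by (intro mult_left_mono) auto
    also have "\<dots> = 2 powr (p - 1) * \<bar>\<theta>\<bar> powr p"
      using th by (simp add: powr_mult powr_diff)
    finally have "p * \<bar>\<theta>\<bar> \<le> p * (2 powr (p - 1) * \<bar>\<theta>\<bar> powr p)" using assms by (intro mult_left_mono) auto
    then have 3: "\<bar>p * \<theta>\<bar> \<le> p * 2 powr (p - 1) * \<bar>\<theta>\<bar> powr p" using assms by (simp add: abs_mult)
    show ?thesis unfolding C2_def distrib_right using 1 2 3 by linarith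
  qed
  show thesis
  proof (rule that[of "C1 + C2"])
    fix \<theta> :: real
    show "\<bar>\<bar>1 + \<theta>\<bar> powr (p - 1) * (1 + \<theta>) - 1 - p * \<theta>\<bar> \<le> (C1 + C2) * \<theta>\<^sup>2" if "\<bar>\<theta>\<bar> \<le> 1/2"
      using near[OF that] C mult_right_mono[of C1 "C1 + C2" "\<theta>\<^sup>2"] by simp
    show "\<bar>\<bar>1 + \<theta>\<bar> powr (p - 1) * (1 + \<theta>) - 1 - p * \<theta>\<bar> \<le> (C1 + C2) * \<bar>\<theta>\<bar> powr p" if "1/2 < \<bar>\<theta>\<bar>"
      using far[OF that] C mult_right_mono[of C2 "C1 + C2" "\<bar>\<theta>\<bar> powr p"] by simp
  qed (use C in auto)
qed

text \<open>Only an upper bound on v is assumed, since the amplitude to be inserted for v tends to 0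
  as y grows.\<close>

lemma signed_power_taylor:
  assumes "1 < p"
  obtains C where "0 \<le> C"
    "\<And>v h::real. 0 < v \<Longrightarrow> v \<le> M \<Longrightarrow>
       \<bar>\<bar>v + h\<bar> powr (p - 1) * (v + h) - v powr (p - 1) * v - p * v powr (p - 1) * h\<bar> \<le> C * (h\<^sup>2 + \<bar>h\<bar> powr p)"
proof -
  from signed_power_taylor_unit[OF assms] obtain C where C: "0 \<le> C"
    "\<And>\<theta>::real. \<bar>\<theta>\<bar> \<le> 1/2 \<Longrightarrow> \<bar>\<bar>1 + \<theta>\<bar> powr (p - 1) * (1 + \<theta>) - 1 - p * \<theta>\<bar> \<le> C * \<theta>\<^sup>2"
    "\<And>\<theta>::real. 1/2 < \<bar>\<theta>\<bar> \<Longrightarrow> \<bar>\<bar>1 + \<theta>\<bar> powr (p - 1) * (1 + \<theta>) - 1 - p * \<theta>\<bar> \<le> C * \<bar>\<theta>\<bar> powr p"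
    by metis
  show thesis
  proof (rule that[of "C * (1 + M powr (p - 2))"])
    fix v h :: real assume v: "0 < v" "v \<le> M"
    define \<theta> where "\<theta> = h / v"
    have h: "h = v * \<theta>" using v by (simp add: \<theta>_def)
    have hp: "\<bar>h\<bar> powr p = v powr p * \<bar>\<theta>\<bar> powr p" using v by (simp add: h abs_mult powr_mult)
    have "v + h = v * (1 + \<theta>)" by (simp add: h algebra_simps)
    then have "\<bar>v + h\<bar> powr (p - 1) * (v + h) = (v powr (p - 1) * v) * (\<bar>1 + \<theta>\<bar> powr (p - 1) * (1 + \<theta>))"
      using v by (simp add: abs_mult powr_mult)
    then have "\<bar>v + h\<bar> powr (p - 1) * (v + h) - v powr (p - 1) * v - p * v powr (p - 1) * h
        = (v powr (p - 1) * v) * (\<bar>1 + \<theta>\<bar> powr (p - 1) * (1 + \<theta>) - 1 - p * \<theta>)"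
      by (simp add: h algebra_simps)
    moreover have vp: "v powr (p - 1) * v = v powr p" using v by (simp add: powr_diff)
    ultimately have eq: "\<bar>\<bar>v + h\<bar> powr (p - 1) * (v + h) - v powr (p - 1) * v - p * v powr (p - 1) * h\<bar>
        = v powr p * \<bar>\<bar>1 + \<theta>\<bar> powr (p - 1) * (1 + \<theta>) - 1 - p * \<theta>\<bar>"
      by (simp add: abs_mult)
    have fin1: "C * \<bar>h\<bar> powr p \<le> C * (1 + M powr (p - 2)) * (h\<^sup>2 + \<bar>h\<bar> powr p)"
    proof -
      have "1 * \<bar>h\<bar> powr p \<le> (1 + M powr (p - 2)) * (h\<^sup>2 + \<bar>h\<bar> powr p)" by (intro mult_mono) auto
      from mult_left_mono[OF this C(1)] show ?thesis by (simp add: mult.assoc)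
    qed
    have fin2: "C * (M powr (p - 2) * h\<^sup>2) \<le> C * (1 + M powr (p - 2)) * (h\<^sup>2 + \<bar>h\<bar> powr p)"
    proof -
      have "M powr (p - 2) * h\<^sup>2 \<le> (1 + M powr (p - 2)) * (h\<^sup>2 + \<bar>h\<bar> powr p)" by (intro mult_mono) auto
      from mult_left_mono[OF this C(1)] show ?thesis by (simp add: mult.assoc)
    qed
    show "\<bar>\<bar>v + h\<bar> powr (p - 1) * (v + h) - v powr (p - 1) * v - p * v powr (p - 1) * h\<bar>
        \<le> C * (1 + M powr (p - 2)) * (h\<^sup>2 + \<bar>h\<bar> powr p)"
    proof (cases "\<bar>\<theta>\<bar> \<le> 1/2")
      case far: False
      then have "v powr p * \<bar>\<bar>1 + \<theta>\<bar> powr (p - 1) * (1 + \<theta>) - 1 - p * \<theta>\<bar> \<le> v powr p * (C * \<bar>\<theta>\<bar> powr p)"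
        by (intro mult_left_mono C(3)) auto
      also have "\<dots> = C * \<bar>h\<bar> powr p" by (simp add: hp)
      finally show ?thesis using eq fin1 by linarith
    next
      case near: True
      then have le: "v powr p * \<bar>\<bar>1 + \<theta>\<bar> powr (p - 1) * (1 + \<theta>) - 1 - p * \<theta>\<bar> \<le> v powr p * (C * \<theta>\<^sup>2)"
        by (intro mult_left_mono C(2)) auto
      show ?thesis
      proof (cases "2 \<le> p")
        case True
        have "v powr p * (C * \<theta>\<^sup>2) = C * (v powr (p - 2) * h\<^sup>2)"
          using v by (simp add: h power_mult_distrib powr_diff)
        also have "\<dots> \<le> C * (M powr (p - 2) * h\<^sup>2)"
          using v True C(1) by (intro mult_left_mono mult_right_mono powr_mono2) auto
        finally show ?thesis using eq fin2 le by linarith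
      next
        case False
        have "\<theta>\<^sup>2 \<le> \<bar>\<theta>\<bar> powr p"
        proof (cases "\<theta> = 0")
          case nz: False
          have "\<theta>\<^sup>2 = \<bar>\<theta>\<bar> powr 2" using nz by (simp add: powr_numeral)
          also have "\<dots> \<le> \<bar>\<theta>\<bar> powr p" using near False nz by (intro powr_mono') auto
          finally show ?thesis .
        qed simp
        then have "v powr p * (C * \<theta>\<^sup>2) \<le> v powr p * (C * \<bar>\<theta>\<bar> powr p)"
          using C(1) by (intro mult_left_mono) auto
        also have "\<dots> = C * \<bar>h\<bar> powr p" by (simp add: hp)
        finally show ?thesis using eq fin1 le by linarith
      qed
    qed
  qed (use C in auto)
qed

text \<open>Besides the size of the solution, Cramer's rule gives its uniqueness, which turns the
  \<open>THE\<close> in \<open>velocity\<close> into an actual value.\<close>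

lemma linear_2x2_solve:
  fixes m0 m1 n0 n1 e0 e1 :: real
  assumes "0 < \<delta>" "\<delta> \<le> \<bar>m0 * n1 - m1 * n0\<bar>" "\<bar>m0\<bar> \<le> L" "\<bar>m1\<bar> \<le> L" "\<bar>n0\<bar> \<le> L" "\<bar>n1\<bar> \<le> L"
    and "\<bar>e0\<bar> \<le> \<rho>" "\<bar>e1\<bar> \<le> \<rho>"
  obtains x y where "e0 + x * m0 + y * n0 = 0" "e1 + x * m1 + y * n1 = 0"
    "\<bar>x\<bar> \<le> 2 * L * \<rho> / \<delta>" "\<bar>y\<bar> \<le> 2 * L * \<rho> / \<delta>"
    "\<And>x' y'. e0 + x' * m0 + y' * n0 = 0 \<Longrightarrow> e1 + x' * m1 + y' * n1 = 0 \<Longrightarrow> x' = x \<and> y' = y"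
proof -
  define D where "D = m0 * n1 - m1 * n0"
  have D: "D \<noteq> 0" "\<delta> \<le> \<bar>D\<bar>" using assms by (auto simp: D_def)
  define x where "x = (n0 * e1 - n1 * e0) / D"
  define y where "y = (m1 * e0 - m0 * e1) / D"
  have est: "\<bar>(u * e - v * f) / D\<bar> \<le> 2 * L * \<rho> / \<delta>"
    if "\<bar>u\<bar> \<le> L" "\<bar>v\<bar> \<le> L" "\<bar>e\<bar> \<le> \<rho>" "\<bar>f\<bar> \<le> \<rho>" for u v e f
  proof -
    have "\<bar>u * e\<bar> \<le> L * \<rho>" "\<bar>v * f\<bar> \<le> L * \<rho>"
      unfolding abs_mult using that by (auto intro!: mult_mono)
    then have "\<bar>u * e - v * f\<bar> \<le> 2 * L * \<rho>" by linarith
    then show ?thesis unfolding abs_divide using assms(1) D by (intro frac_le) auto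
  qed
  show thesis
  proof (rule that[of x y])
    show "e0 + x * m0 + y * n0 = 0" "e1 + x * m1 + y * n1 = 0"
      using D(1) by (simp_all add: x_def y_def field_simps) (simp_all add: D_def algebra_simps)
    show "\<bar>x\<bar> \<le> 2 * L * \<rho> / \<delta>" "\<bar>y\<bar> \<le> 2 * L * \<rho> / \<delta>"
      unfolding x_def y_def by (intro est assms)+
    fix x' y' assume "e0 + x' * m0 + y' * n0 = 0" "e1 + x' * m1 + y' * n1 = 0"
    then have e: "e0 = - (x' * m0 + y' * n0)" "e1 = - (x' * m1 + y' * n1)" by linarith+
    have "n0 * e1 - n1 * e0 = x' * D" "m1 * e0 - m0 * e1 = y' * D"
      unfolding e D_def by (simp_all add: algebra_simps)
    then show "x' = x \<and> y' = y" using D(1) by (simp add: x_def y_def)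
  qed
qed

text \<open>For variance 1/a the moments of a y^2 of order 0 to 3 are the double factorials 1, 1, 3,
  15.\<close>

lemma gaussian_moment_quartic:
  assumes "0 < a"
  shows "has_bochner_integral lborel
    (\<lambda>y. exp (- (a / 2) * y\<^sup>2) * ((1 - k * (a * y\<^sup>2)) * (g0 + g1 * (a * y\<^sup>2) + g2 * (a * y\<^sup>2)\<^sup>2)))
    (sqrt (2 * pi / a) * (g0 + g1 + 3 * g2 - k * (g0 + 3 * g1 + 15 * g2)))"
proof -
  note m = gaussian_moment[OF assms]
  have "has_bochner_integral lborel
    (\<lambda>y. g0 * (exp (- (a / 2) * y\<^sup>2) * y ^ (2 * 0)) + (g1 - k * g0) * a * (exp (- (a / 2) * y\<^sup>2) * y ^ (2 * 1))
       + (g2 - k * g1) * a^2 * (exp (- (a / 2) * y\<^sup>2) * y ^ (2 * 2)) - k * g2 * a^3 * (exp (- (a / 2) * y\<^sup>2) * y ^ (2 * 3)))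
    (g0 * (sqrt (2 * pi / a) * (fact (2 * 0) / ((2 * a) ^ 0 * fact 0)))
     + (g1 - k * g0) * a * (sqrt (2 * pi / a) * (fact (2 * 1) / ((2 * a) ^ 1 * fact 1)))
     + (g2 - k * g1) * a^2 * (sqrt (2 * pi / a) * (fact (2 * 2) / ((2 * a) ^ 2 * fact 2)))
     - k * g2 * a^3 * (sqrt (2 * pi / a) * (fact (2 * 3) / ((2 * a) ^ 3 * fact 3))))"
    by (intro has_bochner_integral_add has_bochner_integral_diff has_bochner_integral_mult_right m)
  moreover have "(\<lambda>y. g0 * (exp (- (a / 2) * y\<^sup>2) * y ^ (2 * 0)) + (g1 - k * g0) * a * (exp (- (a / 2) * y\<^sup>2) * y ^ (2 * 1))
       + (g2 - k * g1) * a^2 * (exp (- (a / 2) * y\<^sup>2) * y ^ (2 * 2)) - k * g2 * a^3 * (exp (- (a / 2) * y\<^sup>2) * y ^ (2 * 3)))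
    = (\<lambda>y. exp (- (a / 2) * y\<^sup>2) * ((1 - k * (a * y\<^sup>2)) * (g0 + g1 * (a * y\<^sup>2) + g2 * (a * y\<^sup>2)\<^sup>2)))"
  proof
    fix y
    show "g0 * (exp (- (a / 2) * y\<^sup>2) * y ^ (2 * 0)) + (g1 - k * g0) * a * (exp (- (a / 2) * y\<^sup>2) * y ^ (2 * 1))
       + (g2 - k * g1) * a^2 * (exp (- (a / 2) * y\<^sup>2) * y ^ (2 * 2)) - k * g2 * a^3 * (exp (- (a / 2) * y\<^sup>2) * y ^ (2 * 3))
      = exp (- (a / 2) * y\<^sup>2) * ((1 - k * (a * y\<^sup>2)) * (g0 + g1 * (a * y\<^sup>2) + g2 * (a * y\<^sup>2)\<^sup>2))"
      by (simp add: eval_nat_numeral algebra_simps)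
  qed
  moreover have "(g0 * (sqrt (2 * pi / a) * (fact (2 * 0) / ((2 * a) ^ 0 * fact 0)))
     + (g1 - k * g0) * a * (sqrt (2 * pi / a) * (fact (2 * 1) / ((2 * a) ^ 1 * fact 1)))
     + (g2 - k * g1) * a^2 * (sqrt (2 * pi / a) * (fact (2 * 2) / ((2 * a) ^ 2 * fact 2)))
     - k * g2 * a^3 * (sqrt (2 * pi / a) * (fact (2 * 3) / ((2 * a) ^ 3 * fact 3))))
    = (sqrt (2 * pi / a) * (g0 + g1 + 3 * g2 - k * (g0 + 3 * g1 + 15 * g2)))"
    using assms by (simp add: fact_numeral power_mult_distrib field_simps)
  ultimately show ?thesis by (simp only:)
qed

section \<open>Predicted velocities and the residual of the profile\<close>

definition b_rate :: "real \<Rightarrow> real \<Rightarrow> real \<Rightarrow> real" where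
  "b_rate p b c = - (2 * (3 * p - 1) / (p - 1)\<^sup>2) * b\<^sup>2 + 2 * b * (c - (2 * c - 1/2))"

definition c_rate :: "real \<Rightarrow> real \<Rightarrow> real \<Rightarrow> real" where
  "c_rate p b c = c * (2 * (c - (2 * c - 1/2)) - 2 / (p - 1) * b)"

text \<open>The bounds on a allow one Gaussian for all states. The condition on c - a makes it O(b),
  so that (c - a) b^2 counts as third order and the predicted velocity of c is O(b).
  \<open>K\<close> stays free until the bootstrap bounds determine it.\<close>

definition near_blowup :: "real \<Rightarrow> real \<Rightarrow> real \<Rightarrow> real \<Rightarrow> bool" where
  "near_blowup K a b c \<longleftrightarrow>
     a = 2 * c - 1/2 \<and> 1/4 \<le> a \<and> a \<le> 3/4 \<and> 0 < b \<and> b \<le> 1 \<and> \<bar>c - a\<bar> \<le> K * b"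

lemma near_blowup_c:
  assumes "near_blowup K a b c"
  shows "3/8 \<le> c" "c \<le> 5/8"
  using assms by (auto simp: near_blowup_def)

text \<open>All profile terms become powers of 1 + t with the common factor V0. The rational form of
  V^q closes the family: both V^q V and the derivative of V in b reduce to the second form.\<close>

lemma amplitude_power_forms:
  fixes p b c y :: real
  assumes "1 < p" "0 \<le> b" "0 < c"
  defines "q \<equiv> p - 1"
  defines "V0 \<equiv> (2 * c / q) powr (1 / q)" and "t \<equiv> b * y\<^sup>2 / q"
  shows "amplitude p b c y = V0 * (1 + t) powr (- (1 / q))"
    and "amplitude p b c y / (q + b * y\<^sup>2) = V0 / q * (1 + t) powr (- (1 / q + 1))"
    and "amplitude p b c y powr q = 2 * c / (q + b * y\<^sup>2)"
proof -
  have q: "0 < q" using assms by simp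
  have t: "0 \<le> t" using assms q by (simp add: t_def)
  have D: "q + b * y\<^sup>2 = q * (1 + t)" using q by (simp add: t_def field_simps)
  have "2 * c / (q + b * y\<^sup>2) = (2 * c / q) * (1 / (1 + t))" unfolding D by simp
  then have amp: "amplitude p b c y = ((2 * c / q) * (1 / (1 + t))) powr (1 / q)"
    unfolding amplitude_def q_def[symmetric] by (simp only:)
  also have "\<dots> = V0 * (1 / (1 + t)) powr (1 / q)"
    using assms q t unfolding V0_def by (intro powr_mult)
  finally show 1: "amplitude p b c y = V0 * (1 + t) powr (- (1 / q))"
    using t by (simp add: powr_divide powr_minus_divide)
  have "(1 + t) powr (- (1 / q + 1)) = (1 + t) powr (- (1 / q)) / (1 + t)"
    using t powr_diff[of "1 + t" "- (1 / q)" 1] by simp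
  then show "amplitude p b c y / (q + b * y\<^sup>2) = V0 / q * (1 + t) powr (- (1 / q + 1))"
    unfolding 1 D by simp
  have "0 < 2 * c / (q + b * y\<^sup>2)"
    unfolding D using assms(3) q t by (intro divide_pos_pos mult_pos_pos) linarith+
  then show "amplitude p b c y powr q = 2 * c / (q + b * y\<^sup>2)"
    using q unfolding amplitude_def q_def[symmetric] by (simp add: powr_powr del: abs_divide)
qed

text \<open>The predicted rates are exactly those for which the Gaussian averages of the expansion against
  both modes vanish through second order in \<open>z\<close> and \<open>d\<close>; here \<open>z = b / (q a)\<close>, \<open>d = c - a\<close>, \<open>r = 1 / q\<close>.\<close>

lemma residual_cancellation:
  fixes a c d z q r k :: real
  assumes "r * q = 1" "d = c - a" "k = 0 \<or> k = 1"
  defines "l \<equiv> 2 * c - 2 * a * z + 2 * a * k * q"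
  defines "g0 \<equiv> 2 * c - l"
    and "g1 \<equiv> l * r * z - 2 * c * (r + 1) * z + (2 * z * d - 2 * (3 + 2 * r) * a * z\<^sup>2)"
    and "g2 \<equiv> c * (r + 1) * (r + 2) * z\<^sup>2 - l * r * (r + 1) / 2 * z\<^sup>2"
  shows "g0 + g1 + 3 * g2 - k * (g0 + 3 * g1 + 15 * g2)
     = (1 - 5 * k) * (6 * (r + 1) * d * z\<^sup>2 + 3 * a * r * (r + 1) * z ^ 3)"
proof -
  have "l * r = 2 * c * r - 2 * a * z * r + 2 * a * k"
    using assms(1) unfolding l_def by algebra
  then have lr: "l * r * z = (2 * c * r - 2 * a * z * r + 2 * a * k) * z"
    "l * r * (r + 1) / 2 * z\<^sup>2 = (2 * c * r - 2 * a * z * r + 2 * a * k) * (r + 1) / 2 * z\<^sup>2"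
    by simp_all
  from assms(3) show ?thesis
  proof
    assume k: "k = 0"
    show ?thesis unfolding g0_def g1_def g2_def lr unfolding l_def assms(2) k
      by (simp add: field_simps power2_eq_square power3_eq_cube)
  next
    assume k: "k = 1"
    show ?thesis unfolding g0_def g1_def g2_def lr unfolding l_def assms(2) k
      by (simp add: field_simps power2_eq_square power3_eq_cube)
  qed
qed

text \<open>The term 2 b (c - a) is quadratic as well, since c - a is O(b).\<close>

lemma b_rate_bound:
  assumes "1 < p" "near_blowup K a b c" "0 \<le> K"
  shows "\<bar>b_rate p b c\<bar> \<le> (2 * (3 * p - 1) / (p - 1)\<^sup>2 + 2 * K) * b\<^sup>2"
proof -
  have n: "a = 2 * c - 1/2" "0 < b" "\<bar>c - a\<bar> \<le> K * b" using assms(2) by (auto simp: near_blowup_def)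
  define E where "E = 2 * (3 * p - 1) / (p - 1)\<^sup>2"
  have E: "0 \<le> E" using assms(1) by (simp add: E_def)
  have "b_rate p b c = 2 * b * (c - a) - E * b\<^sup>2" unfolding b_rate_def n(1) E_def by simp
  moreover have "\<bar>2 * b * (c - a)\<bar> \<le> 2 * b * (K * b)"
    unfolding abs_mult[of "2 * b"] using n by (intro mult_mono) auto
  moreover have "0 \<le> E * b\<^sup>2" using E by simp
  moreover have "(E + 2 * K) * b\<^sup>2 = E * b\<^sup>2 + 2 * b * (K * b)" by (simp add: power2_eq_square algebra_simps)
  ultimately show ?thesis unfolding E_def[symmetric] by linarith
qed

lemma c_rate_bound:
  assumes "1 < p" "near_blowup K a b c" "0 \<le> K"
  shows "\<bar>c_rate p b c\<bar> \<le> (2 * K + 2 / (p - 1)) * b"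
proof -
  have n: "a = 2 * c - 1/2" "0 < b" "\<bar>c - a\<bar> \<le> K * b" using assms(2) by (auto simp: near_blowup_def)
  have c: "0 \<le> c" "c \<le> 1" using near_blowup_c[OF assms(2)] by auto
  have "\<bar>2 * (c - a) - 2 / (p - 1) * b\<bar> \<le> 2 * \<bar>c - a\<bar> + 2 / (p - 1) * b"
  proof -
    have "\<bar>2 * u - w\<bar> \<le> 2 * \<bar>u\<bar> + w" if "0 \<le> w" for u w :: real using that by linarith
    from this[of "2 / (p - 1) * b" "c - a"] show ?thesis using n assms(1) by simp
  qed
  also have "\<dots> \<le> (2 * K + 2 / (p - 1)) * b" using n by (simp add: algebra_simps)
  finally have "\<bar>2 * (c - a) - 2 / (p - 1) * b\<bar> \<le> (2 * K + 2 / (p - 1)) * b" .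
  then have "c * \<bar>2 * (c - a) - 2 / (p - 1) * b\<bar> \<le> 1 * ((2 * K + 2 / (p - 1)) * b)"
    using c by (intro mult_mono) auto
  then show ?thesis unfolding c_rate_def n(1) using c by (simp add: abs_mult)
qed

text \<open>The polynomial in a y^2 holds the expansion through second order and need not be small:
  for k = 1 its constant term stays away from 0 as b tends to 0. Only its Gaussian average against
  the mode is cubic, which is why the average and the pointwise error are separate claims.\<close>

lemma profile_residual:
  assumes "1 < p" "0 \<le> K"
  shows "\<exists>C\<ge>0. \<forall>k a b c. (k = 0 \<or> k = 1) \<and> near_blowup K a b c \<longrightarrow>
    (\<exists>g0 g1 g2. \<bar>g0 + g1 + 3 * g2 - k * (g0 + 3 * g1 + 15 * g2)\<bar> \<le> C * b ^ 3 \<and>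
      (\<forall>y. \<bar>(1 - k * a * y\<^sup>2) *
            (- (2 * a / (p - 1) + 2 * a * k) * amplitude p b c y + amplitude p b c y powr (p - 1) * amplitude p b c y
             + b_rate p b c * amplitude p b c y * y\<^sup>2 / ((p - 1) * (p - 1 + b * y\<^sup>2))
             - c_rate p b c * amplitude p b c y / ((p - 1) * c))
          - (1 - k * (a * y\<^sup>2)) * (g0 + g1 * (a * y\<^sup>2) + g2 * (a * y\<^sup>2)\<^sup>2)\<bar> \<le> C * b ^ 3 * (1 + y\<^sup>2) ^ 4))"
proof -
  define q where "q = p - 1"
  define r where "r = 1 / q"
  have q: "0 < q" "0 < r" "r * q = 1" using assms by (auto simp: q_def r_def)
  \<comment> \<open>5 / (4 q) is the value of 2 c / q at c = 5/8, the largest c allowed by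
    \<open>near_blowup\<close>.\<close>
  define VM where "VM = (5 / (4 * q)) powr r"
  define L0 where "L0 = 2 + 2 / q + 2 * q"
  define Kb where "Kb = 2 * (3 * p - 1) / (p - 1)\<^sup>2 + 2 * K"
  \<comment> \<open>\<open>Ca\<close> bounds the average left after cancellation, with 4 as the
    largest value of |1 - 5 k|. The three summands of \<open>Cm\<close> belong to the errors u - U,
    u' - U' and u' - 1 below.\<close>
  define Ca where "Ca = VM * r * (4 * (6 * (r + 1) * K * (4 / q)\<^sup>2 + 3 * r * (r + 1) * (4 / q) ^ 3))"
  define Cm where "Cm = L0 * (r * (r + 1) * (r + 2) / 6 / q ^ 3)
      + 2 * ((r + 1) * (r + 2) * (r + 3) / 6 / q ^ 3) + Kb / q * ((r + 1) / q)"
  define Cb where "Cb = VM * r * Cm"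
  have pos: "0 \<le> VM" "0 \<le> L0" "0 \<le> Kb" "0 \<le> Ca" "0 \<le> Cm" "0 \<le> Cb"
    using q assms by (auto simp: VM_def L0_def Kb_def Ca_def Cb_def Cm_def intro!: add_nonneg_nonneg mult_nonneg_nonneg divide_nonneg_nonneg)
  show ?thesis
  proof (rule exI[of _ "Ca + Cb"], intro conjI allI impI, goal_cases)
    case 1 show ?case using pos by simp
  next
    case (2 k a b c)
    then have k: "k = 0 \<or> k = 1" and nb: "near_blowup K a b c" by auto
    have n: "a = 2 * c - 1/2" "1/4 \<le> a" "a \<le> 3/4" "0 < b" "b \<le> 1" "\<bar>c - a\<bar> \<le> K * b"
      using nb by (auto simp: near_blowup_def)
    note cb = near_blowup_c[OF nb]
    define V0 where "V0 = (2 * c / q) powr (1 / q)"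
    have V0: "0 < V0" "V0 \<le> VM" using cb q unfolding V0_def VM_def r_def
      by (auto intro!: powr_mono2 simp: divide_simps)
    \<comment> \<open>Chosen so that z (a y^2) = b y^2 / q: polynomials in t become polynomials in a
      y^2 whose coefficients are powers of z.\<close>
    define z where "z = b / (q * a)"
    define d where "d = c - a"
    have z: "0 \<le> z" "z \<le> 4 / q * b" using n q by (auto simp: z_def field_simps)
    \<comment> \<open>q times the total coefficient of -V: the damping 2 a / q, the eigenvalue shift
      2 a k of the mode and the contribution of the predicted c-velocity.\<close>
    define l where "l = 2 * c - 2 * a * z + 2 * a * k * q"
    define g0 where "g0 = 2 * c - l"
    define g1 where "g1 = l * r * z - 2 * c * (r + 1) * z + (2 * z * d - 2 * (3 + 2 * r) * a * z\<^sup>2)"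
    define g2 where "g2 = c * (r + 1) * (r + 2) * z\<^sup>2 - l * r * (r + 1) / 2 * z\<^sup>2"
    have canc: "g0 + g1 + 3 * g2 - k * (g0 + 3 * g1 + 15 * g2)
     = (1 - 5 * k) * (6 * (r + 1) * d * z\<^sup>2 + 3 * a * r * (r + 1) * z ^ 3)"
      unfolding g0_def g1_def g2_def l_def by (rule residual_cancellation[OF q(3) d_def k])
    have az: "a * z = b / q" using n q by (simp add: z_def)
    have br: "b_rate p b c / q = a * (2 * z * d - 2 * (3 + 2 * r) * a * z\<^sup>2)"
    proof -
      have bz: "b = q * a * z" using n q by (simp add: z_def)
      have "b_rate p b c = - (2 * (3 * q + 2) / q\<^sup>2) * (q * a * z)\<^sup>2 + 2 * (q * a * z) * d"
      proof -
        have "3 * p - 1 = 3 * q + 2" "p - 1 = q" by (simp_all add: q_def)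
        then show ?thesis unfolding b_rate_def d_def n(1)[symmetric] bz[symmetric] by simp
      qed
      moreover have "2 * (3 * q + 2) / q\<^sup>2 * (q * a * z)\<^sup>2 = q * (2 * (3 + 2 * r) * a\<^sup>2 * z\<^sup>2)"
        using q(1) unfolding r_def by (simp add: field_simps power2_eq_square)
      ultimately have "b_rate p b c = q * (a * (2 * z * d - 2 * (3 + 2 * r) * a * z\<^sup>2))"
        by (simp add: algebra_simps power2_eq_square)
      then show ?thesis using q(1) by simp
    qed
    have cr: "c_rate p b c / c = 2 * d - 2 * a * z"
      unfolding c_rate_def d_def n(1)[symmetric] using cb az by (simp add: q_def[symmetric])
    show ?case
    proof (rule exI[of _ "V0 * r * g0"], rule exI[of _ "V0 * r * g1"], rule exI[of _ "V0 * r * g2"], intro conjI allI)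
      have "\<bar>d * z\<^sup>2\<bar> \<le> (K * b) * (4 / q * b)\<^sup>2"
        unfolding abs_mult using n z by (intro mult_mono) (auto simp: d_def intro!: power_mono)
      then have d1: "\<bar>6 * (r + 1) * (d * z\<^sup>2)\<bar> \<le> 6 * (r + 1) * ((K * b) * (4 / q * b)\<^sup>2)"
        unfolding abs_mult[of "6 * (r + 1)"] using q by (intro mult_mono) auto
      have "a * z ^ 3 \<le> 1 * (4 / q * b) ^ 3" using n z by (intro mult_mono power_mono) auto
      then have d2: "\<bar>3 * r * (r + 1) * (a * z ^ 3)\<bar> \<le> 3 * r * (r + 1) * (1 * (4 / q * b) ^ 3)"
        unfolding abs_mult[of "3 * r * (r + 1)"] using q z n by (intro mult_mono) auto
      have "6 * (r + 1) * d * z\<^sup>2 + 3 * a * r * (r + 1) * z ^ 3 = 6 * (r + 1) * (d * z\<^sup>2) + 3 * r * (r + 1) * (a * z ^ 3)"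
        by simp
      then have "\<bar>6 * (r + 1) * d * z\<^sup>2 + 3 * a * r * (r + 1) * z ^ 3\<bar>
         \<le> 6 * (r + 1) * ((K * b) * (4 / q * b)\<^sup>2) + 3 * r * (r + 1) * (1 * (4 / q * b) ^ 3)"
        using d1 d2 by linarith
      also have "\<dots> = (6 * (r + 1) * K * (4 / q)\<^sup>2 + 3 * r * (r + 1) * (4 / q) ^ 3) * b ^ 3"
        by (simp add: power_mult_distrib power2_eq_square power3_eq_cube algebra_simps add_divide_distrib)
      finally have "\<bar>1 - 5 * k\<bar> * \<bar>6 * (r + 1) * d * z\<^sup>2 + 3 * a * r * (r + 1) * z ^ 3\<bar>
        \<le> 4 * ((6 * (r + 1) * K * (4 / q)\<^sup>2 + 3 * r * (r + 1) * (4 / q) ^ 3) * b ^ 3)"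
        using k by (intro mult_mono) auto
      then have "(V0 * r) * (\<bar>1 - 5 * k\<bar> * \<bar>6 * (r + 1) * d * z\<^sup>2 + 3 * a * r * (r + 1) * z ^ 3\<bar>)
        \<le> (VM * r) * (4 * ((6 * (r + 1) * K * (4 / q)\<^sup>2 + 3 * r * (r + 1) * (4 / q) ^ 3) * b ^ 3))"
        by (rule mult_mono[rotated]) (use V0 q pos in auto)
      also have "\<dots> = Ca * b ^ 3" by (simp add: Ca_def)
      also have "\<dots> \<le> (Ca + Cb) * b ^ 3" using pos n by (intro mult_right_mono) auto
      finally have "\<bar>V0 * r * ((1 - 5 * k) * (6 * (r + 1) * d * z\<^sup>2 + 3 * a * r * (r + 1) * z ^ 3))\<bar> \<le> (Ca + Cb) * b ^ 3"
        using V0 q by (simp add: abs_mult)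
      then show "\<bar>V0 * r * g0 + V0 * r * g1 + 3 * (V0 * r * g2) - k * (V0 * r * g0 + 3 * (V0 * r * g1) + 15 * (V0 * r * g2))\<bar> \<le> (Ca + Cb) * b ^ 3"
        unfolding canc[symmetric] by (simp add: algebra_simps)
    next
      fix y :: real
      define x where "x = y\<^sup>2"
      define S where "S = 1 + y\<^sup>2"
      define t where "t = b * x / q"
      have x: "0 \<le> x" "x \<le> S" "1 \<le> S" by (auto simp: x_def S_def)
      have t: "0 \<le> t" using n x q by (simp add: t_def)
      have zt: "z * (a * x) = t" 
      proof -
        have "z * (a * x) = (a * z) * x" by simp
        then show ?thesis unfolding az t_def by simp
      qed
      define u where "u = (1 + t) powr (- r)"
      define u' where "u' = (1 + t) powr (- (r + 1))"
      define P where "P = 1 - k * a * y\<^sup>2"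
      note forms = amplitude_power_forms[of p b c y, folded q_def, folded V0_def r_def x_def, folded t_def, folded u_def u'_def]
      have cpos: "0 < c" using cb by simp
      have amp: "amplitude p b c y = V0 * u" "amplitude p b c y / (q + b * x) = V0 * r * u'"
        "amplitude p b c y powr q = 2 * c / (q + b * x)"
        using forms[OF assms(1) _ cpos] n by (auto simp: r_def)
      define U where "U = 1 - r * t + r * (r + 1) / 2 * t\<^sup>2"
      define U' where "U' = 1 - (r + 1) * t + (r + 1) * (r + 1 + 1) / 2 * t\<^sup>2"
      have e1: "\<bar>u - U\<bar> \<le> r * (r + 1) * (r + 2) / 6 * t ^ 3"
        unfolding u_def U_def using q t by (intro powr_minus_taylor3) auto
      have e2: "\<bar>u' - U'\<bar> \<le> (r + 1) * (r + 1 + 1) * (r + 1 + 2) / 6 * t ^ 3"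
        unfolding u'_def U'_def using q t by (intro powr_minus_taylor3) auto
      \<comment> \<open>First order suffices, because this u' is multiplied by the predicted
        b-velocity, which is already quadratic in b.\<close>
      have e3: "\<bar>u' - 1\<bar> \<le> (r + 1) * t"
        unfolding u'_def using q t by (intro powr_minus_taylor1) auto
      define bq where "bq = b_rate p b c / q"
      have exact: "- (2 * a / q + 2 * a * k) * amplitude p b c y + amplitude p b c y powr q * amplitude p b c y
             + b_rate p b c * amplitude p b c y * y\<^sup>2 / (q * (q + b * x))
             - c_rate p b c * amplitude p b c y / (q * c) = V0 * r * (- l * u + 2 * c * u' + bq * x * u')"
      proof -
        have 1: "amplitude p b c y powr q * amplitude p b c y = 2 * c * (V0 * r * u')"
          unfolding amp(3) amp(2)[symmetric] by simp
        have 2: "b_rate p b c * amplitude p b c y * y\<^sup>2 / (q * (q + b * x)) = bq * x * (V0 * r * u')"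
          unfolding bq_def amp(2)[symmetric] x_def by simp
        have 3: "c_rate p b c * amplitude p b c y / (q * c) = (2 * d - 2 * a * z) * r * (V0 * u)"
          unfolding cr[symmetric] amp(1) r_def by simp
        have "2 * a / q + 2 * a * k + (2 * d - 2 * a * z) * r = r * l"
          using q(1) unfolding l_def r_def d_def by (simp add: field_simps)
        then have 4: "(2 * a / q + 2 * a * k) * (V0 * u) + (2 * d - 2 * a * z) * r * (V0 * u) = r * l * (V0 * u)"
          by (simp flip: distrib_right)
        show ?thesis unfolding 1 2 3 using 4 unfolding amp(1) by (simp add: algebra_simps)
      qed
      \<comment> \<open>g0, g1, g2 are the coefficients of the Taylor polynomials after t is
        rewritten as z (a x).\<close>
      have poly: "g0 + g1 * (a * x) + g2 * (a * x)\<^sup>2 = - l * U + 2 * c * U' + bq * x"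
      proof -
        have "g0 + g1 * (a * x) + g2 * (a * x)\<^sup>2
          = 2 * c - l + l * r * (z * (a * x)) - 2 * c * (r + 1) * (z * (a * x)) + (a * (2 * z * d - 2 * (3 + 2 * r) * a * z\<^sup>2)) * x
            + c * (r + 1) * (r + 2) * (z * (a * x))\<^sup>2 - l * r * (r + 1) / 2 * (z * (a * x))\<^sup>2"
          unfolding g0_def g1_def g2_def by (simp add: algebra_simps power2_eq_square)
        also have "\<dots> = - l * U + 2 * c * U' + bq * x"
          unfolding zt br[symmetric] bq_def[symmetric] U_def U'_def by (simp add: field_simps)
        finally show ?thesis .
      qed
      have t3: "t ^ 3 \<le> b ^ 3 * S ^ 3 / q ^ 3"
      proof -
        have "t ^ 3 = b ^ 3 * x ^ 3 / q ^ 3" by (simp add: t_def power_mult_distrib power_divide)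
        also have "\<dots> \<le> b ^ 3 * S ^ 3 / q ^ 3"
          using x n q by (intro divide_right_mono mult_left_mono power_mono) auto
        finally show ?thesis .
      qed
      have l: "\<bar>l\<bar> \<le> L0"
      proof -
        have "0 \<le> a * z" "a * z \<le> 1 / q" using az n q by (auto simp: divide_right_mono)
        moreover have "0 \<le> a * k * q" "a * k * q \<le> q" using k n q by auto
        moreover have "2 * (1 / q) = 2 / q" by simp
        ultimately show ?thesis unfolding l_def L0_def using cb by (simp add: abs_le_iff mult.assoc)
      qed
      have bq: "\<bar>bq * x\<bar> \<le> Kb * b\<^sup>2 / q * S"
        unfolding abs_mult bq_def abs_divide using b_rate_bound[OF assms(1) nb assms(2)] q x
        by (intro mult_mono divide_mono) (auto simp: Kb_def)
      have diff: "\<bar>(- l * u + 2 * c * u' + bq * x * u') - (- l * U + 2 * c * U' + bq * x)\<bar> \<le> Cm * (b ^ 3 * S ^ 3)"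
      proof -
        have "(- l * u + 2 * c * u' + bq * x * u') - (- l * U + 2 * c * U' + bq * x)
          = - l * (u - U) + 2 * c * (u' - U') + (bq * x) * (u' - 1)" by (simp add: algebra_simps)
        moreover have "\<bar>- l * (u - U)\<bar> \<le> L0 * (r * (r + 1) * (r + 2) / 6 * (b ^ 3 * S ^ 3 / q ^ 3))"
          unfolding abs_mult abs_minus_cancel
        proof (rule mult_mono[OF l])
          show "\<bar>u - U\<bar> \<le> r * (r + 1) * (r + 2) / 6 * (b ^ 3 * S ^ 3 / q ^ 3)"
            by (rule order_trans[OF e1], rule mult_left_mono[OF t3]) (use q in simp)
        qed (use pos in auto)
        moreover have "\<bar>2 * c * (u' - U')\<bar> \<le> 2 * ((r + 1) * (r + 2) * (r + 3) / 6 * (b ^ 3 * S ^ 3 / q ^ 3))"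
          unfolding abs_mult[of "2 * c"]
        proof (rule mult_mono)
          have "r + 1 + 1 = r + 2" "r + 1 + 2 = r + 3" by simp_all
          note e2' = e2[unfolded this]
          show "\<bar>u' - U'\<bar> \<le> (r + 1) * (r + 2) * (r + 3) / 6 * (b ^ 3 * S ^ 3 / q ^ 3)"
            by (rule order_trans[OF e2'], rule mult_left_mono[OF t3]) (use q in simp)
        qed (use cb in auto)
        moreover have "\<bar>(bq * x) * (u' - 1)\<bar> \<le> (Kb * b\<^sup>2 / q * S) * ((r + 1) * (b * S / q))"
        proof -
          have "t \<le> b * S / q" unfolding t_def using n q x by (intro divide_right_mono mult_left_mono) auto
          then have "(r + 1) * t \<le> (r + 1) * (b * S / q)" using q by (intro mult_left_mono) auto
          then show ?thesis unfolding abs_mult[of "bq * x"] using bq e3 pos q n x by (intro mult_mono) auto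
        qed
        moreover have "(Kb * b\<^sup>2 / q * S) * ((r + 1) * (b * S / q)) \<le> Kb / q * ((r + 1) / q) * (b ^ 3 * S ^ 3)"
        proof -
          have "(Kb * b\<^sup>2 / q * S) * ((r + 1) * (b * S / q)) = Kb / q * ((r + 1) / q) * (b ^ 3 * S ^ 2)"
            by (simp add: power2_eq_square power3_eq_cube)
          also have "\<dots> \<le> Kb / q * ((r + 1) / q) * (b ^ 3 * S ^ 3)"
            using pos q n x by (intro mult_left_mono power_increasing) auto
          finally show ?thesis .
        qed
        ultimately have "\<bar>(- l * u + 2 * c * u' + bq * x * u') - (- l * U + 2 * c * U' + bq * x)\<bar>
          \<le> L0 * (r * (r + 1) * (r + 2) / 6 * (b ^ 3 * S ^ 3 / q ^ 3))
           + 2 * ((r + 1) * (r + 2) * (r + 3) / 6 * (b ^ 3 * S ^ 3 / q ^ 3)) + Kb / q * ((r + 1) / q) * (b ^ 3 * S ^ 3)"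
          by linarith
        also have "\<dots> = Cm * (b ^ 3 * S ^ 3)" 
        proof -
          have "A1 * (A2 * (B / Q)) + 2 * (A3 * (B / Q)) + A4 * B = (A1 * (A2 / Q) + 2 * (A3 / Q) + A4) * B"
            for A1 A2 A3 A4 B Q :: real by (simp add: algebra_simps)
          then show ?thesis unfolding Cm_def .
        qed
        finally show ?thesis .
      qed
      have P: "\<bar>P\<bar> \<le> S"
      proof -
        have "0 \<le> k * a" "k * a \<le> 1" using k n by auto
        then have "0 \<le> k * a * y\<^sup>2" "k * a * y\<^sup>2 \<le> 1 * y\<^sup>2" using mult_right_mono[of "k * a" 1 "y\<^sup>2"] by simp_all
        then show ?thesis unfolding P_def S_def by (simp add: abs_le_iff)
      qed
      have "P * (V0 * r * (- l * u + 2 * c * u' + bq * x * u')) - P * (V0 * r * g0 + V0 * r * g1 * (a * x) + V0 * r * g2 * (a * x)\<^sup>2)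
        = P * ((V0 * r) * ((- l * u + 2 * c * u' + bq * x * u') - (g0 + g1 * (a * x) + g2 * (a * x)\<^sup>2)))"
        by (simp add: algebra_simps)
      also have "\<bar>\<dots>\<bar> \<le> S * ((VM * r) * (Cm * (b ^ 3 * S ^ 3)))"
        unfolding poly abs_mult[of P] abs_mult[of "V0 * r"]
        using P diff V0 q x pos by (intro mult_mono) auto
      also have "\<dots> = Cb * b ^ 3 * S ^ 4" by (simp add: Cb_def eval_nat_numeral)
      also have "\<dots> \<le> (Ca + Cb) * b ^ 3 * S ^ 4" using pos n x by (intro mult_right_mono) auto
      finally show "\<bar>(1 - k * a * y\<^sup>2) *
            (- (2 * a / (p - 1) + 2 * a * k) * amplitude p b c y + amplitude p b c y powr (p - 1) * amplitude p b c y
             + b_rate p b c * amplitude p b c y * y\<^sup>2 / ((p - 1) * (p - 1 + b * y\<^sup>2))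
             - c_rate p b c * amplitude p b c y / ((p - 1) * c))
          - (1 - k * (a * y\<^sup>2)) * (V0 * r * g0 + V0 * r * g1 * (a * y\<^sup>2) + V0 * r * g2 * (a * y\<^sup>2)\<^sup>2)\<bar>
          \<le> (Ca + Cb) * b ^ 3 * (1 + y\<^sup>2) ^ 4"
        using exact unfolding q_def[symmetric] x_def[symmetric] P_def mult.assoc[of k a]
        by (simp add: S_def flip: x_def)
    qed
  qed
qed

section \<open>The rate at the predicted velocities\<close>

definition remainder_size :: "real \<Rightarrow> real \<Rightarrow> real \<Rightarrow> real" where
  "remainder_size p b N = b ^ 3 + b * N + N\<^sup>2 + N powr p"

lemma rate_density_measurable [measurable]:
  assumes [measurable]: "h \<in> borel_measurable borel"
  shows "(\<lambda>y. rate_density p k a b c b1 c1 (h y) y) \<in> borel_measurable borel"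
  unfolding rate_density_def amplitude_def by measurable

text \<open>Since a \<ge> 1/4, the function exp (- y^2 / 8) majorizes the Gaussians of all
  admissible states.\<close>

lemma gauss_factor_le:
  fixes a f D y :: real
  assumes "1/4 \<le> a" "\<bar>f\<bar> \<le> D * (1 + y\<^sup>2) ^ n"
  shows "\<bar>exp (- (a / 2) * y\<^sup>2) * f\<bar> \<le> D * (exp (- (1 / 8) * y\<^sup>2) * (1 + y\<^sup>2) ^ n)"
proof -
  have "1 / 4 * y\<^sup>2 \<le> a * y\<^sup>2" using assms(1) by (intro mult_right_mono) auto
  then have "exp (- (a / 2) * y\<^sup>2) * \<bar>f\<bar> \<le> exp (- (1 / 8) * y\<^sup>2) * (D * (1 + y\<^sup>2) ^ n)"
    using assms(2) by (intro mult_mono) auto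
  then show ?thesis by (simp add: abs_mult mult_ac)
qed

lemma gauss_mode_integral:
  "exp (- (a / 2) * y\<^sup>2) * ((1 - k * a * y\<^sup>2) * (exp (a / 4 * y\<^sup>2) * x)) = x * mode k a y"
proof -
  have "exp (- (a / 2) * y\<^sup>2) * exp (a / 4 * y\<^sup>2) = exp (- (a / 4) * y\<^sup>2)"
    by (simp add: exp_add[symmetric])
  then show ?thesis unfolding mode_def by (simp add: mult_ac)
qed

lemma weight_polynomial_bounds:
  fixes y :: real
  assumes "0 \<le> k" "k \<le> 1" "0 \<le> a" "a \<le> 1"
  shows "\<bar>1 - k * a * y\<^sup>2\<bar> \<le> 1 + y\<^sup>2"
    and "\<bar>k * a * y ^ 4 - (1 + 2 * k) * y\<^sup>2\<bar> \<le> 4 * (1 + y\<^sup>2)\<^sup>2"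
proof -
  have ka: "0 \<le> k * a" "k * a \<le> 1" using assms mult_mono[of k 1 a 1] by simp_all
  then have "0 \<le> k * a * y\<^sup>2" "k * a * y\<^sup>2 \<le> 1 * y\<^sup>2"
    using mult_right_mono[of "k * a" 1 "y\<^sup>2"] by simp_all
  then show "\<bar>1 - k * a * y\<^sup>2\<bar> \<le> 1 + y\<^sup>2" by (simp add: abs_le_iff)
  have y4: "0 \<le> y ^ 4" by simp
  have "0 \<le> k * a * y ^ 4" "k * a * y ^ 4 \<le> 1 * y ^ 4"
    using ka mult_right_mono[of "k * a" 1 "y ^ 4"] by simp_all
  moreover have "0 \<le> (1 + 2 * k) * y\<^sup>2" "(1 + 2 * k) * y\<^sup>2 \<le> 3 * y\<^sup>2"
    using assms by (auto intro!: mult_right_mono)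
  moreover have "4 * (1 + y\<^sup>2)\<^sup>2 = 4 + 8 * y\<^sup>2 + 4 * y ^ 4"
    by (simp add: power2_eq_square power4_eq_xxxx algebra_simps)
  ultimately show "\<bar>k * a * y ^ 4 - (1 + 2 * k) * y\<^sup>2\<bar> \<le> 4 * (1 + y\<^sup>2)\<^sup>2"
    using y4 by (simp add: abs_le_iff)
qed

text \<open>Three kinds of terms: a polynomial with exact Gaussian moments, a constant multiple of a
  term that orthogonality integrates to 0, and an error that is estimated pointwise. The first two
  are too large for pointwise estimates, so they are kept in exact form until the
  integration.\<close>

lemma rate_density_remainder:
  assumes "1 < p" "0 \<le> K"
  shows "\<exists>C\<ge>0. \<exists>n. \<forall>k a b c N. (k = 0 \<or> k = 1) \<and> near_blowup K a b c \<and> 0 \<le> N \<longrightarrow>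
    (\<exists>g0 g1 g2. \<bar>g0 + g1 + 3 * g2 - k * (g0 + 3 * g1 + 15 * g2)\<bar> \<le> C * b ^ 3 \<and>
      (\<forall>y h. \<bar>h\<bar> \<le> N * (1 + y\<^sup>2)\<^sup>2 \<longrightarrow>
        \<bar>rate_density p k a b c (b_rate p b c) (c_rate p b c) h y
          - exp (- (a / 2) * y\<^sup>2) * ((1 - k * (a * y\<^sup>2)) * (g0 + g1 * (a * y\<^sup>2) + g2 * (a * y\<^sup>2)\<^sup>2))
          - (2 * c * p / (p - 1) - 2 * a / (p - 1) - 2 * a * k) * (exp (- (a / 2) * y\<^sup>2) * ((1 - k * a * y\<^sup>2) * h))\<bar>
        \<le> C * remainder_size p b N * (exp (- (1 / 8) * y\<^sup>2) * (1 + y\<^sup>2) ^ n)))"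
proof -
  define q where "q = p - 1"
  have q: "0 < q" using assms by (simp add: q_def)
  define VM where "VM = (5 / (4 * q)) powr (1 / q)"
  from profile_residual[OF assms] obtain C1 where C1: "0 \<le> C1"
    and C1': "\<And>k a b c. (k = 0 \<or> k = 1) \<and> near_blowup K a b c \<Longrightarrow>
    (\<exists>g0 g1 g2. \<bar>g0 + g1 + 3 * g2 - k * (g0 + 3 * g1 + 15 * g2)\<bar> \<le> C1 * b ^ 3 \<and>
      (\<forall>y. \<bar>(1 - k * a * y\<^sup>2) *
            (- (2 * a / (p - 1) + 2 * a * k) * amplitude p b c y + amplitude p b c y powr (p - 1) * amplitude p b c y
             + b_rate p b c * amplitude p b c y * y\<^sup>2 / ((p - 1) * (p - 1 + b * y\<^sup>2))
             - c_rate p b c * amplitude p b c y / ((p - 1) * c))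
          - (1 - k * (a * y\<^sup>2)) * (g0 + g1 * (a * y\<^sup>2) + g2 * (a * y\<^sup>2)\<^sup>2)\<bar> \<le> C1 * b ^ 3 * (1 + y\<^sup>2) ^ 4))"
    by blast
  obtain C2 where C2: "0 \<le> C2" "\<And>v h::real. 0 < v \<Longrightarrow> v \<le> VM \<Longrightarrow>
       \<bar>\<bar>v + h\<bar> powr (p - 1) * (v + h) - v powr (p - 1) * v - p * v powr (p - 1) * h\<bar> \<le> C2 * (h\<^sup>2 + \<bar>h\<bar> powr p)"
    using signed_power_taylor[OF assms(1), of VM] by metis
  define C3 where "C3 = 2 * p / (q * q)"
  define C4 where "C4 = 4 * (2 * K + 2 / (p - 1))"
  have Cp: "0 \<le> C3" "0 \<le> C4" using assms q by (auto simp: C3_def C4_def)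
  \<comment> \<open>|h|^p again grows like (1 + y^2)^(2 p); the margin of 5 used below also covers
    the fourth powers and the factor \<open>P\<close>.\<close>
  define m where "m = nat \<lceil>2 * p\<rceil>"
  define C where "C = C1 + C2 + C3 + C4"
  have C: "0 \<le> C" using C1 C2 Cp by (simp add: C_def)
  show ?thesis
  proof (rule exI[of _ C], intro conjI C, rule exI[of _ "m + 5"], intro allI impI, elim conjE)
    fix k a b c N :: real
    assume k: "k = 0 \<or> k = 1" and nb: "near_blowup K a b c" and N: "0 \<le> N"
    have n: "a = 2 * c - 1/2" "1/4 \<le> a" "a \<le> 3/4" "0 < b" "b \<le> 1" "\<bar>c - a\<bar> \<le> K * b"
      using nb by (auto simp: near_blowup_def)
    note cb = near_blowup_c[OF nb]
    from C1'[of k a b c] k nb obtain g0 g1 g2 where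
      \<beta>: "\<bar>g0 + g1 + 3 * g2 - k * (g0 + 3 * g1 + 15 * g2)\<bar> \<le> C1 * b ^ 3"
      and \<beta>': "\<And>y. \<bar>(1 - k * a * y\<^sup>2) *
            (- (2 * a / (p - 1) + 2 * a * k) * amplitude p b c y + amplitude p b c y powr (p - 1) * amplitude p b c y
             + b_rate p b c * amplitude p b c y * y\<^sup>2 / ((p - 1) * (p - 1 + b * y\<^sup>2))
             - c_rate p b c * amplitude p b c y / ((p - 1) * c))
          - (1 - k * (a * y\<^sup>2)) * (g0 + g1 * (a * y\<^sup>2) + g2 * (a * y\<^sup>2)\<^sup>2)\<bar> \<le> C1 * b ^ 3 * (1 + y\<^sup>2) ^ 4"
      by blast
    define \<rho> where "\<rho> = remainder_size p b N"
    have \<rho>: "b ^ 3 \<le> \<rho>" "b * N \<le> \<rho>" "N\<^sup>2 + N powr p \<le> \<rho>" "0 \<le> \<rho>"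
      using n N by (auto simp: \<rho>_def remainder_size_def)
    show "\<exists>g0 g1 g2. \<bar>g0 + g1 + 3 * g2 - k * (g0 + 3 * g1 + 15 * g2)\<bar> \<le> C * b ^ 3 \<and>
      (\<forall>y h. \<bar>h\<bar> \<le> N * (1 + y\<^sup>2)\<^sup>2 \<longrightarrow>
        \<bar>rate_density p k a b c (b_rate p b c) (c_rate p b c) h y
          - exp (- (a / 2) * y\<^sup>2) * ((1 - k * (a * y\<^sup>2)) * (g0 + g1 * (a * y\<^sup>2) + g2 * (a * y\<^sup>2)\<^sup>2))
          - (2 * c * p / (p - 1) - 2 * a / (p - 1) - 2 * a * k) * (exp (- (a / 2) * y\<^sup>2) * ((1 - k * a * y\<^sup>2) * h))\<bar>
        \<le> C * remainder_size p b N * (exp (- (1 / 8) * y\<^sup>2) * (1 + y\<^sup>2) ^ (m + 5)))"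
    proof (rule exI[of _ g0], rule exI[of _ g1], rule exI[of _ g2], intro conjI allI impI)
      have "C1 * b ^ 3 \<le> C * b ^ 3" using n C2 Cp by (intro mult_right_mono) (auto simp: C_def)
      with \<beta> show "\<bar>g0 + g1 + 3 * g2 - k * (g0 + 3 * g1 + 15 * g2)\<bar> \<le> C * b ^ 3" by linarith
    next
      fix y h :: real assume h: "\<bar>h\<bar> \<le> N * (1 + y\<^sup>2)\<^sup>2"
      define S where "S = 1 + y\<^sup>2"
      have S: "1 \<le> S" "y\<^sup>2 \<le> S" by (auto simp: S_def)
      have pw: "S ^ i \<le> S ^ (m + 5)" if "i \<le> m + 5" for i
        using S that by (intro power_increasing) auto
      define V where "V = amplitude p b c y"
      define P where "P = 1 - k * a * y\<^sup>2"
      define T where "T = k * a * y ^ 4 - (1 + 2 * k) * y\<^sup>2"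
      define NL where "NL = \<bar>V + h\<bar> powr q * (V + h) - V powr q * V - p * V powr q * h"
      define X where "X = P * (- (2 * a / q + 2 * a * k) * V + V powr q * V
             + b_rate p b c * V * y\<^sup>2 / (q * (q + b * y\<^sup>2)) - c_rate p b c * V / (q * c))"
      define Q where "Q = (1 - k * (a * y\<^sup>2)) * (g0 + g1 * (a * y\<^sup>2) + g2 * (a * y\<^sup>2)\<^sup>2)"
      have V: "0 < V" "V \<le> VM"
      proof -
        show "0 < V" unfolding V_def using n cb by (intro amplitude_pos assms) auto
        have "V \<le> (2 * c / (p - 1)) powr (1 / (p - 1))"
          unfolding V_def using n cb by (intro amplitude_le assms) auto
        also have "\<dots> \<le> VM" unfolding VM_def q_def[symmetric] using cb q
          by (intro powr_mono2) (auto simp: divide_simps)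
        finally show "V \<le> VM" .
      qed
      have D: "0 < q + b * y\<^sup>2" "q \<le> q + b * y\<^sup>2" using q n by (auto intro: add_pos_nonneg)
      have Vq: "V powr q = 2 * c / (q + b * y\<^sup>2)"
        unfolding V_def q_def using n cb by (intro amplitude_power_forms assms) auto
      have Pb: "\<bar>P\<bar> \<le> S" "\<bar>T\<bar> \<le> 4 * S\<^sup>2"
        unfolding P_def T_def S_def using k n by (auto intro!: weight_polynomial_bounds)
      have hS: "\<bar>h\<bar> \<le> N * S\<^sup>2" using h by (simp add: S_def)
      \<comment> \<open>\<open>E3\<close> is the non-constant part of the linear term p V^q h,
        \<open>E4\<close> the effect of the moving Gaussian on h. Both are O(b N), the latter
        because \<open>c_rate\<close> is O(b).\<close>
      define E3 where "E3 = P * h * (2 * c * p * b * y\<^sup>2 / (q * (q + b * y\<^sup>2)))"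
      define E4 where "E4 = c_rate p b c * h * T"
      have split: "rate_density p k a b c (b_rate p b c) (c_rate p b c) h y
          - exp (- (a / 2) * y\<^sup>2) * Q
          - (2 * c * p / q - 2 * a / q - 2 * a * k) * (exp (- (a / 2) * y\<^sup>2) * (P * h))
        = exp (- (a / 2) * y\<^sup>2) * ((X - Q) + P * NL - E3 + E4)"
      proof -
        \<comment> \<open>Restricting k to 0 and 1 pays off here: the second term of the density
          becomes a constant multiple of the mode polynomial.\<close>
        have kk: "k * (1 - a * y\<^sup>2) = k * P" using k by (auto simp: P_def)
        have lin: "p * V powr q * h = 2 * c * p / q * h - h * (2 * c * p * b * y\<^sup>2 / (q * (q + b * y\<^sup>2)))"
          unfolding Vq using q D by (simp add: divide_simps) (simp add: algebra_simps)
        have rd: "rate_density p k a b c (b_rate p b c) (c_rate p b c) h y = exp (- (a / 2) * y\<^sup>2) *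
          (P * (- (2 * a / q) * (V + h) + \<bar>V + h\<bar> powr q * (V + h) + b_rate p b c * V * y\<^sup>2 / (q * (q + b * y\<^sup>2))
           - c_rate p b c * V / (q * c)) - 2 * a * (k * (1 - a * y\<^sup>2)) * (V + h) + E4)"
          unfolding rate_density_def V_def P_def q_def E4_def T_def by (simp add: mult.assoc)
        have nl: "\<bar>V + h\<bar> powr q * (V + h) = NL + V powr q * V
           + (2 * c * p / q * h - h * (2 * c * p * b * y\<^sup>2 / (q * (q + b * y\<^sup>2))))"
          unfolding lin[symmetric] NL_def by simp
        show ?thesis unfolding rd kk nl X_def E3_def by (simp add: algebra_simps add_divide_distrib)
      qed
      have x1: "\<bar>X - Q\<bar> \<le> C1 * \<rho> * S ^ (m + 5)"
      proof -
        have "\<bar>X - Q\<bar> \<le> C1 * b ^ 3 * S ^ 4"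
          using \<beta>'[of y] unfolding X_def Q_def P_def V_def q_def S_def .
        also have "\<dots> \<le> C1 * \<rho> * S ^ (m + 5)"
          using C1 \<rho> n S by (intro mult_mono pw) auto
        finally show ?thesis .
      qed
      have x2: "\<bar>P * NL\<bar> \<le> C2 * \<rho> * S ^ (m + 5)"
      proof -
        have "h\<^sup>2 \<le> (N * S\<^sup>2)\<^sup>2" using hS power_mono[of "\<bar>h\<bar>" "N * S\<^sup>2" 2] by simp
        also have "\<dots> = N\<^sup>2 * S ^ 4" by (simp add: power_mult_distrib flip: power_mult)
        also have "\<dots> \<le> N\<^sup>2 * S ^ (m + 4)" using S by (intro mult_left_mono power_increasing) auto
        finally have h2: "h\<^sup>2 \<le> N\<^sup>2 * S ^ (m + 4)" .
        have "\<bar>h\<bar> powr p \<le> (N * S\<^sup>2) powr p" using hS assms by (intro powr_mono2) auto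
        also have "\<dots> = N powr p * S powr (2 * p)"
          using N S by (simp add: powr_mult powr_powr flip: powr_numeral)
        also have "\<dots> \<le> N powr p * S powr (real (m + 4))"
          using S assms unfolding m_def by (intro mult_left_mono powr_mono) (auto, linarith)
        also have "S powr (real (m + 4)) = S ^ (m + 4)" using S by (simp add: powr_realpow del: of_nat_add)
        finally have hp: "\<bar>h\<bar> powr p \<le> N powr p * S ^ (m + 4)" .
        have "\<bar>NL\<bar> \<le> C2 * (h\<^sup>2 + \<bar>h\<bar> powr p)" unfolding NL_def q_def by (rule C2(2)[OF V])
        also have "\<dots> \<le> C2 * ((N\<^sup>2 + N powr p) * S ^ (m + 4))"
          using h2 hp C2(1) by (intro mult_left_mono) (auto simp: distrib_right)
        also have "\<dots> \<le> C2 * (\<rho> * S ^ (m + 4))"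
          using C2(1) \<rho> S by (intro mult_left_mono mult_right_mono) auto
        finally have "\<bar>P * NL\<bar> \<le> S * (C2 * (\<rho> * S ^ (m + 4)))"
          unfolding abs_mult using Pb S by (intro mult_mono) auto
        also have "\<dots> = C2 * \<rho> * S ^ (m + 5)" by (simp add: power_add eval_nat_numeral)
        finally show ?thesis .
      qed
      have x3: "\<bar>E3\<bar> \<le> C3 * \<rho> * S ^ (m + 5)"
      proof -
        have f: "\<bar>2 * c * p * b * y\<^sup>2 / (q * (q + b * y\<^sup>2))\<bar> \<le> (2 * 1 * p * b * S) / (q * q)"
        proof -
          have "2 * c * p * b * y\<^sup>2 \<le> 2 * 1 * p * b * S" 
            using cb assms n S by (intro mult_mono) auto
          moreover have "0 \<le> 2 * c * p * b * y\<^sup>2" using cb assms n by simp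
          ultimately show ?thesis unfolding abs_divide using q D S n assms by (intro frac_le) auto
        qed
        have "\<bar>E3\<bar> \<le> (S * (N * S\<^sup>2)) * ((2 * 1 * p * b * S) / (q * q))"
          unfolding E3_def abs_mult[of "P * h"] abs_mult[of P]
          by (intro mult_mono f Pb hS) (use S N in auto)
        also have "\<dots> = C3 * (b * N) * S ^ 4" by (simp add: C3_def eval_nat_numeral)
        also have "\<dots> \<le> C3 * \<rho> * S ^ (m + 5)"
          using Cp \<rho> n N S by (intro mult_mono pw) auto
        finally show ?thesis .
      qed
      have x4: "\<bar>E4\<bar> \<le> C4 * \<rho> * S ^ (m + 5)"
      proof -
        have "\<bar>E4\<bar> \<le> (((2 * K + 2 / (p - 1)) * b) * (N * S\<^sup>2)) * (4 * S\<^sup>2)"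
          unfolding E4_def abs_mult
          by (intro mult_mono c_rate_bound[OF assms(1) nb assms(2)] Pb hS) (use S N n assms in auto)
        also have "\<dots> = C4 * (b * N) * S ^ 4" by (simp add: C4_def eval_nat_numeral)
        also have "\<dots> \<le> C4 * \<rho> * S ^ (m + 5)"
          using Cp \<rho> n N S by (intro mult_mono pw) auto
        finally show ?thesis .
      qed
      have "\<bar>(X - Q) + P * NL - E3 + E4\<bar> \<le> C * \<rho> * S ^ (m + 5)"
        unfolding C_def distrib_right using x1 x2 x3 x4 by linarith
      note g = gauss_factor_le[OF n(2) this[unfolded S_def], folded split]
      show "\<bar>rate_density p k a b c (b_rate p b c) (c_rate p b c) h y
          - exp (- (a / 2) * y\<^sup>2) * ((1 - k * (a * y\<^sup>2)) * (g0 + g1 * (a * y\<^sup>2) + g2 * (a * y\<^sup>2)\<^sup>2))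
          - (2 * c * p / (p - 1) - 2 * a / (p - 1) - 2 * a * k) * (exp (- (a / 2) * y\<^sup>2) * ((1 - k * a * y\<^sup>2) * h))\<bar>
        \<le> C * remainder_size p b N * (exp (- (1 / 8) * y\<^sup>2) * (1 + y\<^sup>2) ^ (m + 5))"
        using g unfolding Q_def P_def q_def \<rho>_def .
    qed
  qed
qed

text \<open>\<open>N\<close> is any majorant of the weighted size rather than the norm itself, so
  \<xi> = 0 is admissible with N = 0; that instance gives the cubic bounds for the remainders at
  0.\<close>

definition small_state :: "real \<Rightarrow> real \<Rightarrow> real \<Rightarrow> real \<Rightarrow> (real \<Rightarrow> real) \<Rightarrow> real \<Rightarrow> bool" where
  "small_state K a b c \<xi> N \<longleftrightarrow> near_blowup K a b c \<and> 0 \<le> N \<and> \<xi> \<in> borel_measurable borel \<and>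
     (\<forall>y. \<bar>exp (a / 4 * y\<^sup>2) * \<xi> y\<bar> \<le> N * (1 + y\<^sup>2)\<^sup>2) \<and>
     (LINT y|lborel. \<xi> y * phi0 a y) = 0 \<and> (LINT y|lborel. \<xi> y * phi2 a y) = 0"

text \<open>Integrability is proved along with the value, because \<open>LINT\<close> is 0 by
  default on non-integrable functions and a vanishing \<open>LINT\<close> alone could not be
  combined with other integrals.\<close>

lemma small_state_gauged:
  assumes "small_state K a b c \<xi> N" "k = 0 \<or> k = 1"
  shows "has_bochner_integral lborel (\<lambda>y. exp (- (a / 2) * y\<^sup>2) * ((1 - k * a * y\<^sup>2) * (exp (a / 4 * y\<^sup>2) * \<xi> y))) 0"
proof -
  from assms(1) have m [measurable]: "\<xi> \<in> borel_measurable borel"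
    and a: "1/4 \<le> a" "a \<le> 3/4" and N: "0 \<le> N" and h: "\<And>y. \<bar>exp (a / 4 * y\<^sup>2) * \<xi> y\<bar> \<le> N * (1 + y\<^sup>2)\<^sup>2"
    by (auto simp: small_state_def near_blowup_def)
  have "integrable lborel (\<lambda>y. exp (- (a / 2) * y\<^sup>2) * ((1 - k * a * y\<^sup>2) * (exp (a / 4 * y\<^sup>2) * \<xi> y)))"
  proof (rule integrable_gauss_bounded(1)[where d="1/8"])
    fix y
    have "\<bar>(1 - k * a * y\<^sup>2) * (exp (a / 4 * y\<^sup>2) * \<xi> y)\<bar> \<le> (1 + y\<^sup>2) * (N * (1 + y\<^sup>2)\<^sup>2)"
      unfolding abs_mult[of "1 - k * a * y\<^sup>2"]
      by (intro mult_mono weight_polynomial_bounds h) (use a assms(2) in auto)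
    also have "\<dots> = N * (1 + y\<^sup>2) ^ 3" by (simp add: eval_nat_numeral)
    finally show "\<bar>exp (- (a / 2) * y\<^sup>2) * ((1 - k * a * y\<^sup>2) * (exp (a / 4 * y\<^sup>2) * \<xi> y))\<bar>
        \<le> N * (exp (- (1 / 8) * y\<^sup>2) * (1 + y\<^sup>2) ^ 3)"
      by (rule gauss_factor_le[OF a(1)])
  qed auto
  moreover have "(LINT y|lborel. \<xi> y * mode k a y) = 0"
    using assms by (auto simp: small_state_def phi0_eq_mode phi2_eq_mode)
  moreover have "(\<lambda>y. exp (- (a / 2) * y\<^sup>2) * ((1 - k * a * y\<^sup>2) * (exp (a / 4 * y\<^sup>2) * \<xi> y))) = (\<lambda>y. \<xi> y * mode k a y)"
    by (intro ext gauss_mode_integral)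
  ultimately show ?thesis by (simp only: has_bochner_integral_iff)
qed

text \<open>After integration the polynomial contributes its cubic average times the Gaussian mass,
  the term linear in h with constant coefficient contributes 0, and the rest is at most the
  remainder size.\<close>

lemma rate_at_prediction:
  assumes "1 < p" "0 \<le> K"
  shows "\<exists>C\<ge>0. \<forall>k a b c \<xi> N. (k = 0 \<or> k = 1) \<and> small_state K a b c \<xi> N \<longrightarrow>
    integrable lborel (\<lambda>y. rate_density p k a b c (b_rate p b c) (c_rate p b c) (exp (a / 4 * y\<^sup>2) * \<xi> y) y) \<and>
    \<bar>LINT y|lborel. rate_density p k a b c (b_rate p b c) (c_rate p b c) (exp (a / 4 * y\<^sup>2) * \<xi> y) y\<bar>
      \<le> C * remainder_size p b N"
proof -
  from rate_density_remainder[OF assms] obtain C n where C: "0 \<le> C"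
    and H: "\<And>k a b c N. (k = 0 \<or> k = 1) \<and> near_blowup K a b c \<and> 0 \<le> N \<Longrightarrow>
    (\<exists>g0 g1 g2. \<bar>g0 + g1 + 3 * g2 - k * (g0 + 3 * g1 + 15 * g2)\<bar> \<le> C * b ^ 3 \<and>
      (\<forall>y h. \<bar>h\<bar> \<le> N * (1 + y\<^sup>2)\<^sup>2 \<longrightarrow>
        \<bar>rate_density p k a b c (b_rate p b c) (c_rate p b c) h y
          - exp (- (a / 2) * y\<^sup>2) * ((1 - k * (a * y\<^sup>2)) * (g0 + g1 * (a * y\<^sup>2) + g2 * (a * y\<^sup>2)\<^sup>2))
          - (2 * c * p / (p - 1) - 2 * a / (p - 1) - 2 * a * k) * (exp (- (a / 2) * y\<^sup>2) * ((1 - k * a * y\<^sup>2) * h))\<bar>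
        \<le> C * remainder_size p b N * (exp (- (1 / 8) * y\<^sup>2) * (1 + y\<^sup>2) ^ n)))"
    by blast
  \<comment> \<open>a \<ge> 1/4 bounds the Gaussian mass sqrt (2 pi / a) by sqrt (8 pi).\<close>
  define D where "D = sqrt (8 * pi) * C + C * gauss_mass (1 / 8) n"
  have D: "0 \<le> D" using C gauss_mass_nonneg by (simp add: D_def)
  show ?thesis
  proof (rule exI[of _ D], rule conjI[OF D], intro allI impI, goal_cases)
    case (1 k a b c \<xi> N)
    then have k: "k = 0 \<or> k = 1" and st: "small_state K a b c \<xi> N" by auto
    from st have nb: "near_blowup K a b c" and m [measurable]: "\<xi> \<in> borel_measurable borel"
      and a: "1/4 \<le> a" "a \<le> 3/4" and b: "0 < b" and N: "0 \<le> N" and h: "\<And>y. \<bar>exp (a / 4 * y\<^sup>2) * \<xi> y\<bar> \<le> N * (1 + y\<^sup>2)\<^sup>2"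
      by (auto simp: small_state_def near_blowup_def)
    from H[of k a b c N] k nb N obtain g0 g1 g2 where
      \<beta>: "\<bar>g0 + g1 + 3 * g2 - k * (g0 + 3 * g1 + 15 * g2)\<bar> \<le> C * b ^ 3" and
      E: "\<And>y h. \<bar>h\<bar> \<le> N * (1 + y\<^sup>2)\<^sup>2 \<Longrightarrow>
        \<bar>rate_density p k a b c (b_rate p b c) (c_rate p b c) h y
          - exp (- (a / 2) * y\<^sup>2) * ((1 - k * (a * y\<^sup>2)) * (g0 + g1 * (a * y\<^sup>2) + g2 * (a * y\<^sup>2)\<^sup>2))
          - (2 * c * p / (p - 1) - 2 * a / (p - 1) - 2 * a * k) * (exp (- (a / 2) * y\<^sup>2) * ((1 - k * a * y\<^sup>2) * h))\<bar>
        \<le> C * remainder_size p b N * (exp (- (1 / 8) * y\<^sup>2) * (1 + y\<^sup>2) ^ n)"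
      by blast
    define J where "J y = rate_density p k a b c (b_rate p b c) (c_rate p b c) (exp (a / 4 * y\<^sup>2) * \<xi> y) y" for y
    define M1 where "M1 y = exp (- (a / 2) * y\<^sup>2) * ((1 - k * (a * y\<^sup>2)) * (g0 + g1 * (a * y\<^sup>2) + g2 * (a * y\<^sup>2)\<^sup>2))" for y
    define M2 where "M2 y = exp (- (a / 2) * y\<^sup>2) * ((1 - k * a * y\<^sup>2) * (exp (a / 4 * y\<^sup>2) * \<xi> y))" for y
    define s where "s = 2 * c * p / (p - 1) - 2 * a / (p - 1) - 2 * a * k"
    define I1 where "I1 = sqrt (2 * pi / a) * (g0 + g1 + 3 * g2 - k * (g0 + 3 * g1 + 15 * g2))"
    have J_m [measurable]: "J \<in> borel_measurable borel" unfolding J_def by measurable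
    have M_m [measurable]: "M1 \<in> borel_measurable borel" "M2 \<in> borel_measurable borel"
      unfolding M1_def M2_def by measurable
    have i1: "has_bochner_integral lborel M1 I1"
      unfolding M1_def I1_def using a by (intro gaussian_moment_quartic) auto
    have i2: "has_bochner_integral lborel M2 0" unfolding M2_def by (rule small_state_gauged[OF st k])
    have Eb: "\<bar>J y - M1 y - s * M2 y\<bar> \<le> (C * remainder_size p b N) * (exp (- (1 / 8) * y\<^sup>2) * (1 + y\<^sup>2) ^ n)" for y
      unfolding J_def M1_def M2_def s_def by (rule E[OF h])
    have e: "integrable lborel (\<lambda>y. J y - M1 y - s * M2 y)"
      "\<bar>LINT y|lborel. J y - M1 y - s * M2 y\<bar> \<le> (C * remainder_size p b N) * gauss_mass (1 / 8) n"
      by (rule integrable_gauss_bounded[OF _ _ Eb]; simp)+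
    have "has_bochner_integral lborel (\<lambda>y. (J y - M1 y - s * M2 y) + M1 y + s * M2 y)
        ((LINT y|lborel. J y - M1 y - s * M2 y) + I1 + s * 0)"
      by (intro has_bochner_integral_add has_bochner_integral_mult_right i1 i2 has_bochner_integral_integrable e)
    then have hb: "has_bochner_integral lborel J ((LINT y|lborel. J y - M1 y - s * M2 y) + I1)" by simp
    have "\<bar>I1\<bar> \<le> sqrt (8 * pi) * (C * b ^ 3)"
    proof -
      have "2 * pi / a \<le> 8 * pi" using a by (simp add: field_simps)
      then have "sqrt (2 * pi / a) \<le> sqrt (8 * pi)" by (rule real_sqrt_le_mono)
      then show ?thesis unfolding I1_def abs_mult using \<beta> a C b by (intro mult_mono) auto
    qed
    also have "\<dots> \<le> sqrt (8 * pi) * (C * remainder_size p b N)"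
      using C b N by (intro mult_left_mono) (auto simp: remainder_size_def)
    finally have "\<bar>(LINT y|lborel. J y - M1 y - s * M2 y) + I1\<bar> \<le> D * remainder_size p b N"
      using e(2) by (simp add: D_def algebra_simps)
    with hb show ?case unfolding J_def[symmetric] by (auto simp: has_bochner_integral_iff)
  qed
qed

section \<open>Dependence of the rate on the velocities\<close>

definition b_weight :: "real \<Rightarrow> real \<Rightarrow> real \<Rightarrow> real \<Rightarrow> real \<Rightarrow> real \<Rightarrow> real" where
  "b_weight p k a b c y = exp (- (a / 2) * y\<^sup>2) *
     ((1 - k * a * y\<^sup>2) * (amplitude p b c y * y\<^sup>2 / ((p - 1) * (p - 1 + b * y\<^sup>2))))"

text \<open>h enters because a_tau = 2 c_tau also moves the Gaussian; the matrix of the system is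
  therefore controlled by b and N together.\<close>

definition c_weight :: "real \<Rightarrow> real \<Rightarrow> real \<Rightarrow> real \<Rightarrow> real \<Rightarrow> real \<Rightarrow> real \<Rightarrow> real" where
  "c_weight p k a b c h y = exp (- (a / 2) * y\<^sup>2) *
     (h * (k * a * y ^ 4 - (1 + 2 * k) * y\<^sup>2) - (1 - k * a * y\<^sup>2) * (amplitude p b c y / ((p - 1) * c)))"

text \<open>Expanding around a base point makes the deviations from the predicted velocities the
  unknowns of the linear system, with the rate at the prediction as its inhomogeneity.\<close>

lemma rate_density_affine:
  "rate_density p k a b c b1 c1 h y = rate_density p k a b c b0 c0 h y
     + (b1 - b0) * b_weight p k a b c y + (c1 - c0) * c_weight p k a b c h y"
proof -
  define X where "X = amplitude p b c y * y\<^sup>2 / ((p - 1) * (p - 1 + b * y\<^sup>2))"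
  define Y where "Y = amplitude p b c y / ((p - 1) * c)"
  define W where "W = - (2 * a / (p - 1)) * (amplitude p b c y + h) + \<bar>amplitude p b c y + h\<bar> powr (p - 1) * (amplitude p b c y + h)"
  define F where "F = 2 * a * k * (1 - a * y\<^sup>2) * (amplitude p b c y + h)"
  have rd: "rate_density p k a b c b1 c1 h y = exp (- (a / 2) * y\<^sup>2) *
     ((1 - k * a * y\<^sup>2) * (W + b1 * X - c1 * Y) - F + c1 * h * (k * a * y ^ 4 - (1 + 2 * k) * y\<^sup>2))" for b1 c1
    unfolding rate_density_def X_def Y_def W_def F_def by simp
  show ?thesis unfolding rd b_weight_def c_weight_def X_def[symmetric] Y_def[symmetric] by algebra
qed

text \<open>As b and N tend to 0 the amplitude becomes the constant V0 and only Gaussian moments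
  remain: 1 - 3 k and 1 - k are the averages of 1 - k a y^2 against a y^2 and against 1.\<close>

lemma rate_weights:
  assumes "1 < p" "0 \<le> K"
  shows "\<exists>C\<ge>0. \<forall>k a b c \<xi> N. (k = 0 \<or> k = 1) \<and> small_state K a b c \<xi> N \<longrightarrow>
    integrable lborel (b_weight p k a b c) \<and>
    integrable lborel (\<lambda>y. c_weight p k a b c (exp (a / 4 * y\<^sup>2) * \<xi> y) y) \<and>
    \<bar>(LINT y|lborel. b_weight p k a b c y)
       - (1 - 3 * k) * (sqrt (2 * pi / a) * (2 * c / (p - 1)) powr (1 / (p - 1)) / ((p - 1)\<^sup>2 * a))\<bar> \<le> C * b \<and>
    \<bar>(LINT y|lborel. c_weight p k a b c (exp (a / 4 * y\<^sup>2) * \<xi> y) y)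
       + (1 - k) * (sqrt (2 * pi / a) * (2 * c / (p - 1)) powr (1 / (p - 1)) / ((p - 1) * c))\<bar> \<le> C * (b + N)"
proof -
  define q where "q = p - 1"
  define r where "r = 1 / q"
  have q: "0 < q" "0 < r" using assms by (auto simp: q_def r_def)
  define VM where "VM = (5 / (4 * q)) powr (1 / q)"
  have VM: "0 \<le> VM" by (simp add: VM_def)
  define Cb where "Cb = VM * r * r * ((r + 1) / q)"
  \<comment> \<open>8/3 bounds 1 / c, and the summand 4 comes from the polynomial that multiplies
    h.\<close>
  define Cc where "Cc = VM * r * (8 / 3) * (r / q) + 4"
  define C where "C = (Cb + Cc) * gauss_mass (1 / 8) 4"
  have Cp: "0 \<le> Cb" "0 \<le> Cc" using VM q by (auto simp: Cb_def Cc_def intro!: add_nonneg_nonneg mult_nonneg_nonneg divide_nonneg_nonneg)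
  have C: "0 \<le> C" using Cp gauss_mass_nonneg by (simp add: C_def)
  show ?thesis
  proof (rule exI[of _ C], rule conjI[OF C], intro allI impI, goal_cases)
    case (1 k a b c \<xi> N)
    then have k: "k = 0 \<or> k = 1" and st: "small_state K a b c \<xi> N" by auto
    then have k01: "0 \<le> k" "k \<le> 1" by auto
    from st have nb: "near_blowup K a b c" and m [measurable]: "\<xi> \<in> borel_measurable borel"
      and a: "1/4 \<le> a" "a \<le> 3/4" and b: "0 < b" and N: "0 \<le> N" and h: "\<And>y. \<bar>exp (a / 4 * y\<^sup>2) * \<xi> y\<bar> \<le> N * (1 + y\<^sup>2)\<^sup>2"
      by (auto simp: small_state_def near_blowup_def)
    have a01: "0 \<le> a" "a \<le> 1" "0 < a" using a by auto
    note cb = near_blowup_c[OF nb]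
    define V0 where "V0 = (2 * c / q) powr (1 / q)"
    have V0: "0 < V0" "V0 \<le> VM" using cb q unfolding V0_def VM_def
      by (auto intro!: powr_mono2 simp: divide_simps)
    define Z where "Z = sqrt (2 * pi / a)"
    define u where "u y = (1 + b * y\<^sup>2 / q) powr (- r)" for y
    define u' where "u' y = (1 + b * y\<^sup>2 / q) powr (- (r + 1))" for y
    have cpos: "0 < c" using cb by simp
    note forms = amplitude_power_forms[OF assms(1) less_imp_le[OF b] cpos, folded q_def, folded V0_def r_def]
    have amp: "amplitude p b c y = V0 * u y" "amplitude p b c y / (q + b * y\<^sup>2) = V0 * r * u' y" for y
      using forms[of y] by (auto simp: u_def u'_def r_def)
    have t: "0 \<le> b * y\<^sup>2 / q" "b * y\<^sup>2 / q \<le> b * (1 + y\<^sup>2) / q" for y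
      using b q by (auto intro!: divide_right_mono mult_left_mono)
    have u1: "\<bar>u y - 1\<bar> \<le> r / q * b * (1 + y\<^sup>2)" for y
      using order_trans[OF powr_minus_taylor1[OF q(2) t(1)] mult_left_mono[OF t(2)[of y], of r]] q
      by (simp add: u_def mult.assoc)
    have u'1: "\<bar>u' y - 1\<bar> \<le> (r + 1) / q * b * (1 + y\<^sup>2)" for y
      using order_trans[OF powr_minus_taylor1[OF _ t(1)[of y], of "r + 1"] mult_left_mono[OF t(2)[of y], of "r + 1"]] q
      by (simp add: u'_def mult.assoc)
    define P where "P y = 1 - k * a * y\<^sup>2" for y
    have P: "\<bar>P y\<bar> \<le> 1 + y\<^sup>2" for y
      unfolding P_def using k01 a01 by (intro weight_polynomial_bounds) auto
    \<comment> \<open>The limits are written in quartic form with zero coefficients, so that one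
      moment formula evaluates both.\<close>
    define Q where "Q y = exp (- (a / 2) * y\<^sup>2) * ((1 - k * (a * y\<^sup>2)) * (0 + (V0 * r * r / a) * (a * y\<^sup>2) + 0 * (a * y\<^sup>2)\<^sup>2))" for y
    define Q' where "Q' y = exp (- (a / 2) * y\<^sup>2) * ((1 - k * (a * y\<^sup>2)) * ((V0 * r / c) + 0 * (a * y\<^sup>2) + 0 * (a * y\<^sup>2)\<^sup>2))" for y
    have Qi: "has_bochner_integral lborel Q (Z * (0 + (V0 * r * r / a) + 3 * 0 - k * (0 + 3 * (V0 * r * r / a) + 15 * 0)))"
      "has_bochner_integral lborel Q' (Z * ((V0 * r / c) + 0 + 3 * 0 - k * ((V0 * r / c) + 3 * 0 + 15 * 0)))"
      unfolding Q_def Q'_def Z_def by (intro gaussian_moment_quartic a01)+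
    have Qm [measurable]: "Q \<in> borel_measurable borel" "Q' \<in> borel_measurable borel"
      unfolding Q_def Q'_def by measurable
    have wm [measurable]: "b_weight p k a b c \<in> borel_measurable borel"
      "(\<lambda>y. c_weight p k a b c (exp (a / 4 * y\<^sup>2) * \<xi> y) y) \<in> borel_measurable borel"
      unfolding b_weight_def c_weight_def amplitude_def by measurable
    have be: "\<bar>b_weight p k a b c y - Q y\<bar> \<le> (Cb * b) * (exp (- (1 / 8) * y\<^sup>2) * (1 + y\<^sup>2) ^ 4)" for y
    proof -
      have "b_weight p k a b c y - Q y = exp (- (a / 2) * y\<^sup>2) * (P y * ((V0 * r * r) * (y\<^sup>2 * (u' y - 1))))"
      proof -
        have "amplitude p b c y * y\<^sup>2 / (q * (q + b * y\<^sup>2)) = r * y\<^sup>2 * (amplitude p b c y / (q + b * y\<^sup>2))"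
          by (simp add: r_def)
        then show ?thesis unfolding b_weight_def Q_def q_def[symmetric] P_def amp(2)
          using a01(3) by (simp add: algebra_simps)
      qed
      moreover have "\<bar>P y * ((V0 * r * r) * (y\<^sup>2 * (u' y - 1)))\<bar> \<le> (Cb * b) * (1 + y\<^sup>2) ^ 4"
      proof -
        have "\<bar>P y * ((V0 * r * r) * (y\<^sup>2 * (u' y - 1)))\<bar>
          \<le> (1 + y\<^sup>2) * ((VM * r * r) * ((1 + y\<^sup>2) * ((r + 1) / q * b * (1 + y\<^sup>2))))"
          unfolding abs_mult[of "P y"] abs_mult[of "V0 * r * r"] abs_mult[of "y\<^sup>2"]
          using P[of y] V0 q u'1[of y] VM b by (intro mult_mono) auto
        also have "\<dots> = (Cb * b) * (1 + y\<^sup>2) ^ 3" by (simp add: Cb_def eval_nat_numeral)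
        also have "\<dots> \<le> (Cb * b) * (1 + y\<^sup>2) ^ 4"
          using Cp b by (intro mult_left_mono power_increasing) auto
        finally show ?thesis .
      qed
      ultimately show ?thesis using gauss_factor_le[OF a(1)] by simp
    qed
    have ce: "\<bar>c_weight p k a b c (exp (a / 4 * y\<^sup>2) * \<xi> y) y + Q' y\<bar> \<le> (Cc * (b + N)) * (exp (- (1 / 8) * y\<^sup>2) * (1 + y\<^sup>2) ^ 4)" for y
    proof -
      define T where "T = k * a * y ^ 4 - (1 + 2 * k) * y\<^sup>2"
      define g where "g = exp (a / 4 * y\<^sup>2) * \<xi> y"
      have T: "\<bar>T\<bar> \<le> 4 * (1 + y\<^sup>2)\<^sup>2"
        unfolding T_def using k01 a01 by (intro weight_polynomial_bounds) auto
      have "c_weight p k a b c g y + Q' y = exp (- (a / 2) * y\<^sup>2) * (g * T - P y * ((V0 * r / c) * (u y - 1)))"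
        unfolding c_weight_def Q'_def T_def[symmetric] q_def[symmetric] P_def amp(1)
        by (simp add: algebra_simps add_divide_distrib diff_divide_distrib r_def)
      moreover have "\<bar>g * T - P y * ((V0 * r / c) * (u y - 1))\<bar> \<le> (Cc * (b + N)) * (1 + y\<^sup>2) ^ 4"
      proof -
        have "\<bar>g * T\<bar> \<le> (N * (1 + y\<^sup>2)\<^sup>2) * (4 * (1 + y\<^sup>2)\<^sup>2)"
          unfolding abs_mult[of g T] using h[of y] T N by (intro mult_mono) (auto simp: g_def)
        also have "\<dots> = 4 * N * (1 + y\<^sup>2) ^ 4" by (simp add: power2_eq_square power4_eq_xxxx)
        finally have 1: "\<bar>g * T\<bar> \<le> 4 * N * (1 + y\<^sup>2) ^ 4" .
        have rc: "V0 * r / c \<le> VM * r * (8 / 3)"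
        proof -
          have "1 / c \<le> 8 / 3" using cb by (simp add: field_simps)
          then have "(V0 * r) * (1 / c) \<le> (VM * r) * (8 / 3)" using V0 q VM cpos by (intro mult_mono) auto
          then show ?thesis by simp
        qed
        have "\<bar>P y * ((V0 * r / c) * (u y - 1))\<bar> \<le> (1 + y\<^sup>2) * ((VM * r * (8 / 3)) * (r / q * b * (1 + y\<^sup>2)))"
          unfolding abs_mult[of "P y"] abs_mult[of "V0 * r / c"]
          using P[of y] V0 q u1[of y] VM b rc cpos by (intro mult_mono) auto
        also have "\<dots> = (VM * r * (8 / 3) * (r / q)) * b * (1 + y\<^sup>2) ^ 2" by (simp add: power2_eq_square)
        also have "\<dots> \<le> (VM * r * (8 / 3) * (r / q)) * b * (1 + y\<^sup>2) ^ 4"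
          using VM q b by (intro mult_left_mono power_increasing) auto
        finally have 2: "\<bar>P y * ((V0 * r / c) * (u y - 1))\<bar> \<le> (VM * r * (8 / 3) * (r / q)) * b * (1 + y\<^sup>2) ^ 4" .
        have "4 * N + (VM * r * (8 / 3) * (r / q)) * b \<le> Cc * (b + N)"
        proof -
          have "0 \<le> (VM * r * (8 / 3) * (r / q)) * N" using VM q N by simp
          then show ?thesis unfolding Cc_def using b by (simp add: distrib_right distrib_left)
        qed
        from mult_right_mono[OF this, of "(1 + y\<^sup>2) ^ 4"]
        have "4 * N * (1 + y\<^sup>2) ^ 4 + (VM * r * (8 / 3) * (r / q)) * b * (1 + y\<^sup>2) ^ 4 \<le> Cc * (b + N) * (1 + y\<^sup>2) ^ 4"
          unfolding distrib_right[of "4 * N"] by simp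
        then show ?thesis
          by (rule order_trans[OF order_trans[OF abs_triangle_ineq4 add_mono[OF 1 2]]])
      qed
      ultimately show ?thesis using gauss_factor_le[OF a(1)] unfolding g_def by simp
    qed
    have bi: "integrable lborel (\<lambda>y. b_weight p k a b c y - Q y)"
      "\<bar>LINT y|lborel. b_weight p k a b c y - Q y\<bar> \<le> Cb * b * gauss_mass (1 / 8) 4"
      by (rule integrable_gauss_bounded[OF _ _ be]; simp)+
    have ci: "integrable lborel (\<lambda>y. c_weight p k a b c (exp (a / 4 * y\<^sup>2) * \<xi> y) y + Q' y)"
      "\<bar>LINT y|lborel. c_weight p k a b c (exp (a / 4 * y\<^sup>2) * \<xi> y) y + Q' y\<bar> \<le> Cc * (b + N) * gauss_mass (1 / 8) 4"
      by (rule integrable_gauss_bounded[OF _ _ ce];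
          simp only: measurable_lborel2 borel_measurable_add[OF wm(2) Qm(2)]; simp)+
    have "has_bochner_integral lborel (\<lambda>y. (b_weight p k a b c y - Q y) + Q y)
       ((LINT y|lborel. b_weight p k a b c y - Q y) + Z * (0 + (V0 * r * r / a) + 3 * 0 - k * (0 + 3 * (V0 * r * r / a) + 15 * 0)))"
      by (intro has_bochner_integral_add Qi has_bochner_integral_integrable bi)
    then have hb: "has_bochner_integral lborel (b_weight p k a b c)
       ((LINT y|lborel. b_weight p k a b c y - Q y) + (1 - 3 * k) * (Z * V0 / (q\<^sup>2 * a)))"
      by (simp add: r_def algebra_simps power2_eq_square diff_divide_distrib)
    have "has_bochner_integral lborel (\<lambda>y. (c_weight p k a b c (exp (a / 4 * y\<^sup>2) * \<xi> y) y + Q' y) - Q' y)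
       ((LINT y|lborel. c_weight p k a b c (exp (a / 4 * y\<^sup>2) * \<xi> y) y + Q' y) - Z * ((V0 * r / c) + 0 + 3 * 0 - k * ((V0 * r / c) + 3 * 0 + 15 * 0)))"
      by (intro has_bochner_integral_diff Qi has_bochner_integral_integrable ci)
    then have hc: "has_bochner_integral lborel (\<lambda>y. c_weight p k a b c (exp (a / 4 * y\<^sup>2) * \<xi> y) y)
       ((LINT y|lborel. c_weight p k a b c (exp (a / 4 * y\<^sup>2) * \<xi> y) y + Q' y) - (1 - k) * (Z * V0 / (q * c)))"
      by (simp add: r_def algebra_simps diff_divide_distrib)
    have le: "Cb * b * gauss_mass (1 / 8) 4 \<le> C * b" "Cc * (b + N) * gauss_mass (1 / 8) 4 \<le> C * (b + N)"
    proof -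
      have g: "0 \<le> gauss_mass (1 / 8) 4" by (rule gauss_mass_nonneg)
      have "Cb * (b * gauss_mass (1 / 8) 4) \<le> (Cb + Cc) * (b * gauss_mass (1 / 8) 4)"
        using Cp b g by (intro mult_right_mono) auto
      then show "Cb * b * gauss_mass (1 / 8) 4 \<le> C * b" by (simp add: C_def mult_ac)
      have "Cc * ((b + N) * gauss_mass (1 / 8) 4) \<le> (Cb + Cc) * ((b + N) * gauss_mass (1 / 8) 4)"
        using Cp b N g by (intro mult_right_mono) auto
      then show "Cc * (b + N) * gauss_mass (1 / 8) 4 \<le> C * (b + N)" by (simp add: C_def mult_ac)
    qed
    show ?case
      using hb hc bi(2) ci(2) le unfolding has_bochner_integral_iff Z_def V0_def q_def by auto
  qed
qed

text \<open>The limit matrix has rows (\<mu>, -\<nu>) and (-2 \<mu>, 0); the zero entry reflects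
  that 1 - a y^2 has Gaussian mean 0. Its determinant is -2 \<mu> \<nu>, and \<eta> measures the
  perturbation of the entries.\<close>

lemma perturbed_determinant:
  fixes m0 m1 n0 n1 \<mu> \<nu> \<eta> L :: real
  assumes "\<bar>m0 - \<mu>\<bar> \<le> \<eta>" "\<bar>m1 + 2 * \<mu>\<bar> \<le> \<eta>" "\<bar>n0 + \<nu>\<bar> \<le> \<eta>" "\<bar>n1\<bar> \<le> \<eta>"
    and "0 \<le> \<mu>" "\<mu> \<le> L" "0 \<le> \<nu>" "\<nu> \<le> L" "\<eta> \<le> 1"
  shows "2 * \<mu> * \<nu> - \<eta> * (4 * L + 2) \<le> \<bar>m0 * n1 - m1 * n0\<bar>"
proof -
  have b: "\<bar>m0\<bar> \<le> L + 1" "\<bar>n0\<bar> \<le> L + 1" using assms by linarith+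
  have \<eta>: "0 \<le> \<eta>" "0 \<le> L" using assms by linarith+
  have "\<bar>m0 * n1\<bar> \<le> (L + 1) * \<eta>" "\<bar>(m1 + 2 * \<mu>) * n0\<bar> \<le> \<eta> * (L + 1)"
    "\<bar>2 * \<mu> * (n0 + \<nu>)\<bar> \<le> 2 * L * \<eta>"
    unfolding abs_mult using assms b \<eta> by (auto intro!: mult_mono)
  moreover have "m0 * n1 - m1 * n0 = m0 * n1 - (m1 + 2 * \<mu>) * n0 + 2 * \<mu> * (n0 + \<nu>) - 2 * \<mu> * \<nu>"
    by (simp add: algebra_simps)
  moreover have "\<eta> * (4 * L + 2) = (L + 1) * \<eta> + \<eta> * (L + 1) + 2 * L * \<eta>"
    by (simp add: algebra_simps)
  ultimately show ?thesis by linarith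
qed

text \<open>The condition N \<le> b reduces the smallness of the matrix perturbation to that of b.
  The solution is described by an equivalence because uniqueness, not mere solvability, determines
  \<open>velocity\<close>.\<close>

lemma velocity_near_prediction:
  assumes "1 < p" "0 \<le> K"
  shows "\<exists>\<epsilon>>0. \<exists>C\<ge>0. \<forall>a b c \<xi> N. small_state K a b c \<xi> N \<and> b < \<epsilon> \<and> N \<le> b \<longrightarrow>
    (\<exists>v1 v2. (\<forall>b1 c1. orthogonality_rate p phi0 \<xi> b c b1 c1 = 0 \<and> orthogonality_rate p phi2 \<xi> b c b1 c1 = 0
          \<longleftrightarrow> b1 = v1 \<and> c1 = v2) \<and>
      \<bar>v1 - b_rate p b c\<bar> \<le> C * remainder_size p b N \<and> \<bar>v2 - c_rate p b c\<bar> \<le> C * remainder_size p b N)"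
proof -
  from rate_at_prediction[OF assms] obtain C0 where C0: "0 \<le> C0" and
    E: "\<And>k a b c \<xi> N. (k = 0 \<or> k = 1) \<and> small_state K a b c \<xi> N \<Longrightarrow>
    integrable lborel (\<lambda>y. rate_density p k a b c (b_rate p b c) (c_rate p b c) (exp (a / 4 * y\<^sup>2) * \<xi> y) y) \<and>
    \<bar>LINT y|lborel. rate_density p k a b c (b_rate p b c) (c_rate p b c) (exp (a / 4 * y\<^sup>2) * \<xi> y) y\<bar>
      \<le> C0 * remainder_size p b N" by blast
  from rate_weights[OF assms] obtain C1 where C1: "0 \<le> C1" and
    W: "\<And>k a b c \<xi> N. (k = 0 \<or> k = 1) \<and> small_state K a b c \<xi> N \<Longrightarrow>
    integrable lborel (b_weight p k a b c) \<and>
    integrable lborel (\<lambda>y. c_weight p k a b c (exp (a / 4 * y\<^sup>2) * \<xi> y) y) \<and>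
    \<bar>(LINT y|lborel. b_weight p k a b c y)
       - (1 - 3 * k) * (sqrt (2 * pi / a) * (2 * c / (p - 1)) powr (1 / (p - 1)) / ((p - 1)\<^sup>2 * a))\<bar> \<le> C1 * b \<and>
    \<bar>(LINT y|lborel. c_weight p k a b c (exp (a / 4 * y\<^sup>2) * \<xi> y) y)
       + (1 - k) * (sqrt (2 * pi / a) * (2 * c / (p - 1)) powr (1 / (p - 1)) / ((p - 1) * c))\<bar> \<le> C1 * (b + N)"
    by blast
  define q where "q = p - 1"
  have q: "0 < q" using assms by (simp add: q_def)
  \<comment> \<open>3 / (4 q) is the value of 2 c / q at c = 3/8, the smallest c allowed by
    \<open>near_blowup\<close>.\<close>
  define Vm where "Vm = (3 / (4 * q)) powr (1 / q)"
  define VM where "VM = (5 / (4 * q)) powr (1 / q)"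
  have Vm: "0 < Vm" "0 \<le> VM" using q by (auto simp: Vm_def VM_def)
  define L where "L = sqrt (8 * pi) * VM * (4 / q\<^sup>2) + sqrt (8 * pi) * VM * (8 / 3 / q)"
  have L: "0 \<le> L" using Vm q by (simp add: L_def)
  \<comment> \<open>A lower bound for \<mu> \<nu>. The two entries of \<epsilon> below secure \<eta>
    \<le> 1 and \<eta> (4 L + 2) \<le> \<delta>, so the determinant stays above 2 \<delta> -
    \<delta> in absolute value.\<close>
  define \<delta> where "\<delta> = (Vm / q\<^sup>2) * (Vm / q)"
  have \<delta>: "0 < \<delta>" using Vm q by (simp add: \<delta>_def)
  define \<epsilon> where "\<epsilon> = min (1 / (2 * C1 + 1)) (\<delta> / ((2 * C1 + 1) * (4 * L + 2)))"
  have \<epsilon>: "0 < \<epsilon>" using C1 L \<delta> by (auto simp: \<epsilon>_def intro!: divide_pos_pos mult_pos_pos add_nonneg_pos)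
  define C where "C = 2 * (2 * L + 1) * C0 / \<delta>"
  have C: "0 \<le> C" using L C0 \<delta> by (simp add: C_def)
  show ?thesis
  proof (rule exI[of _ \<epsilon>], rule conjI[OF \<epsilon>], rule exI[of _ C], rule conjI[OF C], intro allI impI, goal_cases)
    case (1 a b c \<xi> N)
    then have st: "small_state K a b c \<xi> N" and b\<epsilon>: "b < \<epsilon>" and Nb: "N \<le> b" by auto
    from st have nb: "near_blowup K a b c" and a: "1/4 \<le> a" "a \<le> 3/4" "a = 2 * c - 1/2" and b: "0 < b" and N: "0 \<le> N"
      by (auto simp: small_state_def near_blowup_def)
    note cb = near_blowup_c[OF nb]
    define e where "e k = (LINT y|lborel. rate_density p k a b c (b_rate p b c) (c_rate p b c) (exp (a / 4 * y\<^sup>2) * \<xi> y) y)" for k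
    define m where "m k = (LINT y|lborel. b_weight p k a b c y)" for k
    define n where "n k = (LINT y|lborel. c_weight p k a b c (exp (a / 4 * y\<^sup>2) * \<xi> y) y)" for k
    have rate: "orthogonality_rate p (mode k) \<xi> b c b1 c1 = e k + (b1 - b_rate p b c) * m k + (c1 - c_rate p b c) * n k"
      if k: "k = 0 \<or> k = 1" for k b1 c1
    proof -
      have c: "0 < c" using cb by simp
      have i: "integrable lborel (\<lambda>y. rate_density p k a b c (b_rate p b c) (c_rate p b c) (exp (a / 4 * y\<^sup>2) * \<xi> y) y)"
        "integrable lborel (b_weight p k a b c)" "integrable lborel (\<lambda>y. c_weight p k a b c (exp (a / 4 * y\<^sup>2) * \<xi> y) y)"
        using E[of k a b c \<xi> N] W[of k a b c \<xi> N] k st by blast+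
      have "has_bochner_integral lborel (\<lambda>y. rate_density p k a b c (b_rate p b c) (c_rate p b c) (exp (a / 4 * y\<^sup>2) * \<xi> y) y
          + (b1 - b_rate p b c) * b_weight p k a b c y
          + (c1 - c_rate p b c) * c_weight p k a b c (exp (a / 4 * y\<^sup>2) * \<xi> y) y)
        (e k + (b1 - b_rate p b c) * m k + (c1 - c_rate p b c) * n k)"
        unfolding e_def m_def n_def
        by (intro has_bochner_integral_add has_bochner_integral_mult_right has_bochner_integral_integrable i)
      then have "(LINT y|lborel. rate_density p k a b c b1 c1 (exp (a / 4 * y\<^sup>2) * \<xi> y) y)
          = e k + (b1 - b_rate p b c) * m k + (c1 - c_rate p b c) * n k"
        unfolding rate_density_affine[symmetric] by (rule has_bochner_integral_integral_eq)
      then show ?thesis unfolding orthogonality_rate_mode[OF assms(1) b c] a(3)[symmetric] .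
    qed
    define Z where "Z = sqrt (2 * pi / a)"
    define V0 where "V0 = (2 * c / q) powr (1 / q)"
    have Z: "1 \<le> Z" "Z \<le> sqrt (8 * pi)"
    proof -
      have "1 \<le> 2 * pi / a" using a pi_gt3 by (simp add: field_simps)
      then show "1 \<le> Z" unfolding Z_def by simp
      have "2 * pi / a \<le> 8 * pi" using a by (simp add: field_simps)
      then show "Z \<le> sqrt (8 * pi)" unfolding Z_def by (rule real_sqrt_le_mono)
    qed
    have V0: "Vm \<le> V0" "V0 \<le> VM" using cb q unfolding V0_def Vm_def VM_def
      by (auto intro!: powr_mono2 simp: divide_simps)
    define \<mu> where "\<mu> = Z * V0 / (q\<^sup>2 * a)"
    define \<nu> where "\<nu> = Z * V0 / (q * c)"
    have ZV1: "1 * Vm \<le> Z * V0" by (rule mult_mono) (use Z V0 Vm in auto)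
    have ZV2: "Z * V0 \<le> sqrt (8 * pi) * VM" by (rule mult_mono) (use Z V0 Vm in auto)
    note ZV = ZV1 ZV2
    have \<mu>: "Vm / q\<^sup>2 \<le> \<mu>" "\<mu> \<le> L"
    proof -
      have "Vm / q\<^sup>2 \<le> Z * V0 / (q\<^sup>2 * a)"
        using ZV Vm q a by (intro frac_le) (auto simp: mult_left_le)
      then show "Vm / q\<^sup>2 \<le> \<mu>" by (simp add: \<mu>_def)
      have "Z * V0 / (q\<^sup>2 * a) \<le> sqrt (8 * pi) * VM / (q\<^sup>2 * (1/4))"
        using ZV Vm q a by (intro frac_le) (auto intro: order_trans[OF less_imp_le])
      also have "\<dots> = sqrt (8 * pi) * VM * (4 / q\<^sup>2)" by simp
      also have "\<dots> \<le> L" using Vm q by (simp add: L_def)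
      finally show "\<mu> \<le> L" by (simp add: \<mu>_def)
    qed
    have \<nu>: "Vm / q \<le> \<nu>" "\<nu> \<le> L"
    proof -
      have "Vm / q \<le> Z * V0 / (q * c)"
        using ZV Vm q cb by (intro frac_le) (auto simp: mult_left_le)
      then show "Vm / q \<le> \<nu>" by (simp add: \<nu>_def)
      have "Z * V0 / (q * c) \<le> sqrt (8 * pi) * VM / (q * (3/8))"
        using ZV Vm q cb by (intro frac_le) (auto intro: order_trans[OF less_imp_le])
      also have "\<dots> = sqrt (8 * pi) * VM * (8 / 3 / q)" by simp
      also have "\<dots> \<le> L" using Vm q by (simp add: L_def)
      finally show "\<nu> \<le> L" by (simp add: \<nu>_def)
    qed
    have Vq: "0 \<le> Vm / q\<^sup>2" "0 \<le> Vm / q" using Vm q by simp_all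
    note \<mu>\<nu>0 = order_trans[OF Vq(1) \<mu>(1)] order_trans[OF Vq(2) \<nu>(1)]
    have \<delta>\<mu>\<nu>: "\<delta> \<le> \<mu> * \<nu>" unfolding \<delta>_def by (rule mult_mono[OF \<mu>(1) \<nu>(1) \<mu>\<nu>0(1) Vq(2)])
    \<comment> \<open>2 C1 b covers the error C1 (b + N), as N \<le> b.\<close>
    define \<eta> where "\<eta> = (2 * C1 + 1) * b"
    have "b < 1 / (2 * C1 + 1)" "b < \<delta> / ((2 * C1 + 1) * (4 * L + 2))" using b\<epsilon> by (auto simp: \<epsilon>_def)
    moreover have "0 < 2 * C1 + 1" "0 < (2 * C1 + 1) * (4 * L + 2)" using C1 L by (auto intro!: mult_pos_pos)
    ultimately have "b * (2 * C1 + 1) < 1" "b * ((2 * C1 + 1) * (4 * L + 2)) < \<delta>"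
      by (simp_all only: pos_less_divide_eq)
    then have \<eta>: "\<eta> \<le> 1" "\<eta> * (4 * L + 2) \<le> \<delta>"
      unfolding \<eta>_def by (simp_all only: mult_ac less_imp_le)
    have \<eta>le: "C1 * b \<le> \<eta>" "C1 * (b + N) \<le> \<eta>"
    proof -
      have "C1 * (b + N) \<le> C1 * (2 * b)" using Nb C1 by (intro mult_left_mono) auto
      moreover have "\<eta> = C1 * (2 * b) + b" by (simp add: \<eta>_def algebra_simps)
      moreover have "0 \<le> C1 * b" using C1 b by simp
      ultimately show "C1 * b \<le> \<eta>" "C1 * (b + N) \<le> \<eta>" using b by linarith+
    qed
    have w0: "\<bar>m 0 - \<mu>\<bar> \<le> \<eta>" "\<bar>n 0 + \<nu>\<bar> \<le> \<eta>"
      using W[of 0 a b c \<xi> N] st \<eta>le unfolding m_def n_def \<mu>_def \<nu>_def Z_def V0_def q_def by simp_all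
    have w1: "\<bar>m 1 + 2 * \<mu>\<bar> \<le> \<eta>" "\<bar>n 1\<bar> \<le> \<eta>"
      using W[of 1 a b c \<xi> N] st \<eta>le unfolding m_def n_def \<mu>_def \<nu>_def Z_def V0_def q_def by simp_all
    have det: "\<delta> \<le> \<bar>m 0 * n 1 - m 1 * n 0\<bar>"
      using perturbed_determinant[OF w0(1) w1(1) w0(2) w1(2) \<mu>\<nu>0(1) \<mu>(2) \<mu>\<nu>0(2) \<nu>(2) \<eta>(1)] \<eta>(2) \<delta>\<mu>\<nu> by linarith
    have bounds: "\<bar>m 0\<bar> \<le> 2 * L + 1" "\<bar>m 1\<bar> \<le> 2 * L + 1" "\<bar>n 0\<bar> \<le> 2 * L + 1" "\<bar>n 1\<bar> \<le> 2 * L + 1"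
      using w0 w1 \<eta>(1) \<mu>(2) \<nu>(2) \<mu>\<nu>0 L by linarith+
    have eb: "\<bar>e 0\<bar> \<le> C0 * remainder_size p b N" "\<bar>e 1\<bar> \<le> C0 * remainder_size p b N"
      using E[of 0 a b c \<xi> N] E[of 1 a b c \<xi> N] st unfolding e_def by auto
    obtain x y where xy: "e 0 + x * m 0 + y * n 0 = 0" "e 1 + x * m 1 + y * n 1 = 0"
      "\<bar>x\<bar> \<le> 2 * (2 * L + 1) * (C0 * remainder_size p b N) / \<delta>" "\<bar>y\<bar> \<le> 2 * (2 * L + 1) * (C0 * remainder_size p b N) / \<delta>"
      "\<And>x' y'. e 0 + x' * m 0 + y' * n 0 = 0 \<Longrightarrow> e 1 + x' * m 1 + y' * n 1 = 0 \<Longrightarrow> x' = x \<and> y' = y"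
      by (rule linear_2x2_solve[OF \<delta> det bounds eb]) blast
    show ?case
    proof (rule exI[of _ "b_rate p b c + x"], rule exI[of _ "c_rate p b c + y"], intro conjI allI)
      fix b1 c1
      show "(orthogonality_rate p phi0 \<xi> b c b1 c1 = 0 \<and> orthogonality_rate p phi2 \<xi> b c b1 c1 = 0)
          = (b1 = b_rate p b c + x \<and> c1 = c_rate p b c + y)"
        unfolding phi0_eq_mode phi2_eq_mode rate[OF disjI1[OF refl]] rate[OF disjI2[OF refl]]
        using xy(1,2) xy(5)[of "b1 - b_rate p b c" "c1 - c_rate p b c"] by auto
    next
      show "\<bar>b_rate p b c + x - b_rate p b c\<bar> \<le> C * remainder_size p b N"
        "\<bar>c_rate p b c + y - c_rate p b c\<bar> \<le> C * remainder_size p b N"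
        using xy(3,4) by (auto simp: C_def mult_ac)
    qed
  qed
qed

lemma remainder_bounds:
  assumes "1 < p" "0 \<le> K"
  shows "\<exists>\<epsilon>>0. \<exists>C\<ge>0. \<forall>a b c \<xi> N. small_state K a b c \<xi> N \<and> b < \<epsilon> \<and> N \<le> b \<longrightarrow>
    \<bar>R_b p \<xi> b c\<bar> \<le> C * remainder_size p b N \<and> \<bar>R_c p \<xi> b c\<bar> \<le> C * remainder_size p b N \<and>
    (\<forall>b1 c1. orthogonality_rate p phi0 \<xi> b c b1 c1 = 0 \<and> orthogonality_rate p phi2 \<xi> b c b1 c1 = 0 \<longrightarrow>
       velocity p \<xi> b c = (b1, c1))"
proof -
  from velocity_near_prediction[OF assms] obtain \<epsilon> C where \<epsilon>: "0 < \<epsilon>" and C: "0 \<le> C" and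
    H: "\<And>a b c \<xi> N. small_state K a b c \<xi> N \<and> b < \<epsilon> \<and> N \<le> b \<Longrightarrow>
    (\<exists>v1 v2. (\<forall>b1 c1. orthogonality_rate p phi0 \<xi> b c b1 c1 = 0 \<and> orthogonality_rate p phi2 \<xi> b c b1 c1 = 0
          \<longleftrightarrow> b1 = v1 \<and> c1 = v2) \<and>
      \<bar>v1 - b_rate p b c\<bar> \<le> C * remainder_size p b N \<and> \<bar>v2 - c_rate p b c\<bar> \<le> C * remainder_size p b N)"
    by blast
  \<comment> \<open>3 bounds 1 / c, since c \<ge> 3/8; \<open>R_c\<close> concerns c_tau / c and
    thus requires a division by c.\<close>
  have C': "0 \<le> 3 * C" using C by simp
  show ?thesis
  proof (rule exI[of _ \<epsilon>], rule conjI[OF \<epsilon>], rule exI[of _ "3 * C"], rule conjI[OF C'], intro allI impI, goal_cases)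
    case (1 a b c \<xi> N)
    from 1 have nb: "near_blowup K a b c" and b: "0 < b" and N: "0 \<le> N"
      by (auto simp: small_state_def near_blowup_def)
    note cb = near_blowup_c[OF nb]
    from H[OF 1] obtain v1 v2 where
      v: "\<And>b1 c1. orthogonality_rate p phi0 \<xi> b c b1 c1 = 0 \<and> orthogonality_rate p phi2 \<xi> b c b1 c1 = 0
          \<longleftrightarrow> b1 = v1 \<and> c1 = v2"
      and vb: "\<bar>v1 - b_rate p b c\<bar> \<le> C * remainder_size p b N" "\<bar>v2 - c_rate p b c\<bar> \<le> C * remainder_size p b N"
      by blast
    have vel: "velocity p \<xi> b c = (v1, v2)"
      unfolding velocity_def v by (rule the_equality) auto
    have \<rho>: "0 \<le> C * remainder_size p b N" using b N C by (simp add: remainder_size_def)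
    have "R_b p \<xi> b c = v1 - b_rate p b c" by (simp add: R_b_def vel b_rate_def)
    moreover have "R_c p \<xi> b c = (v2 - c_rate p b c) / c"
      using cb by (simp add: R_c_def vel c_rate_def diff_divide_distrib)
    moreover have "\<bar>(v2 - c_rate p b c) / c\<bar> \<le> (C * remainder_size p b N) / (1 / 3)"
      unfolding abs_divide using vb cb \<rho> by (intro frac_le) auto
    ultimately show ?case using vb(1) \<rho> v vel by auto
  qed
qed

section \<open>From the bootstrap bounds to the remainder estimate\<close>

text \<open>Continuity on a compact interval bounds the values above, which is what gives the real
  \<open>SUP\<close> a meaning.\<close>

lemma running_sup_ge:
  fixes f :: "real \<Rightarrow> real"
  assumes "continuous_on {0..t} f" "0 \<le> t"
  shows "f t \<le> (SUP s\<in>{0..t}. f s)"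
  using assms by (intro cSUP_upper bounded_imp_bdd_above compact_imp_bounded compact_continuous_image) auto

lemma beta_facts:
  assumes "1 < p" "0 < b0" "0 \<le> t"
  shows "0 < beta p b0 t" "beta p b0 t \<le> b0"
proof -
  have s: "0 \<le> 4 * p / (p - 1)\<^sup>2 * t" using assms by simp
  then have D: "0 < 1 / b0 + 4 * p / (p - 1)\<^sup>2 * t" using assms by (simp add: add_pos_nonneg)
  then show "0 < beta p b0 t" by (simp add: beta_def)
  have "1 / (1 / b0 + 4 * p / (p - 1)\<^sup>2 * t) \<le> 1 / (1 / b0)"
    by (intro divide_left_mono mult_pos_pos) (use s D assms in simp_all)
  then show "beta p b0 t \<le> b0" by (simp add: beta_def)
qed

lemma continuous_on_beta_powr:
  assumes "1 < p" "0 < b0" "S \<subseteq> {0..}"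
  shows "continuous_on S (\<lambda>t. beta p b0 t powr e)"
proof -
  have "1 / b0 + 4 * p / (p - 1)\<^sup>2 * t \<noteq> 0" if "t \<in> S" for t
  proof -
    have "0 \<le> 4 * p / (p - 1)\<^sup>2 * t" using that assms by auto
    moreover have "0 < 1 / b0" using assms by simp
    ultimately show ?thesis by linarith
  qed
  then show ?thesis
    unfolding beta_def by (intro continuous_intros) auto
qed

text \<open>The 8 is the cube of the factor in b \<le> 2 \<beta>; the mixed term costs only 2, and
  the last two terms agree exactly for N = \<beta>^2 m.\<close>

lemma remainder_size_le_order:
  assumes "1 < p" "0 < \<beta>" "0 \<le> b" "b \<le> 2 * \<beta>" "0 \<le> m" "0 \<le> A0"
  shows "remainder_size p b (\<beta>\<^sup>2 * m) \<le> 8 * remainder_order p \<beta> m A0"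
proof -
  have "b ^ 3 \<le> (2 * \<beta>) ^ 3" using assms by (intro power_mono) auto
  then have 1: "b ^ 3 \<le> 8 * \<beta> ^ 3" by (simp add: power_mult_distrib)
  have "b * (\<beta>\<^sup>2 * m) \<le> (2 * \<beta>) * (\<beta>\<^sup>2 * m)" using assms by (intro mult_right_mono) auto
  also have "\<dots> = 2 * (\<beta> ^ 3 * m * 1)" by (simp add: power2_eq_square power3_eq_cube)
  also have "\<dots> \<le> 2 * (\<beta> ^ 3 * m * (1 + A0))" using assms by (intro mult_left_mono) auto
  finally have 2: "b * (\<beta>\<^sup>2 * m) \<le> 2 * (\<beta> ^ 3 * m * (1 + A0))" .
  have 3: "(\<beta>\<^sup>2 * m)\<^sup>2 = \<beta> ^ 4 * m\<^sup>2" by (simp add: power_mult_distrib flip: power_mult)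
  have 4: "(\<beta>\<^sup>2 * m) powr p = \<beta> powr (2 * p) * m powr p"
    using assms by (simp add: powr_mult powr_powr flip: powr_numeral)
  define X where "X = \<beta> ^ 3 * m * (1 + A0)"
  have "0 \<le> X" "0 \<le> \<beta> ^ 4 * m\<^sup>2" "0 \<le> \<beta> powr (2 * p) * m powr p"
    using assms by (auto simp: X_def)
  moreover have "u + v + w + z \<le> 8 * (s + X + w + z)"
    if "u \<le> 8 * s" "v \<le> 2 * X" "0 \<le> X" "0 \<le> w" "0 \<le> z" for u v w z s :: real
  proof -
    have "v \<le> 8 * X" "w \<le> 8 * w" "z \<le> 8 * z" using that by simp_all
    then show ?thesis unfolding distrib_left using that(1) by (intro add_mono)
  qed
  ultimately show ?thesis
    using 1 2 unfolding remainder_size_def remainder_order_def 3 4 X_def[symmetric] by blast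
qed

section \<open>Bootstrap quantities along the flow\<close>

context blowup_flow
begin

lemma A_ge:
  assumes "\<tau> \<in> {0..T}"
  shows "\<bar>a \<tau> - 1/2 + 2 * b \<tau> / (p - 1)\<bar> \<le> (beta p (b 0) \<tau>)\<^sup>2 * A p a b \<tau>" "0 \<le> A p a b \<tau>"
proof -
  have b0: "0 < b 0" and sub: "{0..\<tau>} \<subseteq> {0..T}" using pos(2)[of 0] T assms by auto
  define \<beta> where "\<beta> = beta p (b 0) \<tau>"
  have \<beta>: "0 < \<beta>" using beta_facts[OF p b0] assms by (simp add: \<beta>_def)
  have le: "\<beta> powr (-2) * \<bar>a \<tau> - 1/2 + 2 * b \<tau> / (p - 1)\<bar> \<le> A p a b \<tau>"
    unfolding A_def \<beta>_def
    by (rule running_sup_ge) (use assms p in \<open>auto intro!: continuous_intros continuous_on_beta_powr p b0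
        continuous_on_subset[OF cont(1) sub] continuous_on_subset[OF cont(2) sub]\<close>)
  then show "0 \<le> A p a b \<tau>" by (rule order_trans[rotated]) simp
  have "\<beta>\<^sup>2 * (\<beta> powr (-2) * \<bar>a \<tau> - 1/2 + 2 * b \<tau> / (p - 1)\<bar>) \<le> \<beta>\<^sup>2 * A p a b \<tau>"
    using le by (intro mult_left_mono) auto
  moreover have "\<beta>\<^sup>2 * \<beta> powr (-2) = 1" using \<beta> by (simp add: powr_minus)
  ultimately show "\<bar>a \<tau> - 1/2 + 2 * b \<tau> / (p - 1)\<bar> \<le> (beta p (b 0) \<tau>)\<^sup>2 * A p a b \<tau>"
    unfolding \<beta>_def[symmetric] mult.assoc[symmetric] by simp
qed

lemma B_ge:
  assumes "\<tau> \<in> {0..T}"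
  shows "\<bar>b \<tau> - beta p (b 0) \<tau>\<bar> \<le> beta p (b 0) \<tau> powr (1 + kappa p) * B p b \<tau>"
proof -
  have b0: "0 < b 0" and sub: "{0..\<tau>} \<subseteq> {0..T}" using pos(2)[of 0] T assms by auto
  define \<beta> where "\<beta> = beta p (b 0) \<tau>"
  have \<beta>: "0 < \<beta>" using beta_facts[OF p b0] assms by (simp add: \<beta>_def)
  have c1: "continuous_on {0..\<tau>} (beta p (b 0))"
  proof (rule continuous_on_eq[OF continuous_on_beta_powr[OF p b0, of _ 1]])
    show "beta p (b 0) t powr 1 = beta p (b 0) t" if "t \<in> {0..\<tau>}" for t
      using beta_facts(1)[OF p b0, of t] that by simp
  qed auto
  have le: "\<beta> powr (- (1 + kappa p)) * \<bar>b \<tau> - \<beta>\<bar> \<le> B p b \<tau>"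
    unfolding B_def \<beta>_def
    by (rule running_sup_ge) (use assms in \<open>auto intro!: continuous_intros continuous_on_beta_powr p b0 c1
        continuous_on_subset[OF cont(2) sub]\<close>)
  have "\<beta> powr (1 + kappa p) * (\<beta> powr (- (1 + kappa p)) * \<bar>b \<tau> - \<beta>\<bar>) \<le> \<beta> powr (1 + kappa p) * B p b \<tau>"
    using le by (intro mult_left_mono) auto
  moreover have "\<beta> powr (1 + kappa p) * \<beta> powr (- (1 + kappa p)) = 1"
    using \<beta> by (simp flip: powr_add)
  ultimately show ?thesis unfolding \<beta>_def[symmetric] by (simp add: mult.assoc[symmetric])
qed

text \<open>Continuity in time of the weighted norm is not established, so the supremum is bounded
  instead by the uniform bound on the weighted \<xi> times the maximum of \<beta>^(-2) on the
  interval.\<close>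

lemma M1_ge:
  assumes "\<tau> \<in> {0..T}"
  shows "\<bar>weighted a \<xi> y \<tau>\<bar> \<le> (beta p (b 0) \<tau>)\<^sup>2 * M1 p (b 0) a \<xi> \<tau>" "0 \<le> M1 p (b 0) a \<xi> \<tau>"
proof -
  have b0: "0 < b 0" using pos(2)[of 0] T by auto
  define \<beta> where "\<beta> = beta p (b 0) \<tau>"
  have \<beta>: "0 < \<beta>" using beta_facts[OF p b0] assms by (simp add: \<beta>_def)
  from bounded obtain N where N: "\<And>y \<tau>. \<tau> \<in> {0..T} \<Longrightarrow> \<bar>weighted a \<xi> y \<tau>\<bar> \<le> N"
    unfolding bounded_iff by fastforce
  define s where "s t = (SUP y. \<bar>weighted a \<xi> y t\<bar>)" for t
  have bdd: "bdd_above (range (\<lambda>y. \<bar>weighted a \<xi> y t\<bar>))" if "t \<in> {0..T}" for t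
    using N[OF that] by (intro bdd_aboveI2)
  have s_ge: "\<bar>weighted a \<xi> y t\<bar> \<le> s t" if "t \<in> {0..T}" for y t
    unfolding s_def by (rule cSUP_upper[OF _ bdd[OF that]]) simp
  have s_le: "s t \<le> N" if "t \<in> {0..T}" for t
    unfolding s_def using N[OF that] by (intro cSUP_least) auto
  have s0: "0 \<le> s t" if "t \<in> {0..T}" for t using order_trans[OF abs_ge_zero s_ge[OF that]] .
  have "\<exists>x\<in>{0..\<tau>}. \<forall>t\<in>{0..\<tau>}. beta p (b 0) t powr (-2) \<le> beta p (b 0) x powr (-2)"
    using assms by (intro continuous_attains_sup continuous_on_beta_powr p b0) auto
  then obtain x where x: "\<And>t. t \<in> {0..\<tau>} \<Longrightarrow> beta p (b 0) t powr (-2) \<le> beta p (b 0) x powr (-2)" by blast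
  have "bdd_above ((\<lambda>t. beta p (b 0) t powr (-2) * s t) ` {0..\<tau>})"
  proof (rule bdd_aboveI2)
    fix t assume t: "t \<in> {0..\<tau>}"
    then have "t \<in> {0..T}" using assms by auto
    then show "beta p (b 0) t powr (-2) * s t \<le> beta p (b 0) x powr (-2) * N"
      using x[OF t] s_le s0 by (intro mult_mono) auto
  qed
  then have le: "\<beta> powr (-2) * s \<tau> \<le> M1 p (b 0) a \<xi> \<tau>"
    unfolding M1_def s_def \<beta>_def using assms by (intro cSUP_upper) auto
  have "0 \<le> \<beta> powr (-2) * s \<tau>" using s0[OF assms] by simp
  then show "0 \<le> M1 p (b 0) a \<xi> \<tau>" using le by linarith
  have "\<beta>\<^sup>2 * (\<beta> powr (-2) * s \<tau>) \<le> \<beta>\<^sup>2 * M1 p (b 0) a \<xi> \<tau>"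
    using le by (intro mult_left_mono) auto
  moreover have "\<beta>\<^sup>2 * \<beta> powr (-2) = 1" using \<beta> by (simp add: powr_minus)
  ultimately have "s \<tau> \<le> \<beta>\<^sup>2 * M1 p (b 0) a \<xi> \<tau>"
    unfolding mult.assoc[symmetric] by simp
  then show "\<bar>weighted a \<xi> y \<tau>\<bar> \<le> (beta p (b 0) \<tau>)\<^sup>2 * M1 p (b 0) a \<xi> \<tau>"
    using s_ge[OF assms, of y] unfolding \<beta>_def by linarith
qed

text \<open>Each bootstrap bound loses a factor \<beta>^(-\<kappa>/2), while a small b(0) makes
  \<beta>^(\<kappa>/2) \<le> 1/2 at all times. Then b lies within \<beta>/2 of \<beta>, and
  \<beta>^2 A and \<beta>^2 M1 are at most \<beta>/2, hence at most b.\<close>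

lemma state_small:
  assumes \<tau>: "\<tau> \<in> {0..T}"
    and hyp: "A p a b \<tau> \<le> beta p (b 0) \<tau> powr (- kappa p / 2)"
      "B p b \<tau> \<le> beta p (b 0) \<tau> powr (- kappa p / 2)"
      "M1 p (b 0) a \<xi> \<tau> \<le> beta p (b 0) \<tau> powr (- kappa p / 2)"
    and orth: "(LINT y|lborel. \<xi> y \<tau> * phi0 (a \<tau>) y) = 0" "(LINT y|lborel. \<xi> y \<tau> * phi2 (a \<tau>) y) = 0"
    and K: "K = 2 / (p - 1) + 2"
    and b0: "b 0 < (1/2) powr (2 / kappa p)" "b 0 < 1/2" "b 0 < 1 / (8 * K)"
  defines "\<beta> \<equiv> beta p (b 0) \<tau>"
  shows "small_state K (a \<tau>) (b \<tau>) (c \<tau>) (\<lambda>y. \<xi> y \<tau>) (\<beta>\<^sup>2 * M1 p (b 0) a \<xi> \<tau>)"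
    and "small_state K (a \<tau>) (b \<tau>) (c \<tau>) (\<lambda>y. 0) 0"
    and "b \<tau> \<le> 2 * \<beta>" "\<beta>\<^sup>2 * M1 p (b 0) a \<xi> \<tau> \<le> b \<tau>" "0 < \<beta>" "\<beta> \<le> b 0"
proof -
  have bpos: "0 < b 0" using pos(2)[of 0] T by auto
  show \<beta>: "0 < \<beta>" "\<beta> \<le> b 0" unfolding \<beta>_def using beta_facts[OF p bpos] \<tau> by auto
  define k where "k = kappa p"
  have k: "0 < k" "k \<le> 1/2" using p by (auto simp: k_def kappa_def)
  have Kpos: "2 \<le> K" using p by (simp add: K)
  have \<beta>k: "\<beta> powr (k / 2) \<le> 1/2"
  proof -
    have "\<beta> powr (k / 2) \<le> ((1/2) powr (2 / k)) powr (k / 2)"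
      using \<beta> b0(1) k by (intro powr_mono2) (auto simp: k_def)
    also have "\<dots> = 1/2" using k by (simp add: powr_powr)
    finally show ?thesis .
  qed
  have g1: "\<beta> \<le> 1" using \<beta> b0 by linarith
  \<comment> \<open>The exponent left over is 2 - \<kappa>/2 \<ge> 1 + \<kappa>/2, as \<kappa> \<le>
    1/2.\<close>
  have sq: "\<beta>\<^sup>2 * \<beta> powr (- k / 2) \<le> \<beta> / 2"
  proof -
    have "\<beta>\<^sup>2 * \<beta> powr (- k / 2) = \<beta> powr (1 + (1 - k / 2))"
      using \<beta> by (simp flip: powr_add powr_numeral)
    also have "\<dots> = \<beta> * \<beta> powr (1 - k / 2)" using \<beta> by (simp only: powr_add) simp
    also have "\<dots> \<le> \<beta> * \<beta> powr (k / 2)"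
      using \<beta> g1 k by (intro mult_left_mono powr_mono') auto
    also have "\<dots> \<le> \<beta> * (1/2)" using \<beta>k \<beta> by (intro mult_left_mono) auto
    finally show ?thesis by simp
  qed
  have "\<bar>b \<tau> - \<beta>\<bar> \<le> \<beta> powr (1 + k) * \<beta> powr (- k / 2)"
    using order_trans[OF B_ge[OF \<tau>] mult_left_mono[OF hyp(2)]] unfolding \<beta>_def k_def by simp
  also have "\<dots> = \<beta> powr (1 + k / 2)" by (simp add: add.commute flip: powr_add)
  also have "\<dots> = \<beta> * \<beta> powr (k / 2)" using \<beta> by (simp only: powr_add) simp
  also have "\<dots> \<le> \<beta> * (1/2)" using \<beta>k \<beta> by (intro mult_left_mono) auto
  finally have b\<beta>: "\<bar>b \<tau> - \<beta>\<bar> \<le> \<beta> / 2" by simp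
  then show b2: "b \<tau> \<le> 2 * \<beta>" using \<beta> by linarith
  have \<beta>b: "\<beta> / 2 \<le> b \<tau>" using b\<beta> by linarith
  have "\<beta>\<^sup>2 * M1 p (b 0) a \<xi> \<tau> \<le> \<beta>\<^sup>2 * \<beta> powr (- k / 2)"
    using hyp(3) unfolding \<beta>_def k_def by (intro mult_left_mono) auto
  then show Nb: "\<beta>\<^sup>2 * M1 p (b 0) a \<xi> \<tau> \<le> b \<tau>" using sq \<beta>b by linarith
  have "\<beta>\<^sup>2 * A p a b \<tau> \<le> \<beta>\<^sup>2 * \<beta> powr (- k / 2)"
    using hyp(1) unfolding \<beta>_def k_def by (intro mult_left_mono) auto
  then have "\<bar>a \<tau> - 1/2 + 2 * b \<tau> / (p - 1)\<bar> \<le> \<beta> / 2"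
    using A_ge(1)[OF \<tau>] sq unfolding \<beta>_def[symmetric] by linarith
  moreover have "0 < 2 * b \<tau> / (p - 1)" using pos(2)[OF \<tau>] p by simp
  moreover have "K * b \<tau> = 2 * b \<tau> / (p - 1) + 2 * b \<tau>" by (simp add: K algebra_simps)
  \<comment> \<open>Origin of \<open>K\<close>: its part 2 / (p - 1) absorbs the b-term inside
    \<open>A\<close>, and its part 2 absorbs the remaining \<beta>/2 \<le> b.\<close>
  ultimately have a: "\<bar>a \<tau> - 1/2\<bar> \<le> K * b \<tau>" using \<beta>b pos(2)[OF \<tau>] by linarith
  have "K * b \<tau> \<le> K * (2 * b 0)" using Kpos b2 \<beta> by (intro mult_left_mono) auto
  also have "\<dots> \<le> 1/4" using b0(3) Kpos by (simp add: field_simps)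
  finally have Kb: "K * b \<tau> \<le> 1/4" .
  have "c \<tau> - a \<tau> = - (a \<tau> - 1/2) / 2" using ac[OF \<tau>] by simp
  then have ca: "\<bar>c \<tau> - a \<tau>\<bar> \<le> K * b \<tau>" using a by (simp add: abs_if split: if_splits)
  have nb: "near_blowup K (a \<tau>) (b \<tau>) (c \<tau>)"
    unfolding near_blowup_def
  proof (intro conjI)
    show "a \<tau> = 2 * c \<tau> - 1/2" by (rule ac[OF \<tau>])
    show "1/4 \<le> a \<tau>" "a \<tau> \<le> 3/4" using a Kb by linarith+
    show "0 < b \<tau>" by (rule pos(2)[OF \<tau>])
    show "b \<tau> \<le> 1" using b2 \<beta> b0 by linarith
    show "\<bar>c \<tau> - a \<tau>\<bar> \<le> K * b \<tau>" by (rule ca)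
  qed
  show "small_state K (a \<tau>) (b \<tau>) (c \<tau>) (\<lambda>y. 0) 0"
    using nb by (simp add: small_state_def)
  have "(\<lambda>y. \<xi> y \<tau>) \<in> borel_measurable borel"
    by (rule borel_measurable_continuous_onI[OF cont_sections(1)[OF cont_\<xi> \<tau>]])
  then show "small_state K (a \<tau>) (b \<tau>) (c \<tau>) (\<lambda>y. \<xi> y \<tau>) (\<beta>\<^sup>2 * M1 p (b 0) a \<xi> \<tau>)"
    unfolding small_state_def
    using nb orth M1_ge(2)[OF \<tau>] weighted_bound[OF M1_ge(1)[OF \<tau>]] by (auto simp: \<beta>_def)
qed

end

theorem proposition7:
  fixes p :: real
  assumes "1 < p"
  shows "\<exists>\<epsilon>>0. \<exists>C>0. \<forall>T>0. \<forall>(a :: real \<Rightarrow> real) a' b b' c c' (\<xi> :: real \<Rightarrow> real \<Rightarrow> real).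
     C1_on_interval T a a' \<and> C1_on_interval T b b' \<and> C1_on_interval T c c' \<and>
     (\<forall>\<tau>\<in>{0..T}. 0 < a \<tau> \<and> 0 < b \<tau> \<and> 0 < c \<tau> \<and> a \<tau> = 2 * c \<tau> - 1/2) \<and>
     (\<forall>\<tau>\<in>{0..T}. \<forall>y. \<xi> (- y) \<tau> = \<xi> y \<tau>) \<and>
     bounded ((\<lambda>(y, \<tau>). weighted a \<xi> y \<tau>) ` (UNIV \<times> {0..T})) \<and>
     b 0 < \<epsilon> \<and> 1/4 \<le> c 0 \<and> c 0 \<le> 1 \<and>
     (\<forall>\<tau>\<in>{0..T}.
        A p a b \<tau> \<le> beta p (b 0) \<tau> powr (- kappa p / 2) \<and>
        B p b \<tau> \<le> beta p (b 0) \<tau> powr (- kappa p / 2) \<and>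
        M1 p (b 0) a \<xi> \<tau> \<le> beta p (b 0) \<tau> powr (- kappa p / 2)) \<and>
     solves_w_equation p T a a' (\<lambda>y \<tau>. profile p (a \<tau>) (b \<tau>) (c \<tau>) y + \<xi> y \<tau>) \<and>
     (\<forall>\<tau>\<in>{0..T}. (LINT y|lborel. \<xi> y \<tau> * phi0 (a \<tau>) y) = 0 \<and>
                  (LINT y|lborel. \<xi> y \<tau> * phi2 (a \<tau>) y) = 0)
     \<longrightarrow>
     (\<forall>\<tau>\<in>{0..T}.
        b' \<tau> = - (2 * (3 * p - 1) / (p - 1)\<^sup>2) * (b \<tau>)\<^sup>2 + 2 * b \<tau> * (c \<tau> - a \<tau>)
                 + R_b p (\<lambda>y. \<xi> y \<tau>) (b \<tau>) (c \<tau>) \<and>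
        c' \<tau> / c \<tau> = 2 * (c \<tau> - a \<tau>) - 2 / (p - 1) * b \<tau>
                 + R_c p (\<lambda>y. \<xi> y \<tau>) (b \<tau>) (c \<tau>) \<and>
        \<bar>R_b p (\<lambda>y. \<xi> y \<tau>) (b \<tau>) (c \<tau>)\<bar>
          \<le> C * remainder_order p (beta p (b 0) \<tau>) (M1 p (b 0) a \<xi> \<tau>) (A p a b \<tau>) \<and>
        \<bar>R_c p (\<lambda>y. \<xi> y \<tau>) (b \<tau>) (c \<tau>)\<bar>
          \<le> C * remainder_order p (beta p (b 0) \<tau>) (M1 p (b 0) a \<xi> \<tau>) (A p a b \<tau>) \<and>
        \<bar>R_b p (\<lambda>y. 0) (b \<tau>) (c \<tau>)\<bar> \<le> C * (b \<tau>)^3 \<and>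
        \<bar>R_c p (\<lambda>y. 0) (b \<tau>) (c \<tau>)\<bar> \<le> C * (b \<tau>)^3)"
proof -
  define K where "K = 2 / (p - 1) + 2"
  have K: "2 \<le> K" using assms by (simp add: K_def)
  have K0: "0 \<le> K" using K by simp
  from remainder_bounds[OF assms K0] obtain \<epsilon>0 C where \<epsilon>0: "0 < \<epsilon>0" and C: "0 \<le> C" and
    R: "\<And>a b c \<xi> N. small_state K a b c \<xi> N \<and> b < \<epsilon>0 \<and> N \<le> b \<Longrightarrow>
    \<bar>R_b p \<xi> b c\<bar> \<le> C * remainder_size p b N \<and> \<bar>R_c p \<xi> b c\<bar> \<le> C * remainder_size p b N \<and>
    (\<forall>b1 c1. orthogonality_rate p phi0 \<xi> b c b1 c1 = 0 \<and> orthogonality_rate p phi2 \<xi> b c b1 c1 = 0 \<longrightarrow>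
       velocity p \<xi> b c = (b1, c1))" by blast
  \<comment> \<open>\<epsilon>0 is halved because b(\<tau>) \<le> 2 \<beta> \<le> 2 b(0); the other
    entries are the smallness conditions of \<open>state_small\<close>.\<close>
  define \<epsilon> where "\<epsilon> = min (\<epsilon>0 / 2) (min ((1/2) powr (2 / kappa p)) (min (1/2) (1 / (8 * K))))"
  have \<epsilon>: "0 < \<epsilon>" using \<epsilon>0 K by (simp add: \<epsilon>_def)
  \<comment> \<open>The 8 comes from \<open>remainder_size_le_order\<close>; the 1 makes the
    constant positive even if C = 0.\<close>
  have C1: "0 < 8 * C + 1" using C by simp
  show ?thesis
  proof (rule exI[of _ \<epsilon>], rule conjI[OF \<epsilon>], rule exI[of _ "8 * C + 1"], rule conjI[OF C1],
      intro allI impI ballI, goal_cases)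
    case (1 T a a' b b' c c' \<xi> \<tau>)
    note T = 1(1) and H = 1(2) and \<tau> = 1(3)
    interpret blowup_flow p T a a' b b' c c' \<xi>
      by unfold_locales (use assms T H in blast)+
    have orth: "(LINT y|lborel. \<xi> y t * phi0 (a t) y) = 0" "(LINT y|lborel. \<xi> y t * phi2 (a t) y) = 0"
      if "t \<in> {0..T}" for t using H that by auto
    have hyp: "A p a b \<tau> \<le> beta p (b 0) \<tau> powr (- kappa p / 2)"
      "B p b \<tau> \<le> beta p (b 0) \<tau> powr (- kappa p / 2)"
      "M1 p (b 0) a \<xi> \<tau> \<le> beta p (b 0) \<tau> powr (- kappa p / 2)"
      using H \<tau> by auto
    have b0: "b 0 < (1/2) powr (2 / kappa p)" "b 0 < 1/2" "b 0 < 1 / (8 * K)" "b 0 < \<epsilon>0 / 2"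
      using H by (auto simp: \<epsilon>_def)
    note st = state_small[OF \<tau> hyp orth[OF \<tau>] K_def b0(1-3)]
    define \<beta> where "\<beta> = beta p (b 0) \<tau>"
    define m where "m = M1 p (b 0) a \<xi> \<tau>"
    have b: "0 < b \<tau>" "b \<tau> < \<epsilon>0" using st b0(4) pos(2)[OF \<tau>] by auto
    have rem: "remainder_size p (b \<tau>) (\<beta>\<^sup>2 * m) \<le> 8 * remainder_order p \<beta> m (A p a b \<tau>)"
      unfolding \<beta>_def m_def using st b A_ge(2)[OF \<tau>] M1_ge(2)[OF \<tau>]
      by (intro remainder_size_le_order assms) auto
    have ord: "0 \<le> remainder_order p \<beta> m (A p a b \<tau>)"
      unfolding remainder_order_def \<beta>_def m_def using st A_ge(2)[OF \<tau>] M1_ge(2)[OF \<tau>] by simp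
    have "C * remainder_size p (b \<tau>) (\<beta>\<^sup>2 * m) \<le> C * (8 * remainder_order p \<beta> m (A p a b \<tau>))"
      using rem C by (rule mult_left_mono)
    also have "\<dots> \<le> (8 * C + 1) * remainder_order p \<beta> m (A p a b \<tau>)" using ord by (simp add: algebra_simps)
    finally have le: "C * remainder_size p (b \<tau>) (\<beta>\<^sup>2 * m) \<le> (8 * C + 1) * remainder_order p \<beta> m (A p a b \<tau>)" .
    have R1: "\<bar>R_b p (\<lambda>y. \<xi> y \<tau>) (b \<tau>) (c \<tau>)\<bar> \<le> C * remainder_size p (b \<tau>) (\<beta>\<^sup>2 * m)"
      "\<bar>R_c p (\<lambda>y. \<xi> y \<tau>) (b \<tau>) (c \<tau>)\<bar> \<le> C * remainder_size p (b \<tau>) (\<beta>\<^sup>2 * m)"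
      and vel: "\<And>b1 c1. orthogonality_rate p phi0 (\<lambda>y. \<xi> y \<tau>) (b \<tau>) (c \<tau>) b1 c1 = 0 \<Longrightarrow>
        orthogonality_rate p phi2 (\<lambda>y. \<xi> y \<tau>) (b \<tau>) (c \<tau>) b1 c1 = 0 \<Longrightarrow>
        velocity p (\<lambda>y. \<xi> y \<tau>) (b \<tau>) (c \<tau>) = (b1, c1)"
      using R[of "a \<tau>" "b \<tau>" "c \<tau>" "\<lambda>y. \<xi> y \<tau>" "\<beta>\<^sup>2 * m"] st b unfolding \<beta>_def m_def by blast+
    \<comment> \<open>The same b and c with \<xi> = 0 and N = 0, where \<open>remainder_size\<close>
      collapses to b^3.\<close>
    have R0: "\<bar>R_b p (\<lambda>y. 0) (b \<tau>) (c \<tau>)\<bar> \<le> C * (b \<tau>) ^ 3" "\<bar>R_c p (\<lambda>y. 0) (b \<tau>) (c \<tau>)\<bar> \<le> C * (b \<tau>) ^ 3"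
      using R[of "a \<tau>" "b \<tau>" "c \<tau>" "\<lambda>y. 0" 0] st b by (auto simp: remainder_size_def)
    have "C * (b \<tau>) ^ 3 \<le> (8 * C + 1) * (b \<tau>) ^ 3" using C b by (intro mult_right_mono) auto
    note R0' = order_trans[OF R0(1) this] order_trans[OF R0(2) this]
    \<comment> \<open>b' and c' annihilate both rates, so by uniqueness they are the value of
      \<open>velocity\<close>; the two differential equations then restate the definitions of
      \<open>R_b\<close> and \<open>R_c\<close>.\<close>
    have "velocity p (\<lambda>y. \<xi> y \<tau>) (b \<tau>) (c \<tau>) = (b' \<tau>, c' \<tau>)"
      using rate_zero[of 0, OF _ _ _ \<tau>] rate_zero[of 1, OF _ _ _ \<tau>] orth
      by (intro vel) (simp_all add: phi0_eq_mode phi2_eq_mode)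
    then have "b' \<tau> = - (2 * (3 * p - 1) / (p - 1)\<^sup>2) * (b \<tau>)\<^sup>2 + 2 * b \<tau> * (c \<tau> - a \<tau>)
                 + R_b p (\<lambda>y. \<xi> y \<tau>) (b \<tau>) (c \<tau>)"
      "c' \<tau> / c \<tau> = 2 * (c \<tau> - a \<tau>) - 2 / (p - 1) * b \<tau> + R_c p (\<lambda>y. \<xi> y \<tau>) (b \<tau>) (c \<tau>)"
      unfolding ac[OF \<tau>] by (simp_all add: R_b_def R_c_def)
    then show ?case
      using order_trans[OF R1(1) le] order_trans[OF R1(2) le] R0' unfolding \<beta>_def m_def by blast
  qed
qed

end
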